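(* Suppose that the rate function $f:\mathbb{R}\to\mathbb{R}_+$ is Lipschitz continuous with Lipschitz constant $\|f\|_{Lip}$, that $\int \sum_{i=1}^L |c_i|\, G(dc_1,\ldots,dc_L)<\infty$, and that $$\|f\|_{Lip}\left(\int \sum_{i=1}^L \frac{1}{\alpha^{n_i}}|c_i|\, G(dc_1,\ldots,dc_L)\right)<\alpha .$$ Let $b:\{0,1,\ldots,n+1\}\to\mathbb{R}_+$ be a strictly increasing function such that $$\frac{b(n+1)}{b(1)}\,\|f\|_{Lip}\left(\int \sum_{i=1}^L \frac{1}{\alpha^{n_i}}|c_i|\, G(dc_1,\ldots,dc_L)\right)<\alpha .$$ Put $b_*=\min\{b(k+1)-b(k): 0\le k\le n\}$, $$C=\frac{A^n\vee 1}{1\wedge \alpha^{n+1}}\,\frac{b(n+1)}{b(1)},\qquad d=\Big(\alpha-\|f\|_{Lip}\frac{b(n+1)}{b(1)}\int\sum_{i=1}^L \alpha_i^{-n_i}|c_i|\,G(dc_1,\ldots,dc_L)\Big)\wedge\Big(\frac{\alpha\, b_*}{b(n+1)}\Big).$$ 1. For any probability measures $\mu$ and $\nu$ on $\mathcal{B}(\mathbb{R}^\kappa)$ and all $t\ge 0$, $$W_1(\mu P_t,\nu P_t)\le C e^{-dt}\,W_1(\mu,\nu).$$ 2. In particular, there exists a unique invariant probability measure $\pi$ of the process $X$, and for any probability measure $\nu$ on $\mathcal{B}(\mathbb{R}^\kappa)$ and all $t\ge0$, $$W_1(\pi,\nu P_t)\le C e^{-dt}\,W_1(\pi,\nu).$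$
   Context: $\mathbb{N}$ denotes the non-negative integers. Fix $L\ge 1$, $\alpha_1,\ldots,\alpha_L>0$, $n_1,\ldots,n_L\in\mathbb{N}$, and put $\kappa=L+\sum_{i=1}^L n_i$, $n=\max_i n_i$, $\alpha=\min_i\alpha_i$, $A=\max_i\alpha_i$. Elements of $\mathbb{R}^\kappa$ are written $x=(x^{(1)},\ldots,x^{(L)})$ with $x^{(i)}=(x^{(i,0)},\ldots,x^{(i,n_i)})$; $e_{(i,n_i)}\in\mathbb{R}^\kappa$ is the unit vector with entry $1$ in coordinate $(i,n_i)$. Let $F:\mathbb{R}^\kappa\to\mathbb{R}^\kappa$ be the vector field with $F^{(i,k)}(x)=-\alpha_i x^{(i,k)}+x^{(i,k+1)}$ for $0\le k<n_i$ and $F^{(i,n_i)}(x)=-\alpha_i x^{(i,n_i)}$. Let $G$ be a probability measure on $\mathbb{R}^L$. $X=(X_t)_{t\ge0}$ is the piecewise deterministic Markov process with càdlàg paths in $\mathbb{R}^\kappa$ whose generator is, for smooth bounded $g:\mathbb{R}^\kappa\to\mathbb{R}$, $$\mathcal{L}g(x)=\langle F(x),\nabla g(x)\rangle+f\Big(\sum_{i=1}^L x^{(i,0)}\Big)\int\Big(g\big(x+\sum_{i=1}^L c_i e_{(i,n_i)}\big)-g(x)\Big)G(dc_1,\ldots,dc_L).$$ That is, between jumps $X$ follows the flow of $\dot x=F(x)$, it jumps at rate $f(\sum_i x^{(i,0)})$ when in state $x$, and at each jump $\sum_i c_i e_{(i,n_i)}$ is added, with $(c_1,\ldots,c_L)$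 freshly drawn from $G$. $(P_t)_{t\ge0}$ is the transition semigroup of $X$. $\|x\|_1=\sum_{i=1}^L\sum_{k=0}^{n_i}|x^{(i,k)}|$. For probability measures $\mu,\nu$ on $\mathbb{R}^\kappa$, $W_1(\mu,\nu)=\inf\{\int\int\|x-y\|_1\gamma(dx,dy):\gamma\in\Gamma(\mu,\nu)\}$, where $\Gamma(\mu,\nu)$ is the set of all probability measures on $\mathbb{R}^\kappa\times\mathbb{R}^\kappa$ with marginals $\mu$ and $\nu$. *)

theory Defs
  imports "HOL-Probability.Probability"
begin

text \<open>
  A point of \<open>\<real>\<^sup>\<kappa>\<close>, \<open>\<kappa> = L + n 1 + \<dots> + n L\<close>, is an extensional function on the finite
  index set \<open>coords L n\<close>; the product \<open>\<sigma>\<close>-algebra of \<open>state_space\<close> is the Borel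
  \<open>\<sigma>\<close>-algebra of \<open>\<real>\<^sup>\<kappa>\<close>.
\<close>

definition coords :: "nat \<Rightarrow> (nat \<Rightarrow> nat) \<Rightarrow> (nat \<times> nat) set" where
  "coords L n = (SIGMA i:{1..L}. {0..n i})"

definition state_space :: "nat \<Rightarrow> (nat \<Rightarrow> nat) \<Rightarrow> (nat \<times> nat \<Rightarrow> real) measure" where
  "state_space L n = (\<Pi>\<^sub>M p\<in>coords L n. borel)"

definition mark_space :: "nat \<Rightarrow> (nat \<Rightarrow> real) measure" where
  "mark_space L = (\<Pi>\<^sub>M i\<in>{1..L}. borel)"

definition vector_field ::
  "nat \<Rightarrow> (nat \<Rightarrow> nat) \<Rightarrow> (nat \<Rightarrow> real) \<Rightarrow> (nat \<times> nat \<Rightarrow> real) \<Rightarrow> (nat \<times> nat \<Rightarrow> real)" where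
  "vector_field L n \<alpha> x =
     (\<lambda>(i,k)\<in>coords L n. - \<alpha> i * x (i,k) + (if k < n i then x (i,k+1) else 0))"

definition solves_ode ::
  "nat \<Rightarrow> (nat \<Rightarrow> nat) \<Rightarrow> (nat \<Rightarrow> real) \<Rightarrow> (real \<Rightarrow> nat \<times> nat \<Rightarrow> real) \<Rightarrow> bool" where
  "solves_ode L n \<alpha> u \<longleftrightarrow>
     (\<forall>t. u t \<in> space (state_space L n)) \<and>
     (\<forall>t. \<forall>p\<in>coords L n.
        ((\<lambda>s. u s p) has_real_derivative vector_field L n \<alpha> (u t) p) (at t))"

definition flow ::
  "nat \<Rightarrow> (nat \<Rightarrow> nat) \<Rightarrow> (nat \<Rightarrow> real) \<Rightarrow> (nat \<times> nat \<Rightarrow> real) \<Rightarrow> real \<Rightarrow> (nat \<times> nat \<Rightarrow> real)" where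
  "flow L n \<alpha> x = (THE u. solves_ode L n \<alpha> u \<and> u 0 = x)"

definition jump_rate :: "nat \<Rightarrow> (real \<Rightarrow> real) \<Rightarrow> (nat \<times> nat \<Rightarrow> real) \<Rightarrow> real" where
  "jump_rate L f x = f (\<Sum>i=1..L. x (i,0))"

text \<open>
  The state \<open>x\<close> after a jump with mark \<open>c\<close>, that is, \<open>x + (\<Sum>i. c i e\<^bsub>(i, n i)\<^esub>)\<close>.
\<close>

definition add_jump ::
  "nat \<Rightarrow> (nat \<Rightarrow> nat) \<Rightarrow> (nat \<times> nat \<Rightarrow> real) \<Rightarrow> (nat \<Rightarrow> real) \<Rightarrow> (nat \<times> nat \<Rightarrow> real)" where
  "add_jump L n x c = (\<lambda>(i,k)\<in>coords L n. x (i,k) + (if k = n i then c i else 0))"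

text \<open>
  For a standard exponential \<open>e\<close>, the holding time below exceeds \<open>t\<close> with probability
  \<open>exp (- \<integral>\<^sub>0\<^sup>t jump_rate (flow x s) ds)\<close>, i.e. it is the time of the first jump from \<open>x\<close>;
  it is \<open>\<infinity>\<close> if no further jump occurs.
\<close>

definition holding_time ::
  "nat \<Rightarrow> (nat \<Rightarrow> nat) \<Rightarrow> (nat \<Rightarrow> real) \<Rightarrow> (real \<Rightarrow> real) \<Rightarrow> (nat \<times> nat \<Rightarrow> real) \<Rightarrow> real \<Rightarrow> ereal" where
  "holding_time L n \<alpha> f x e =
     Inf {ereal t | t. 0 \<le> t \<and> e \<le> (LBINT s:{0..t}. jump_rate L f (flow L n \<alpha> x s))}"

text \<open>
  The noise driving the process: an i.i.d. sequence of pairs of a standard exponential variable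
  and an independent mark with law \<open>G\<close>, one pair for each jump.
\<close>

definition noise :: "(nat \<Rightarrow> real) measure \<Rightarrow> (real \<times> (nat \<Rightarrow> real)) stream measure" where
  "noise G = stream_space (density lborel (exponential_density 1) \<Otimes>\<^sub>M G)"

text \<open>
  The \<open>m\<close>-th jump time together with the state right after the \<open>m\<close>-th jump. Once a jump time is
  \<open>\<infinity>\<close>, all later ones are, and the corresponding states are irrelevant.
\<close>

primrec skeleton ::
  "nat \<Rightarrow> (nat \<Rightarrow> nat) \<Rightarrow> (nat \<Rightarrow> real) \<Rightarrow> (real \<Rightarrow> real) \<Rightarrow> (nat \<times> nat \<Rightarrow> real) \<Rightarrow>
   (real \<times> (nat \<Rightarrow> real)) stream \<Rightarrow> nat \<Rightarrow> ereal \<times> (nat \<times> nat \<Rightarrow> real)" where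
  "skeleton L n \<alpha> f x \<omega> 0 = (0, x)"
| "skeleton L n \<alpha> f x \<omega> (Suc m) =
     (let (T, z) = skeleton L n \<alpha> f x \<omega> m;
          (e, c) = \<omega> !! m;
          S = holding_time L n \<alpha> f z e
      in (T + S, add_jump L n (flow L n \<alpha> z (real_of_ereal S)) c))"

text \<open>
  The process started at \<open>x\<close>: on \<open>[T m, T (m+1))\<close> it follows the flow from the state at time
  \<open>T m\<close>. After an accumulation point of jump times (a null event for Lipschitz \<open>f\<close>) it is set to
  the origin by convention.
\<close>

definition process ::
  "nat \<Rightarrow> (nat \<Rightarrow> nat) \<Rightarrow> (nat \<Rightarrow> real) \<Rightarrow> (real \<Rightarrow> real) \<Rightarrow> (nat \<times> nat \<Rightarrow> real) \<Rightarrow>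
   real \<Rightarrow> (real \<times> (nat \<Rightarrow> real)) stream \<Rightarrow> (nat \<times> nat \<Rightarrow> real)" where
  "process L n \<alpha> f x t \<omega> =
     (let T = (\<lambda>m. fst (skeleton L n \<alpha> f x \<omega> m)); Z = (\<lambda>m. snd (skeleton L n \<alpha> f x \<omega> m))
      in if \<exists>m. T m \<le> ereal t \<and> ereal t < T (Suc m)
         then let m = (LEAST m. T m \<le> ereal t \<and> ereal t < T (Suc m))
              in flow L n \<alpha> (Z m) (t - real_of_ereal (T m))
         else (\<lambda>_\<in>coords L n. 0))"

definition transition ::
  "nat \<Rightarrow> (nat \<Rightarrow> nat) \<Rightarrow> (nat \<Rightarrow> real) \<Rightarrow> (real \<Rightarrow> real) \<Rightarrow> (nat \<Rightarrow> real) measure \<Rightarrow>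
   real \<Rightarrow> (nat \<times> nat \<Rightarrow> real) \<Rightarrow> (nat \<times> nat \<Rightarrow> real) measure" where
  "transition L n \<alpha> f G t x = distr (noise G) (state_space L n) (process L n \<alpha> f x t)"

text \<open>The measure \<open>\<mu> P\<^sub>t\<close>.\<close>

definition evolve ::
  "nat \<Rightarrow> (nat \<Rightarrow> nat) \<Rightarrow> (nat \<Rightarrow> real) \<Rightarrow> (real \<Rightarrow> real) \<Rightarrow> (nat \<Rightarrow> real) measure \<Rightarrow>
   real \<Rightarrow> (nat \<times> nat \<Rightarrow> real) measure \<Rightarrow> (nat \<times> nat \<Rightarrow> real) measure" where
  "evolve L n \<alpha> f G t \<mu> = \<mu> \<bind> transition L n \<alpha> f G t"

definition prob_measures :: "nat \<Rightarrow> (nat \<Rightarrow> nat) \<Rightarrow> (nat \<times> nat \<Rightarrow> real) measure set" where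
  "prob_measures L n = {\<mu>. sets \<mu> = sets (state_space L n) \<and> prob_space \<mu>}"

definition invariant_measure ::
  "nat \<Rightarrow> (nat \<Rightarrow> nat) \<Rightarrow> (nat \<Rightarrow> real) \<Rightarrow> (real \<Rightarrow> real) \<Rightarrow> (nat \<Rightarrow> real) measure \<Rightarrow>
   (nat \<times> nat \<Rightarrow> real) measure \<Rightarrow> bool" where
  "invariant_measure L n \<alpha> f G \<pi> \<longleftrightarrow>
     \<pi> \<in> prob_measures L n \<and> (\<forall>t\<ge>0. evolve L n \<alpha> f G t \<pi> = \<pi>)"

definition dist1 :: "nat \<Rightarrow> (nat \<Rightarrow> nat) \<Rightarrow> (nat \<times> nat \<Rightarrow> real) \<Rightarrow> (nat \<times> nat \<Rightarrow> real) \<Rightarrow> real" where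
  "dist1 L n x y = (\<Sum>i=1..L. \<Sum>k=0..n i. \<bar>x (i,k) - y (i,k)\<bar>)"

definition couplings ::
  "nat \<Rightarrow> (nat \<Rightarrow> nat) \<Rightarrow> (nat \<times> nat \<Rightarrow> real) measure \<Rightarrow> (nat \<times> nat \<Rightarrow> real) measure \<Rightarrow>
   ((nat \<times> nat \<Rightarrow> real) \<times> (nat \<times> nat \<Rightarrow> real)) measure set" where
  "couplings L n \<mu> \<nu> =
     {\<gamma>. sets \<gamma> = sets (state_space L n \<Otimes>\<^sub>M state_space L n) \<and> prob_space \<gamma> \<and>
         distr \<gamma> (state_space L n) fst = \<mu> \<and> distr \<gamma> (state_space L n) snd = \<nu>}"

definition W1 ::
  "nat \<Rightarrow> (nat \<Rightarrow> nat) \<Rightarrow> (nat \<times> nat \<Rightarrow> real) measure \<Rightarrow> (nat \<times> nat \<Rightarrow> real) measure \<Rightarrow> ennreal" where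
  "W1 L n \<mu> \<nu> = (INF \<gamma>\<in>couplings L n \<mu> \<nu>. \<integral>\<^sup>+ (x, y). ennreal (dist1 L n x y) \<partial>\<gamma>)"

end

theory Submission
  imports Defs
begin

text \<open>
  Measure the difference \<open>z = x - y\<close> of two states by
  \<open>V z = (\<Sum>i k. b (k + 1) / \<alpha> i ^ k * \<bar>z (i, k)\<bar>)\<close>. Along the flow, the damping of coordinate \<open>(i, k)\<close>
  removes \<open>\<alpha> i\<close> times its weight, while the coordinate \<open>(i, k - 1)\<close> that it feeds gains only the
  fraction \<open>b k / b (k + 1)\<close> of this, because \<open>b\<close> is strictly increasing; hence the term of
  \<open>(i, k)\<close> decays at rate \<open>\<alpha> i * (b (k + 1) - b k) / b (k + 1)\<close>. The coordinates \<open>(i, 0)\<close> feed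
  nothing, decay at the full rate \<open>\<alpha> i\<close>, and this surplus pays for the jumps: if two copies are
  coupled so that they jump together, with the same mark, as often as possible, a common jump leaves
  \<open>V\<close> unchanged, and a single one occurs at rate \<open>\<bar>f (\<Sum>i. x (i, 0)) - f (\<Sum>i. y (i, 0))\<bar>\<close>, at most
  \<open>K * (\<Sum>i. \<bar>z (i, 0)\<bar>)\<close>, and adds on average at most
  \<open>b (N + 1) * (\<integral>c. (\<Sum>i. \<bar>c i\<bar> / \<alpha> i ^ n i) \<partial>G)\<close> to \<open>V\<close>. So \<open>V\<close> contracts at the rate \<open>d\<close> in mean, and
  comparing its weights with \<open>1\<close> gives the constant \<open>C\<close>.

  Since the process is given by its jump times and not by a generator, this computation is made
  rigorous through the first-jump equation: the semigroup is a solution \<open>w\<close> of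
  \<open>w = first_jump h w\<close> (\<open>nn_act_first_jump\<close>). A Lyapunov function of linear growth excludes an
  accumulation of jumps (\<open>many_jumps_le\<close>), and then the semigroup lies below every supersolution
  (\<open>nn_act_le\<close>). Four facts follow by exhibiting supersolutions: the first moment stays finite, the
  Markov property (\<open>trans_add\<close>), the two components of the coupled process are copies of the process
  (\<open>pdmp_projection\<close>), and \<open>V\<close> contracts under the coupling (\<open>coupled_contraction\<close>). To get the
  last one although \<open>V\<close> is not smooth, the absolute difference of two trajectories of the flow is
  replaced by the trajectory started at \<open>\<bar>x - y\<bar>\<close>, which dominates it because the flow is linear with
  nonnegative coefficients. Running the coupled process from an arbitrary coupling of the initial laws
  and taking the infimum over these gives the first claim (\<open>W1_evolve_le\<close>).

  For the invariant measure, the laws at integer times of the process started in \<open>0\<close> have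
  successive couplings with geometrically decreasing costs. After rounding to finer and finer grids these
  couplings are discrete and can be glued into one Markov chain, which converges almost surely
  (\<open>limit_of_couplings\<close>). The limit law is invariant and is the only invariant probability measure,
  because the expectations of bounded Lipschitz functions forget the initial law, even one
  without first moment (\<open>act_forget\<close>). The last claim is the first one for \<open>\<mu> = \<pi>\<close>.
\<close>

section \<open>Piecewise deterministic processes built from their holding times\<close>

text \<open>
  The construction of \<open>skeleton\<close> and \<open>process\<close> with arbitrary flow, holding times, jumps and state
  space: it is used for the process itself and for a pair of coupled copies.
\<close>

primrec jump_chain ::
  "('s \<Rightarrow> real \<Rightarrow> 's) \<Rightarrow> ('s \<Rightarrow> real \<Rightarrow> ereal) \<Rightarrow> ('s \<Rightarrow> 'c \<Rightarrow> 's) \<Rightarrow> 's \<Rightarrow> (real \<times> 'c) stream \<Rightarrow> nat \<Rightarrow>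
   ereal \<times> 's" where
  "jump_chain fl hold jump x \<omega> 0 = (0, x)"
| "jump_chain fl hold jump x \<omega> (Suc m) =
     (let (T, z) = jump_chain fl hold jump x \<omega> m;
          (e, c) = \<omega> !! m;
          S = hold z e
      in (T + S, jump (fl z (real_of_ereal S)) c))"

definition jump_process ::
  "('s \<Rightarrow> real \<Rightarrow> 's) \<Rightarrow> ('s \<Rightarrow> real \<Rightarrow> ereal) \<Rightarrow> ('s \<Rightarrow> 'c \<Rightarrow> 's) \<Rightarrow> 's \<Rightarrow> 's \<Rightarrow> real \<Rightarrow> (real \<times> 'c) stream \<Rightarrow> 's"
  where
  "jump_process fl hold jump origin x t \<omega> =
     (let T = (\<lambda>m. fst (jump_chain fl hold jump x \<omega> m)); Z = (\<lambda>m. snd (jump_chain fl hold jump x \<omega> m))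
      in if \<exists>m. T m \<le> ereal t \<and> ereal t < T (Suc m)
         then let m = (LEAST m. T m \<le> ereal t \<and> ereal t < T (Suc m))
              in fl (Z m) (t - real_of_ereal (T m))
         else origin)"

text \<open>
  The recursion at the first instead of the last jump; it turns statements about the process into
  statements about what happens up to its first jump.
\<close>

lemma jump_chain_shift:
  "jump_chain fl hold jump x \<omega> (Suc m) =
     (let S = hold x (fst (shd \<omega>));
          r = jump_chain fl hold jump (jump (fl x (real_of_ereal S)) (snd (shd \<omega>))) (stl \<omega>) m
      in (S + fst r, snd r))"
proof (induction m)
  case 0
  show ?case by (auto simp: Let_def split_beta)
next
  case (Suc m)
  show ?case
    by (subst jump_chain.simps(2), subst Suc) (simp add: Let_def split_beta add.assoc)
qed

locale pdmp =
  fixes E :: "'s measure" and C :: "'c measure" and fl :: "'s \<Rightarrow> real \<Rightarrow> 's"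
    and rate :: "'s \<Rightarrow> real" and jump :: "'s \<Rightarrow> 'c \<Rightarrow> 's" and origin :: 's
  assumes prob_C: "prob_space C"
    and origin[simp]: "origin \<in> space E"
    and fl_meas: "(\<lambda>p. fl (fst p) (snd p)) \<in> E \<Otimes>\<^sub>M borel \<rightarrow>\<^sub>M E"
    and fl_0[simp]: "x \<in> space E \<Longrightarrow> fl x 0 = x"
    and fl_add: "x \<in> space E \<Longrightarrow> fl (fl x s) t = fl x (s + t)"
    and rate_meas[measurable]: "rate \<in> borel_measurable E"
    and rate_nonneg: "x \<in> space E \<Longrightarrow> 0 \<le> rate x"
    and rate_cont: "x \<in> space E \<Longrightarrow> continuous_on UNIV (\<lambda>s. rate (fl x s))"
    and jump_meas: "(\<lambda>p. jump (fst p) (snd p)) \<in> E \<Otimes>\<^sub>M C \<rightarrow>\<^sub>M E"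
begin

sublocale C: prob_space C by (rule prob_C)

lemma fl_measurable[measurable (raw)]:
  assumes "f \<in> M \<rightarrow>\<^sub>M E" "g \<in> borel_measurable M"
  shows "(\<lambda>\<omega>. fl (f \<omega>) (g \<omega>)) \<in> M \<rightarrow>\<^sub>M E"
  using measurable_compose[OF measurable_Pair[OF assms] fl_meas] by simp

lemma jump_measurable[measurable (raw)]:
  assumes "f \<in> M \<rightarrow>\<^sub>M E" "g \<in> M \<rightarrow>\<^sub>M C"
  shows "(\<lambda>\<omega>. jump (f \<omega>) (g \<omega>)) \<in> M \<rightarrow>\<^sub>M E"
  using measurable_compose[OF measurable_Pair[OF assms] jump_meas] by simp

lemma fl_space[simp]: "x \<in> space E \<Longrightarrow> fl x t \<in> space E"
  using measurable_space[OF fl_meas, of "(x, t)"] by (simp add: space_pair_measure)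

lemma jump_space[simp]: "x \<in> space E \<Longrightarrow> c \<in> space C \<Longrightarrow> jump x c \<in> space E"
  using measurable_space[OF jump_meas, of "(x, c)"] by (simp add: space_pair_measure)

definition hazard :: "'s \<Rightarrow> real \<Rightarrow> real" where
  "hazard x t = (LBINT s:{0..t}. rate (fl x s))"

definition hold :: "'s \<Rightarrow> real \<Rightarrow> ereal" where
  "hold x e = Inf {ereal t | t. 0 \<le> t \<and> e \<le> hazard x t}"

text \<open>
  The antiderivative is defined on the whole line, so that the derivative at time \<open>0\<close> is two-sided.
\<close>

lemma hazard_antiderivative:
  assumes x: "x \<in> space E"
  obtains F where "\<And>t. (F has_real_derivative rate (fl x t)) (at t)" "F 0 = 0"
    "\<And>t. 0 \<le> t \<Longrightarrow> hazard x t = F t"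
proof -
  obtain F where F: "\<And>t. (F has_vector_derivative rate (fl x t)) (at t)"
    using einterval_antiderivative[of "-\<infinity>" "\<infinity>" "\<lambda>s. rate (fl x s)"] rate_cont[OF x]
    by (auto simp: continuous_on_eq_continuous_at)
  have "hazard x t = F t - F 0" if "0 \<le> t" for t
    unfolding hazard_def set_lebesgue_integral_def using that
    by (intro integral_FTC_atLeastAtMost continuous_on_subset[OF rate_cont[OF x]]
        has_vector_derivative_at_within[OF F]) auto
  moreover have "((\<lambda>t. F t - F 0) has_real_derivative rate (fl x t)) (at t)" for t
    using F[of t] by (auto intro!: derivative_eq_intros simp: has_real_derivative_iff_has_vector_derivative)
  ultimately show ?thesis
    by (intro that[of "\<lambda>t. F t - F 0"]) auto
qed

lemma hazard_0[simp]: "x \<in> space E \<Longrightarrow> hazard x 0 = 0"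
  using hazard_antiderivative[of x] by (metis order_refl)

lemma hazard_mono:
  assumes x: "x \<in> space E" and "0 \<le> s" "s \<le> t" shows "hazard x s \<le> hazard x t"
proof -
  obtain F where F: "\<And>t. (F has_real_derivative rate (fl x t)) (at t)" "\<And>t. 0 \<le> t \<Longrightarrow> hazard x t = F t"
    using hazard_antiderivative[OF x] by metis
  have "F s \<le> F t"
    using assms F(1) by (intro DERIV_nonneg_imp_nondecreasing[of s t F]) (auto intro!: rate_nonneg exI)
  then show ?thesis using assms by (simp add: F(2))
qed

lemma hazard_nonneg[simp]: "x \<in> space E \<Longrightarrow> 0 \<le> t \<Longrightarrow> 0 \<le> hazard x t"
  using hazard_mono[of x 0 t] by simp

lemma hazard_cont: "x \<in> space E \<Longrightarrow> continuous_on {0..} (hazard x)"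
proof -
  assume x: "x \<in> space E"
  obtain F where F: "\<And>t. (F has_real_derivative rate (fl x t)) (at t)" "\<And>t. 0 \<le> t \<Longrightarrow> hazard x t = F t"
    using hazard_antiderivative[OF x] by metis
  have "continuous_on {0..} F" using F(1) by (meson DERIV_isCont continuous_at_imp_continuous_on)
  then show ?thesis using F(2) by (subst continuous_on_cong[OF refl, of _ _ F]) auto
qed

lemma hazard_add:
  assumes x: "x \<in> space E" and "0 \<le> s" "0 \<le> t" shows "hazard x (s + t) = hazard x s + hazard (fl x s) t"
proof -
  obtain F where F: "\<And>t. (F has_real_derivative rate (fl x t)) (at t)" "F 0 = 0" "\<And>t. 0 \<le> t \<Longrightarrow> hazard x t = F t"
    using hazard_antiderivative[OF x] by metis
  obtain G where G: "\<And>t. (G has_real_derivative rate (fl (fl x s) t)) (at t)" "G 0 = 0"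
     "\<And>t. 0 \<le> t \<Longrightarrow> hazard (fl x s) t = G t"
    using hazard_antiderivative[OF fl_space[OF x], of s] by metis
  have "((\<lambda>t. F (s + t) - G t) has_real_derivative rate (fl x (s + t)) - rate (fl x (s + t))) (at t)" for t
    using F(1)[of "s + t"] G(1)[of t] 
    by (auto intro!: derivative_eq_intros DERIV_shift[THEN iffD1, of F _ t s, unfolded add.commute[of t]] 
          simp: fl_add[OF x] add.commute)
  then have "F (s + t) - G t = F (s + 0) - G 0"
    by (intro DERIV_isconst_all) auto
  then show ?thesis using assms by (simp add: F(2,3) G(2,3))
qed

lemma hazard_measurable2: "(\<lambda>p. hazard (fst p) (snd p)) \<in> borel_measurable (E \<Otimes>\<^sub>M borel)"
  unfolding hazard_def set_lebesgue_integral_def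
proof (rule lborel.borel_measurable_lebesgue_integral)
  have "(\<lambda>q. indicat_real {q. 0 \<le> snd q \<and> snd q \<le> snd (fst q)} q *\<^sub>R rate (fl (fst (fst q)) (snd q)))
    \<in> borel_measurable ((E \<Otimes>\<^sub>M borel) \<Otimes>\<^sub>M lborel)"
    by measurable
  also have "(\<lambda>q. indicat_real {q. 0 \<le> snd q \<and> snd q \<le> snd (fst q)} q *\<^sub>R rate (fl (fst (fst q)) (snd q))) =
     (\<lambda>(x, y). indicat_real {0..snd x} y *\<^sub>R rate (fl (fst x) y))"
    by (auto simp: fun_eq_iff indicator_def)
  finally show "(\<lambda>(x, y). indicat_real {0..snd x} y *\<^sub>R rate (fl (fst x) y)) \<in> borel_measurable ((E \<Otimes>\<^sub>M borel) \<Otimes>\<^sub>M lborel)" .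
qed

lemma hazard_measurable[measurable (raw)]:
  assumes "f \<in> M \<rightarrow>\<^sub>M E" "g \<in> borel_measurable M"
  shows "(\<lambda>\<omega>. hazard (f \<omega>) (g \<omega>)) \<in> borel_measurable M"
  using measurable_compose[OF measurable_Pair[OF assms] hazard_measurable2] by simp

lemma hold_nonneg: "0 \<le> hold x e"
  unfolding hold_def by (rule Inf_greatest) auto

text \<open>
  The infimum is attained because the hazard is continuous.
\<close>

lemma hold_le_iff:
  assumes x: "x \<in> space E" and t: "0 \<le> t"
  shows "hold x e \<le> ereal t \<longleftrightarrow> e \<le> hazard x t"
proof
  assume "e \<le> hazard x t"
  then show "hold x e \<le> ereal t" unfolding hold_def using t by (intro Inf_lower) auto
next
  assume le: "hold x e \<le> ereal t"
  have "e \<le> hazard x (t + 1 / Suc n)" for n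
  proof -
    have "hold x e < ereal (t + 1 / Suc n)"
      using le by (rule le_less_trans) auto
    then obtain s where s: "0 \<le> s" "e \<le> hazard x s" "s < t + 1 / Suc n"
      unfolding hold_def Inf_less_iff by auto
    then show ?thesis using hazard_mono[OF x s(1), of "t + 1 / Suc n"] by auto
  qed
  moreover have "(\<lambda>n. hazard x (t + 1 / Suc n)) \<longlonglongrightarrow> hazard x t"
  proof (rule continuous_on_tendsto_compose[OF hazard_cont[OF x]])
    show "(\<lambda>n. t + 1 / Suc n) \<longlonglongrightarrow> t"
      using LIMSEQ_inverse_real_of_nat_add[of t] by (simp add: inverse_eq_divide)
  qed (use t in auto)
  ultimately show "e \<le> hazard x t"
    by (intro LIMSEQ_le_const) auto
qed

lemma hold_measurable2: "(\<lambda>p. hold (fst p) (snd p)) \<in> borel_measurable (E \<Otimes>\<^sub>M borel)"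
proof (rule borel_measurableI_le)
  fix a :: ereal
  let ?S = "{p \<in> space (E \<Otimes>\<^sub>M borel). hold (fst p) (snd p) \<le> a}"
  show "?S \<in> sets (E \<Otimes>\<^sub>M borel)"
  proof (cases "0 \<le> a \<and> a \<noteq> \<infinity>")
    case True
    then obtain t where t: "a = ereal t" "0 \<le> t" by (cases a) auto
    have "?S = {p \<in> space (E \<Otimes>\<^sub>M borel). snd p \<le> hazard (fst p) t}"
      using t by (auto simp: hold_le_iff space_pair_measure)
    also have "\<dots> \<in> sets (E \<Otimes>\<^sub>M borel)" by measurable
    finally show ?thesis .
  next
    case False
    then consider "a = \<infinity>" | "a < 0" by (auto simp: not_le)
    then have "?S = {} \<or> ?S = space (E \<Otimes>\<^sub>M borel)"
    proof cases
      case 2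
      then have "\<not> hold x e \<le> a" for x e using hold_nonneg[of x e] by auto
      then show ?thesis by auto
    qed auto
    then show ?thesis by (elim disjE) (simp_all only: sets.top sets.empty_sets)
  qed
qed

lemma hold_measurable[measurable (raw)]:
  assumes "f \<in> M \<rightarrow>\<^sub>M E" "g \<in> borel_measurable M"
  shows "(\<lambda>\<omega>. hold (f \<omega>) (g \<omega>)) \<in> borel_measurable M"
  using measurable_compose[OF measurable_Pair[OF assms] hold_measurable2] by simp

end

section \<open>The first-jump equation\<close>

definition exp1 :: "real measure" where
  "exp1 = density lborel (exponential_density 1)"

lemma sets_exp1[measurable_cong, simp]: "sets exp1 = sets borel"
  by (simp add: exp1_def)

lemma space_exp1[simp]: "space exp1 = UNIV"
  by (simp add: exp1_def)

interpretation exp1: prob_space exp1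
  unfolding exp1_def by (rule prob_space_exponential_density) simp

lemma exp1_tail: "0 \<le> a \<Longrightarrow> emeasure exp1 {a<..} = ennreal (exp (- a))"
proof -
  assume a: "0 \<le> a"
  have "distributed exp1 lborel (\<lambda>x. x) (exponential_density 1)"
    unfolding distributed_def exp1_def by (auto simp: distr_id2)
  from exp1.exponential_distributedD_gt[OF this a] show ?thesis
    by (simp add: exp1.emeasure_eq_measure greaterThan_def)
qed

context pdmp begin

text \<open>
  The first jump time has the density \<open>rate (fl x s) * exp (- hazard x s)\<close>, by the substitution
  \<open>e = hazard x s\<close>.
\<close>

lemma nn_integral_hold:
  assumes x: "x \<in> space E" and t: "0 \<le> t" and k[measurable]: "k \<in> borel_measurable borel"
  shows "(\<integral>\<^sup>+e. (if hold x e \<le> ereal t then k (real_of_ereal (hold x e)) else 0) \<partial>exp1) =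
     (\<integral>\<^sup>+s. ennreal (rate (fl x s) * exp (- hazard x s)) * k s * indicator {0..t} s \<partial>lborel)"
proof (cases "t = 0")
  case True
  have "(\<integral>\<^sup>+e. (if hold x e \<le> ereal t then k (real_of_ereal (hold x e)) else 0) \<partial>exp1) =
      (\<integral>\<^sup>+e. ennreal (exponential_density 1 e) * (if hold x e \<le> ereal t then k (real_of_ereal (hold x e)) else 0) \<partial>lborel)"
    unfolding exp1_def using x by (subst nn_integral_density) auto
  also have "\<dots> = (\<integral>\<^sup>+e. 0 \<partial>(lborel :: real measure))"
    using AE_lborel_singleton[of 0] hold_le_iff[OF x t] x True
    by (intro nn_integral_cong_AE) (auto simp: exponential_density_def)
  also have "\<dots> = (\<integral>\<^sup>+s. ennreal (rate (fl x s) * exp (- hazard x s)) * k s * indicator {0..t} s \<partial>lborel)"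
    using AE_lborel_singleton[of 0] True
    by (intro nn_integral_cong_AE) (auto simp: indicator_def)
  finally show ?thesis .
next
  case False
  then have t: "0 < t" "0 \<le> t" using t by auto
  obtain F where F: "\<And>t. (F has_real_derivative rate (fl x t)) (at t)" "F 0 = 0" "\<And>t. 0 \<le> t \<Longrightarrow> hazard x t = F t"
    using hazard_antiderivative[OF x] by metis
  have Fmono: "F s \<le> F s'" if "s \<le> s'" for s s'
    using that F(1) x by (intro DERIV_nonneg_imp_nondecreasing[of s s' F]) (auto intro!: rate_nonneg exI)
  have [measurable]: "hold x \<in> borel_measurable borel" using x by measurable
  let ?f = "\<lambda>e. ennreal (exp (- e)) * k (real_of_ereal (hold x e))"
  have "(\<integral>\<^sup>+e. (if hold x e \<le> ereal t then k (real_of_ereal (hold x e)) else 0) \<partial>exp1) =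
      (\<integral>\<^sup>+e. ennreal (exponential_density 1 e) * (if hold x e \<le> ereal t then k (real_of_ereal (hold x e)) else 0) \<partial>lborel)"
    unfolding exp1_def by (subst nn_integral_density) auto
  also have "\<dots> = (\<integral>\<^sup>+e. ?f e * indicator {F 0..F t} e \<partial>lborel)"
    using hold_le_iff[OF x t(2)] F(2,3) t
    by (intro nn_integral_cong) (auto simp: exponential_density_def indicator_def)
  also have "\<dots> = (\<integral>\<^sup>+s. ?f (F s) * ennreal (rate (fl x s)) * indicator {0..t} s \<partial>lborel)"
    using x t F(1) by (intro nn_integral_substitution_aux[where g=F and g'="\<lambda>s. rate (fl x s)"]
        continuous_on_subset[OF rate_cont]) (auto intro!: rate_nonneg)
  also have "\<dots> = (\<integral>\<^sup>+s. ennreal (rate (fl x s) * exp (- hazard x s)) * k s * indicator {0..t} s \<partial>lborel)"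
  proof (intro nn_integral_cong)
    fix s :: real
    show "?f (F s) * ennreal (rate (fl x s)) * indicator {0..t} s =
       ennreal (rate (fl x s) * exp (- hazard x s)) * k s * indicator {0..t} s"
    proof (cases "s \<in> {0..t} \<and> rate (fl x s) \<noteq> 0")
      case True
      then have s: "0 \<le> s" "s \<le> t" "0 < rate (fl x s)" using rate_nonneg[OF fl_space[OF x, of s]] by auto
      have le: "hold x (F s) \<le> ereal s" using s F(3) by (simp add: hold_le_iff x)
      then obtain s' where s': "hold x (F s) = ereal s'" "0 \<le> s'" "s' \<le> s"
        using hold_nonneg[of x "F s"] by (cases "hold x (F s)") auto
      have "F s \<le> F s'" using s' hold_le_iff[OF x, of s' "F s"] F(3) by simp
      \<comment> \<open>a flat piece of the hazard that ends in \<open>s\<close> would force its derivative \<open>rate (fl x s)\<close> to vanish\<close>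
      have "s' = s"
      proof (rule ccontr)
        assume "s' \<noteq> s"
        with s' have "s' < s" by simp
        obtain d where d: "d > 0" "\<And>h. 0 < h \<Longrightarrow> h < d \<Longrightarrow> F (s - h) < F s"
          using DERIV_pos_inc_left[OF F(1) s(3)] by auto
        have "F (s - min (d/2) (s - s')) < F s" using d \<open>s' < s\<close> by (intro d(2)) auto
        moreover have "F s' \<le> F (s - min (d/2) (s - s'))" by (intro Fmono) auto
        ultimately show False using \<open>F s \<le> F s'\<close> by simp
      qed
      then show ?thesis using s s' F(3)
        by (simp add: ennreal_mult rate_nonneg x mult_ac)
    qed auto
  qed
  finally show ?thesis .
qed

lemma nn_integral_hold_gt:
  assumes x: "x \<in> space E" and t: "0 \<le> t"
  shows "(\<integral>\<^sup>+e. (if hold x e \<le> ereal t then 0 else c) \<partial>exp1) = ennreal (exp (- hazard x t)) * c"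
proof -
  have "(\<integral>\<^sup>+e. (if hold x e \<le> ereal t then 0 else c) \<partial>exp1) = (\<integral>\<^sup>+e. c * indicator {hazard x t<..} e \<partial>exp1)"
    using hold_le_iff[OF x t] by (intro nn_integral_cong) (auto simp: indicator_def)
  also have "\<dots> = c * emeasure exp1 {hazard x t<..}"
    by (subst nn_integral_cmult_indicator) auto
  finally show ?thesis using exp1_tail[OF hazard_nonneg[OF x t]] by (simp add: mult.commute)
qed

abbreviation "chain \<equiv> jump_chain fl hold jump"
abbreviation "traj \<equiv> jump_process fl hold jump origin"

definition noiseM :: "(real \<times> 'c) stream measure" where
  "noiseM = stream_space (exp1 \<Otimes>\<^sub>M C)"

lemma chain_nonneg: "0 \<le> fst (chain x \<omega> m)"
  by (induction m) (auto simp: Let_def split_beta intro!: add_nonneg_nonneg hold_nonneg)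

text \<open>
  This holds for every noise sequence, also for those with accumulating jump times: on both sides the
  process is then at \<open>origin\<close> from the accumulation point on.
\<close>

lemma traj_unfold:
  assumes x: "x \<in> space E" and t: "0 \<le> t"
  shows "traj x t \<omega> =
    (let S = hold x (fst (shd \<omega>)) in
     if S \<le> ereal t then traj (jump (fl x (real_of_ereal S)) (snd (shd \<omega>))) (t - real_of_ereal S) (stl \<omega>)
     else fl x t)"
proof (cases "hold x (fst (shd \<omega>)) \<le> ereal t")
  case False
  let ?P = "\<lambda>m. fst (chain x \<omega> m) \<le> ereal t \<and> ereal t < fst (chain x \<omega> (Suc m))"
  have P0: "?P 0" using False t by (simp add: jump_chain_shift Let_def split_beta zero_ereal_def)
  then have "(LEAST m. ?P m) = 0" by (intro Least_eq_0)
  with P0 False show ?thesis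
    unfolding jump_process_def Let_def by (auto simp del: jump_chain.simps(2) simp: zero_ereal_def)
next
  case True
  let ?S = "hold x (fst (shd \<omega>))"
  let ?z = "jump (fl x (real_of_ereal ?S)) (snd (shd \<omega>))"
  obtain s where s: "?S = ereal s" "0 \<le> s" "s \<le> t" using True hold_nonneg[of x "fst (shd \<omega>)"] by (cases ?S) auto
  let ?P = "\<lambda>m. fst (chain x \<omega> m) \<le> ereal t \<and> ereal t < fst (chain x \<omega> (Suc m))"
  let ?Q = "\<lambda>m. fst (chain ?z (stl \<omega>) m) \<le> ereal (t - s) \<and> ereal (t - s) < fst (chain ?z (stl \<omega>) (Suc m))"
  have sh: "chain x \<omega> (Suc m) = (ereal s + fst (chain ?z (stl \<omega>) m), snd (chain ?z (stl \<omega>) m))" for m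
    by (subst jump_chain_shift) (simp add: Let_def s)
  have nP0: "\<not> ?P 0" using s by (simp add: sh del: jump_chain.simps(2)) 
  have a1: "ereal s + u \<le> ereal t \<longleftrightarrow> u \<le> ereal (t - s)" for u by (cases u) auto
  have a2: "ereal t < ereal s + u \<longleftrightarrow> ereal (t - s) < u" for u by (cases u) auto
  have PQ: "?P (Suc m) = ?Q m" for m
    by (simp only: sh fst_conv a1 a2)
  have ex: "(\<exists>m. ?P m) \<longleftrightarrow> (\<exists>m. ?Q m)"
    using PQ nP0 by (metis not0_implies_Suc)
  show ?thesis
  proof (cases "\<exists>m. ?Q m")
    case False
    have "traj x t \<omega> = origin" unfolding jump_process_def Let_def using ex False by (intro if_not_P) simp
    moreover have "traj ?z (t - s) (stl \<omega>) = origin" unfolding jump_process_def Let_def using False by (rule if_not_P)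
    ultimately show ?thesis using True s by simp
  next
    case Q: True
    then obtain m where m: "?Q m" by blast
    have L: "(LEAST m. ?P m) = Suc (LEAST m. ?Q m)"
      using PQ m by (subst Least_Suc[of ?P "Suc m", OF _ nP0]) auto
    let ?m = "LEAST m. ?Q m"
    have "?Q ?m" using m by (rule LeastI)
    then obtain u where u: "fst (chain ?z (stl \<omega>) ?m) = ereal u"
      using chain_nonneg[of ?z "stl \<omega>" ?m] by (cases "fst (chain ?z (stl \<omega>) ?m)") auto
    have "traj x t \<omega> = fl (snd (chain x \<omega> (LEAST m. ?P m))) (t - real_of_ereal (fst (chain x \<omega> (LEAST m. ?P m))))"
      unfolding jump_process_def Let_def using ex Q by (intro if_P) simp
    also have "\<dots> = fl (snd (chain ?z (stl \<omega>) ?m)) ((t - s) - u)"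
      unfolding L unfolding sh fst_conv snd_conv unfolding u by (simp add: algebra_simps)
    also have "\<dots> = traj ?z (t - s) (stl \<omega>)"
      unfolding jump_process_def Let_def using Q by (subst if_P) (simp_all only: u real_of_ereal.simps)
    finally show ?thesis using s True by simp
  qed
qed

lemma chain_measurable:
  "(\<lambda>p. chain (fst p) (snd p) m) \<in> E \<Otimes>\<^sub>M noiseM \<rightarrow>\<^sub>M borel \<Otimes>\<^sub>M E"
proof (induction m)
  case 0
  show ?case by (simp add: noiseM_def)
next
  case (Suc m)
  note [measurable] = Suc[unfolded noiseM_def]
  show ?case unfolding jump_chain.simps noiseM_def Let_def split_beta by measurable
qed

lemma chain_measurable'[measurable (raw)]:
  assumes "f \<in> M \<rightarrow>\<^sub>M E" "g \<in> M \<rightarrow>\<^sub>M noiseM"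
  shows "(\<lambda>\<omega>. chain (f \<omega>) (g \<omega>) m) \<in> M \<rightarrow>\<^sub>M borel \<Otimes>\<^sub>M E"
  using measurable_compose[OF measurable_Pair[OF assms] chain_measurable] by simp

lemma traj_measurable3:
  "(\<lambda>p. traj (snd (fst p)) (fst (fst p)) (snd p)) \<in> (borel \<Otimes>\<^sub>M E) \<Otimes>\<^sub>M noiseM \<rightarrow>\<^sub>M E"
proof -
  let ?N = "(borel \<Otimes>\<^sub>M E) \<Otimes>\<^sub>M noiseM :: ((real \<times> 's) \<times> (real \<times> 'c) stream) measure"
  let ?P = "\<lambda>p m. fst (chain (snd (fst p)) (snd p) m) \<le> ereal (fst (fst p)) \<and>
       ereal (fst (fst p)) < fst (chain (snd (fst p)) (snd p) (Suc m))"
  have T: "(\<lambda>p. fst (chain (snd (fst p)) (snd p) m)) \<in> borel_measurable ?N" for m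
    by measurable
  have P: "Measurable.pred ?N (\<lambda>p. ?P p m)" for m
  proof -
    have aux: "Measurable.pred ?N (\<lambda>p. f p \<le> ereal (h p) \<and> ereal (h p) < g p)"
      if [measurable]: "f \<in> borel_measurable ?N" "g \<in> borel_measurable ?N" "h \<in> borel_measurable ?N" for f g h
      by measurable
    show ?thesis by (rule aux[OF T T]) measurable
  qed
  have L: "(\<lambda>p. LEAST m. ?P p m) \<in> ?N \<rightarrow>\<^sub>M count_space UNIV"
    by (rule measurable_Least) (rule P)
  have "(\<lambda>p. (\<lambda>m. fl (snd (chain (snd (fst p)) (snd p) m)) (fst (fst p) - real_of_ereal (fst (chain (snd (fst p)) (snd p) m))))
      (LEAST m. ?P p m)) \<in> ?N \<rightarrow>\<^sub>M E"
    by (rule measurable_compose_countable[OF _ L]) measurable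
  note sel = this
  have ex: "Measurable.pred ?N (\<lambda>p. \<exists>m. ?P p m)"
    by (rule pred_intros_countable(2)) (rule P)
  show ?thesis
    unfolding jump_process_def Let_def
    by (rule measurable_If[OF sel measurable_const[OF origin] predE[OF ex]])
qed

lemma traj_measurable[measurable (raw)]:
  assumes "f \<in> M \<rightarrow>\<^sub>M E" "k \<in> borel_measurable M" "g \<in> M \<rightarrow>\<^sub>M noiseM"
  shows "(\<lambda>\<omega>. traj (f \<omega>) (k \<omega>) (g \<omega>)) \<in> M \<rightarrow>\<^sub>M E"
  using measurable_compose[OF measurable_Pair[OF measurable_Pair[OF assms(2,1)] assms(3)] traj_measurable3] by simp

lemma prob_space_noiseM: "prob_space noiseM"
proof -
  interpret pair_prob_space exp1 C ..
  show ?thesis unfolding noiseM_def by (rule prob_space_stream_space)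
qed

sublocale noise: prob_space noiseM by (rule prob_space_noiseM)

definition trans :: "real \<Rightarrow> 's \<Rightarrow> 's measure" where
  "trans t x = distr noiseM E (traj x t)"

text \<open>
  The transition semigroup acting on nonnegative functions, with values in the extended reals.
\<close>

definition nn_act :: "('s \<Rightarrow> ennreal) \<Rightarrow> real \<Rightarrow> 's \<Rightarrow> ennreal" where
  "nn_act h t x = (\<integral>\<^sup>+y. h y \<partial>trans t x)"

lemma traj_measurable_noise[measurable]: "x \<in> space E \<Longrightarrow> traj x t \<in> noiseM \<rightarrow>\<^sub>M E"
  by (rule traj_measurable) auto

lemma sets_trans[simp, measurable_cong]: "sets (trans t x) = sets E"
  by (simp add: trans_def)

lemma space_trans[simp]: "space (trans t x) = space E"
  by (simp add: trans_def)

lemma prob_space_trans: "x \<in> space E \<Longrightarrow> prob_space (trans t x)"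
  unfolding trans_def by (rule noise.prob_space_distr) measurable

lemma trans_measurable2: "(\<lambda>p. trans (fst p) (snd p)) \<in> borel \<Otimes>\<^sub>M E \<rightarrow>\<^sub>M prob_algebra E"
proof (rule measurable_prob_algebraI)
  show "(\<lambda>p. trans (fst p) (snd p)) \<in> borel \<Otimes>\<^sub>M E \<rightarrow>\<^sub>M subprob_algebra E"
    unfolding trans_def
  proof (rule measurable_distr2)
    show "(\<lambda>(p, y). traj (snd p) (fst p) y) \<in> (borel \<Otimes>\<^sub>M E) \<Otimes>\<^sub>M noiseM \<rightarrow>\<^sub>M E"
      using traj_measurable3 by (simp add: split_beta')
    show "(\<lambda>p. noiseM) \<in> borel \<Otimes>\<^sub>M E \<rightarrow>\<^sub>M subprob_algebra noiseM"
      by (intro measurable_const) (simp add: space_subprob_algebra noise.subprob_space_axioms)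
  qed
qed (auto simp: space_pair_measure intro!: prob_space_trans)

lemma trans_measurable[measurable (raw)]:
  assumes "f \<in> borel_measurable M" "g \<in> M \<rightarrow>\<^sub>M E"
  shows "(\<lambda>\<omega>. trans (f \<omega>) (g \<omega>)) \<in> M \<rightarrow>\<^sub>M prob_algebra E"
  using measurable_compose[OF measurable_Pair[OF assms] trans_measurable2] by simp

lemma nn_act_measurable[measurable (raw)]:
  assumes "f \<in> borel_measurable M" "g \<in> M \<rightarrow>\<^sub>M E" "h \<in> borel_measurable E"
  shows "(\<lambda>\<omega>. nn_act h (f \<omega>) (g \<omega>)) \<in> borel_measurable M"
  unfolding nn_act_def
  by (rule measurable_compose[OF measurable_prob_algebraD[OF trans_measurable[OF assms(1,2)]]
       nn_integral_measurable_subprob_algebra[OF assms(3)]])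

lemma nn_act_traj: "x \<in> space E \<Longrightarrow> h \<in> borel_measurable E \<Longrightarrow> nn_act h t x = (\<integral>\<^sup>+\<omega>. h (traj x t \<omega>) \<partial>noiseM)"
  unfolding nn_act_def trans_def by (rule nn_integral_distr) auto

abbreviation jump_flux :: "(real \<Rightarrow> 's \<Rightarrow> ennreal) \<Rightarrow> real \<Rightarrow> 's \<Rightarrow> real \<Rightarrow> ennreal" where
  "jump_flux w t x s \<equiv>
     ennreal (rate (fl x s) * exp (- hazard x s)) * (\<integral>\<^sup>+c. w (t - s) (jump (fl x s) c) \<partial>C)"

text \<open>
  The expected value of \<open>h\<close> at time \<open>t\<close> if \<open>w\<close> gives the expected value after the first jump, as a
  function of the remaining time and of the state.
\<close>

definition first_jump :: "('s \<Rightarrow> ennreal) \<Rightarrow> (real \<Rightarrow> 's \<Rightarrow> ennreal) \<Rightarrow> real \<Rightarrow> 's \<Rightarrow> ennreal" where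
  "first_jump h w t x = ennreal (exp (- hazard x t)) * h (fl x t) +
     (\<integral>\<^sup>+s. jump_flux w t x s *
        indicator {0..t} s \<partial>lborel)"

lemma nn_act_first_jump:
  assumes x: "x \<in> space E" and t: "0 \<le> t" and h[measurable]: "h \<in> borel_measurable E"
  shows "nn_act h t x = first_jump h (nn_act h) t x"
proof -
  interpret P: pair_prob_space exp1 C ..
  let ?k = "\<lambda>s. \<integral>\<^sup>+c. nn_act h (t - s) (jump (fl x s) c) \<partial>C"
  have [measurable]: "(\<lambda>s. fl x s) \<in> borel \<rightarrow>\<^sub>M E" using x by measurable
  have [measurable]: "hold x \<in> borel_measurable borel" using x by measurable
  have k[measurable]: "?k \<in> borel_measurable borel"
    by measurable
  let ?I = "\<lambda>e c. if hold x e \<le> ereal t then nn_act h (t - real_of_ereal (hold x e)) (jump (fl x (real_of_ereal (hold x e))) c) 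
     else h (fl x t)"
  have "nn_act h t x = (\<integral>\<^sup>+\<omega>. h (traj x t \<omega>) \<partial>noiseM)"
    using x by (simp add: nn_act_traj)
  also have "\<dots> = (\<integral>\<^sup>+p. \<integral>\<^sup>+\<omega>. h (traj x t (p ## \<omega>)) \<partial>noiseM \<partial>(exp1 \<Otimes>\<^sub>M C))"
    unfolding noiseM_def using x by (intro P.nn_integral_stream_space) (simp add: noiseM_def[symmetric])
  also have "\<dots> = (\<integral>\<^sup>+p. ?I (fst p) (snd p) \<partial>(exp1 \<Otimes>\<^sub>M C))"
    using x by (intro nn_integral_cong) (auto simp: traj_unfold[OF x t] Let_def nn_act_traj space_pair_measure noise.emeasure_space_1)
  also have "\<dots> = (\<integral>\<^sup>+e. \<integral>\<^sup>+c. ?I e c \<partial>C \<partial>exp1)"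
  proof -
    have "(\<lambda>p. ?I (fst p) (snd p)) \<in> borel_measurable (exp1 \<Otimes>\<^sub>M C)" by measurable
    from C.nn_integral_fst[OF this] show ?thesis unfolding fst_conv snd_conv by (rule sym)
  qed
  also have "\<dots> = (\<integral>\<^sup>+e. (if hold x e \<le> ereal t then ?k (real_of_ereal (hold x e)) else 0) +
      (if hold x e \<le> ereal t then 0 else h (fl x t)) \<partial>exp1)"
    by (intro nn_integral_cong) (auto simp: C.emeasure_space_1)
  also have "\<dots> = (\<integral>\<^sup>+e. (if hold x e \<le> ereal t then ?k (real_of_ereal (hold x e)) else 0) \<partial>exp1) +
      (\<integral>\<^sup>+e. (if hold x e \<le> ereal t then 0 else h (fl x t)) \<partial>exp1)"
    by (intro nn_integral_add) measurable
  also have "\<dots> = first_jump h (nn_act h) t x"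
    unfolding first_jump_def nn_integral_hold[OF x t k] nn_integral_hold_gt[OF x t] by (simp add: add.commute)
  finally show ?thesis .
qed

lemma first_jump_mono:
  assumes x: "x \<in> space E" 
    and h: "\<And>y. y \<in> space E \<Longrightarrow> h y \<le> h' y"
    and w: "\<And>s y. 0 \<le> s \<Longrightarrow> s \<le> t \<Longrightarrow> y \<in> space E \<Longrightarrow> w s y \<le> w' s y"
  shows "first_jump h w t x \<le> first_jump h' w' t x"
  unfolding first_jump_def
  by (intro add_mono mult_left_mono nn_integral_mono h) 
     (auto simp: indicator_def x intro!: mult_left_mono nn_integral_mono w)

lemma first_jump_measurable[measurable (raw)]:
  assumes [measurable]: "h \<in> borel_measurable E" "(\<lambda>p. w (fst p) (snd p)) \<in> borel_measurable (borel \<Otimes>\<^sub>M E)"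
    and f: "f \<in> borel_measurable M" "g \<in> M \<rightarrow>\<^sub>M E"
  shows "(\<lambda>\<omega>. first_jump h w (f \<omega>) (g \<omega>)) \<in> borel_measurable M"
proof -
  have w[measurable]: "(\<lambda>\<omega>. w (a \<omega>) (b \<omega>)) \<in> borel_measurable N"
    if "a \<in> borel_measurable N" "b \<in> N \<rightarrow>\<^sub>M E" for a b and N :: "'x measure"
    using measurable_compose[OF measurable_Pair[OF that] assms(2)] by simp
  have [measurable]: "(\<lambda>\<omega>. w (a \<omega>) (b \<omega>)) \<in> borel_measurable (((borel \<Otimes>\<^sub>M E) \<Otimes>\<^sub>M lborel) \<Otimes>\<^sub>M C)"
    if "a \<in> borel_measurable (((borel \<Otimes>\<^sub>M E) \<Otimes>\<^sub>M lborel) \<Otimes>\<^sub>M C)" "b \<in> (((borel \<Otimes>\<^sub>M E) \<Otimes>\<^sub>M lborel) \<Otimes>\<^sub>M C) \<rightarrow>\<^sub>M E" for a b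
    using measurable_compose[OF measurable_Pair[OF that] assms(2)] by simp
  have "(\<lambda>p. first_jump h w (fst p) (snd p)) \<in> borel_measurable (borel \<Otimes>\<^sub>M E)"
    unfolding first_jump_def
  proof (intro borel_measurable_add borel_measurable_times lborel.borel_measurable_nn_integral)
    have "(\<lambda>q. ennreal (rate (fl (snd (fst q)) (snd q)) * exp (- hazard (snd (fst q)) (snd q))) *
       (\<integral>\<^sup>+ c. w (fst (fst q) - snd q) (jump (fl (snd (fst q)) (snd q)) c) \<partial>C) *
       indicator {q. 0 \<le> snd q \<and> snd q \<le> fst (fst q)} q) \<in> borel_measurable ((borel \<Otimes>\<^sub>M E) \<Otimes>\<^sub>M lborel)"
      by measurable
    then show "(\<lambda>(x, s). ennreal (rate (fl (snd x) s) * exp (- hazard (snd x) s)) *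
       (\<integral>\<^sup>+ c. w (fst x - s) (jump (fl (snd x) s) c) \<partial>C) * indicator {0..fst x} s)
         \<in> borel_measurable ((borel \<Otimes>\<^sub>M E) \<Otimes>\<^sub>M lborel)"
      by (rule measurable_cong[THEN iffD1, rotated]) (auto simp: indicator_def)
  qed measurable
  from measurable_compose[OF measurable_Pair[OF f] this] show ?thesis by simp
qed

lemma jump_integral_measurable:
  assumes x: "x \<in> space E" and w: "(\<lambda>p. w (fst p) (snd p)) \<in> borel_measurable (borel \<Otimes>\<^sub>M E)"
  shows "(\<lambda>s. \<integral>\<^sup>+c. w (t - s) (jump (fl x s) c) \<partial>C) \<in> borel_measurable borel"
proof (rule C.borel_measurable_nn_integral)
  have "(\<lambda>q. (t - fst q, jump (fl x (fst q)) (snd q))) \<in> borel \<Otimes>\<^sub>M C \<rightarrow>\<^sub>M borel \<Otimes>\<^sub>M E"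
    using x by measurable
  from measurable_compose[OF this w]
  show "(\<lambda>(s, c). w (t - s) (jump (fl x s) c)) \<in> borel_measurable (borel \<Otimes>\<^sub>M C)"
    by (simp add: split_beta')
qed

lemma jump_kernel_measurable:
  assumes y: "y \<in> space E" and w: "(\<lambda>p. w (fst p) (snd p)) \<in> borel_measurable (borel \<Otimes>\<^sub>M E)"
  shows "(\<lambda>c. w s (jump y c)) \<in> borel_measurable C"
proof -
  have "(\<lambda>c. (s, jump y c)) \<in> C \<rightarrow>\<^sub>M borel \<Otimes>\<^sub>M E" using y by measurable
  from measurable_compose[OF this w] show ?thesis by simp
qed

lemma rate_fl_measurable:
  "x \<in> space E \<Longrightarrow> (\<lambda>s. ennreal (rate (fl x s) * exp (- hazard x s))) \<in> borel_measurable borel"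
  by measurable

lemma first_jump_add:
  assumes x: "x \<in> space E"
    and w: "(\<lambda>p. w (fst p) (snd p)) \<in> borel_measurable (borel \<Otimes>\<^sub>M E)"
    and w': "(\<lambda>p. w' (fst p) (snd p)) \<in> borel_measurable (borel \<Otimes>\<^sub>M E)"
  shows "first_jump (\<lambda>y. h y + h' y) (\<lambda>s y. w s y + w' s y) t x = first_jump h w t x + first_jump h' w' t x"
proof -
  note [measurable] = jump_integral_measurable[OF x w, of t] jump_integral_measurable[OF x w', of t] rate_fl_measurable[OF x]
  have *: "(\<integral>\<^sup>+c. w (t - s) (jump (fl x s) c) + w' (t - s) (jump (fl x s) c) \<partial>C) =
      (\<integral>\<^sup>+c. w (t - s) (jump (fl x s) c) \<partial>C) + (\<integral>\<^sup>+c. w' (t - s) (jump (fl x s) c) \<partial>C)" for s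
    by (intro nn_integral_add jump_kernel_measurable w w' fl_space x)
  show ?thesis
    unfolding first_jump_def * distrib_left distrib_right
    by (subst nn_integral_add) (auto simp: add_ac)
qed

lemma first_jump_cmult:
  assumes x: "x \<in> space E"
    and w: "(\<lambda>p. w (fst p) (snd p)) \<in> borel_measurable (borel \<Otimes>\<^sub>M E)"
  shows "first_jump (\<lambda>y. k * h y) (\<lambda>s y. k * w s y) t x = k * first_jump h w t x"
proof -
  note [measurable] = jump_integral_measurable[OF x w, of t] rate_fl_measurable[OF x]
  have *: "(\<integral>\<^sup>+c. k * w (t - s) (jump (fl x s) c) \<partial>C) = k * (\<integral>\<^sup>+c. w (t - s) (jump (fl x s) c) \<partial>C)" for s
    by (intro nn_integral_cmult jump_kernel_measurable w fl_space x)
  have **: "a * (k * b) * i = k * (a * b * i)" for a b i :: ennreal by (simp add: mult_ac)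
  show ?thesis
    unfolding first_jump_def * distrib_left ** 
    by (subst nn_integral_cmult) (auto simp: mult_ac)
qed

text \<open>
  \<open>up_to_jumps h m t x\<close> is the expectation of \<open>h\<close> at time \<open>t\<close> on the event of less than \<open>m\<close> jumps up to
  time \<open>t\<close>, and \<open>many_jumps m t x\<close> is the probability of the complementary event. Both are obtained by
  iterating the first-jump equation, without reference to the paths.
\<close>

primrec up_to_jumps :: "('s \<Rightarrow> ennreal) \<Rightarrow> nat \<Rightarrow> real \<Rightarrow> 's \<Rightarrow> ennreal" where
  "up_to_jumps h 0 = (\<lambda>t x. 0)"
| "up_to_jumps h (Suc m) = first_jump h (up_to_jumps h m)"

primrec many_jumps :: "nat \<Rightarrow> real \<Rightarrow> 's \<Rightarrow> ennreal" where
  "many_jumps 0 = (\<lambda>t x. 1)"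
| "many_jumps (Suc m) = first_jump (\<lambda>_. 0) (many_jumps m)"

lemma up_to_jumps_measurable[measurable]:
  "h \<in> borel_measurable E \<Longrightarrow> (\<lambda>p. up_to_jumps h m (fst p) (snd p)) \<in> borel_measurable (borel \<Otimes>\<^sub>M E)"
  by (induction m) (auto intro!: first_jump_measurable)

lemma many_jumps_measurable[measurable]:
  "(\<lambda>p. many_jumps m (fst p) (snd p)) \<in> borel_measurable (borel \<Otimes>\<^sub>M E)"
  by (induction m) (auto intro!: first_jump_measurable)

lemma up_to_jumps_le:
  assumes "\<And>t x. 0 \<le> t \<Longrightarrow> x \<in> space E \<Longrightarrow> first_jump h w t x \<le> w t x" "0 \<le> t" "x \<in> space E"
  shows "up_to_jumps h m t x \<le> w t x"
  using assms(2,3)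
proof (induction m arbitrary: t x)
  case (Suc m)
  have "up_to_jumps h (Suc m) t x \<le> first_jump h w t x"
    using Suc by (auto intro!: first_jump_mono)
  also have "\<dots> \<le> w t x" using Suc assms(1) by auto
  finally show ?case .
qed auto

lemma nn_act_const: "x \<in> space E \<Longrightarrow> nn_act (\<lambda>_. k) t x = k"
  by (simp add: nn_act_traj noise.emeasure_space_1)

lemma first_jump_cong:
  assumes x: "x \<in> space E" 
    and h: "\<And>y. y \<in> space E \<Longrightarrow> h y = h' y"
    and w: "\<And>s y. 0 \<le> s \<Longrightarrow> s \<le> t \<Longrightarrow> y \<in> space E \<Longrightarrow> w s y = w' s y"
  shows "first_jump h w t x = first_jump h' w' t x"
  using h w by (intro antisym first_jump_mono x) simp_all

text \<open>
  The bookkeeping identity that replaces \<open>E h = E (h; N < m) + E (h; N \<ge> m)\<close> for the number \<open>N\<close> of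
  jumps. It follows from the first-jump equation for the constant \<open>k\<close>, the expectation of which is \<open>k\<close>.
\<close>

lemma up_to_jumps_compl:
  assumes "h \<in> borel_measurable E" "h' \<in> borel_measurable E" "\<And>y. y \<in> space E \<Longrightarrow> h y + h' y = k"
    and "0 \<le> t" "x \<in> space E"
  shows "up_to_jumps h m t x + up_to_jumps h' m t x + k * many_jumps m t x = k"
  using assms(4,5)
proof (induction m arbitrary: t x)
  case (Suc m)
  have "up_to_jumps h (Suc m) t x + up_to_jumps h' (Suc m) t x + k * many_jumps (Suc m) t x =
    first_jump (\<lambda>y. h y + h' y + k * 0) (\<lambda>t x. up_to_jumps h m t x + up_to_jumps h' m t x + k * many_jumps m t x) t x"
  proof -
    note m = up_to_jumps_measurable[OF assms(1), of m] up_to_jumps_measurable[OF assms(2), of m] many_jumps_measurable[of m]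
    have "first_jump (\<lambda>y. h y + h' y + k * 0) (\<lambda>t x. up_to_jumps h m t x + up_to_jumps h' m t x + k * many_jumps m t x) t x =
        first_jump (\<lambda>y. h y + h' y) (\<lambda>t x. up_to_jumps h m t x + up_to_jumps h' m t x) t x + first_jump (\<lambda>y. k * 0) (\<lambda>t x. k * many_jumps m t x) t x"
      by (intro first_jump_add borel_measurable_add borel_measurable_times_ennreal borel_measurable_const m Suc.prems)
    also have "first_jump (\<lambda>y. h y + h' y) (\<lambda>t x. up_to_jumps h m t x + up_to_jumps h' m t x) t x =
        first_jump h (up_to_jumps h m) t x + first_jump h' (up_to_jumps h' m) t x"
      by (intro first_jump_add m Suc.prems)
    also have "first_jump (\<lambda>y. k * 0) (\<lambda>t x. k * many_jumps m t x) t x = k * first_jump (\<lambda>_. 0) (many_jumps m) t x"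
      by (rule first_jump_cmult[OF Suc.prems(2) m(3)])
    finally show ?thesis by simp
  qed
  also have "\<dots> = first_jump (\<lambda>_. k) (nn_act (\<lambda>_. k)) t x"
    using Suc by (intro first_jump_cong) (auto simp: nn_act_const assms(3))
  also have "\<dots> = k" using Suc.prems by (simp add: nn_act_first_jump[symmetric] nn_act_const)
  finally show ?case .
qed auto

text \<open>
  The tool for verifying supersolutions: \<open>g s\<close> bounds the value at the remaining time \<open>t - s\<close> in the state
  reached by the flow. The generator inequality \<open>g' + k \<le> rate * g\<close> says that
  \<open>- exp (- hazard) * g\<close> grows at least at the rate \<open>exp (- hazard) * k\<close> at which the jumps contribute,
  and integrating it from \<open>0\<close> to \<open>t\<close> gives the claim.
\<close>

lemma first_jump_le_FTC:
  fixes g g' k :: "real \<Rightarrow> real"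
  assumes x: "x \<in> space E" and t: "0 \<le> t"
    and g: "\<And>s. (g has_real_derivative g' s) (at s)" and g': "continuous_on UNIV g'"
    and k: "\<And>s. 0 \<le> s \<Longrightarrow> s \<le> t \<Longrightarrow>
       ennreal (rate (fl x s)) * (\<integral>\<^sup>+c. w (t - s) (jump (fl x s) c) \<partial>C) \<le> ennreal (k s)"
      "\<And>s. 0 \<le> s \<Longrightarrow> s \<le> t \<Longrightarrow> 0 \<le> k s"
    and le: "\<And>s. 0 \<le> s \<Longrightarrow> s \<le> t \<Longrightarrow> g' s + k s \<le> rate (fl x s) * g s"
    and h: "h (fl x t) \<le> ennreal (g t)" "0 \<le> g t"
  shows "first_jump h w t x \<le> ennreal (g 0)"
proof -
  obtain F where F: "\<And>t. (F has_real_derivative rate (fl x t)) (at t)" "F 0 = 0" "\<And>t. 0 \<le> t \<Longrightarrow> hazard x t = F t"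
    using hazard_antiderivative[OF x] by metis
  let ?D = "\<lambda>s. exp (- F s) * (rate (fl x s) * g s - g' s)"
  have D: "((\<lambda>s. - (exp (- F s) * g s)) has_real_derivative ?D s) (at s)" for s
    by (auto intro!: derivative_eq_intros F(1) g simp: algebra_simps)
  have contF: "continuous_on UNIV F" using F(1) by (meson DERIV_isCont continuous_at_imp_continuous_on)
  have contg: "continuous_on UNIV g" using g by (meson DERIV_isCont continuous_at_imp_continuous_on)
  have D_meas: "?D \<in> borel_measurable borel"
    by (intro borel_measurable_continuous_onI continuous_intros contF contg g' rate_cont x)
  have D_ge: "exp (- F s) * k s \<le> ?D s" if "0 \<le> s" "s \<le> t" for s
    using le[OF that] by (intro mult_left_mono) auto
  have "(\<integral>\<^sup>+s. jump_flux w t x s *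
        indicator {0..t} s \<partial>lborel) \<le> (\<integral>\<^sup>+s. ennreal (?D s) * indicator {0..t} s \<partial>lborel)"
  proof (intro nn_integral_mono)
    fix s :: real
    show "jump_flux w t x s * indicator {0..t} s
       \<le> ennreal (?D s) * indicator {0..t} s"
    proof (cases "s \<in> {0..t}")
      case True
      then have s: "0 \<le> s" "s \<le> t" by auto
      have "jump_flux w t x s =
         ennreal (exp (- F s)) * (ennreal (rate (fl x s)) * (\<integral>\<^sup>+c. w (t - s) (jump (fl x s) c) \<partial>C))"
        using s by (simp add: F(3) ennreal_mult rate_nonneg x mult_ac)
      also have "\<dots> \<le> ennreal (exp (- F s)) * ennreal (k s)"
        by (intro mult_left_mono k s) auto
      also have "\<dots> \<le> ennreal (?D s)"
        using D_ge[OF s] k(2)[OF s] by (subst ennreal_mult[symmetric]) (auto intro!: ennreal_leI)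
      finally show ?thesis using True by simp
    qed auto
  qed
  also have "\<dots> = ennreal (- (exp (- F t) * g t) - (- (exp (- F 0) * g 0)))"
  proof (rule nn_integral_FTC_Icc[OF D_meas _ _ t])
    fix s assume "s \<in> {0..t}"
    then have s: "0 \<le> s" "s \<le> t" by auto
    show "0 \<le> ?D s" using D_ge[OF s] k(2)[OF s] by (smt (verit) exp_ge_zero mult_nonneg_nonneg)
    show "((\<lambda>s. - (exp (- F s) * g s)) has_real_derivative ?D s) (at s)"
      by (rule D)
  qed
  finally have I: "(\<integral>\<^sup>+s. jump_flux w t x s *
        indicator {0..t} s \<partial>lborel) \<le> ennreal (g 0 - exp (- F t) * g t)"
    by (simp add: F(2))
  have mono: "- (exp (- F 0) * g 0) \<le> - (exp (- F t) * g t)"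
  proof (rule DERIV_nonneg_imp_nondecreasing[OF t])
    fix s assume s: "0 \<le> s" "s \<le> t"
    have "0 \<le> ?D s" using D_ge[OF s] k(2)[OF s] by (smt (verit) exp_ge_zero mult_nonneg_nonneg)
    then show "\<exists>y. ((\<lambda>s. - (exp (- F s) * g s)) has_real_derivative y) (at s) \<and> 0 \<le> y" using D by blast
  qed
  have "ennreal (exp (- hazard x t)) * h (fl x t) \<le> ennreal (exp (- F t)) * ennreal (g t)"
    unfolding F(3)[OF t] by (intro mult_left_mono h) auto
  then have "first_jump h w t x \<le> ennreal (exp (- F t) * g t) + ennreal (g 0 - exp (- F t) * g t)"
    unfolding first_jump_def using h by (intro add_mono I) (simp add: ennreal_mult)
  also have "\<dots> = ennreal (g 0)"
    using mono h F(2) by (subst ennreal_plus[symmetric]) auto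
  finally show ?thesis .
qed

end

section \<open>Non-explosion and the comparison principle\<close>

text \<open>
  A Lyapunov function that does not increase along the flow, increases by a bounded amount in mean at
  each jump, and controls the jump rate linearly. It keeps the jump times from accumulating.
\<close>

locale pdmp_lyapunov = pdmp E C fl rate jump origin
  for E :: "'s measure" and C :: "'c measure" and fl rate jump origin +
  fixes H :: "'s \<Rightarrow> real" and r B :: real
  assumes H_meas[measurable]: "H \<in> borel_measurable E"
    and H_nonneg: "x \<in> space E \<Longrightarrow> 0 \<le> H x"
    and H_fl: "x \<in> space E \<Longrightarrow> 0 \<le> s \<Longrightarrow> H (fl x s) \<le> H x"
    and r_nonneg: "0 \<le> r" and B_nonneg: "0 \<le> B"
    and rate_le: "x \<in> space E \<Longrightarrow> rate x \<le> r * (1 + H x)"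
    and H_jump: "x \<in> space E \<Longrightarrow> (\<integral>\<^sup>+c. ennreal (H (jump x c)) \<partial>C) \<le> ennreal (H x + B)"
begin

definition growth_bound :: "real \<Rightarrow> 's \<Rightarrow> ennreal" where
  "growth_bound t x = ennreal (exp (r * (1 + B) * t) * (1 + H x))"

text \<open>
  One supersolution for two purposes: the summand \<open>1 + H\<close> gives the bound on the moment of \<open>H\<close>, and the
  summand \<open>1\<close> in \<open>1 + growth_bound t x\<close> counts the jump, so that the expected number of jumps is
  bounded as well. The exponent comes from \<open>rate x * (1 + B) \<le> r * (1 + B) * (1 + H x)\<close>.
\<close>

lemma first_jump_growth_bound:
  assumes x: "x \<in> space E" and t: "0 \<le> t"
  shows "first_jump (\<lambda>x. ennreal (1 + H x)) (\<lambda>t x. 1 + growth_bound t x) t x \<le> growth_bound t x"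
proof -
  define b where "b = r * (1 + B)"
  have b: "0 \<le> b" using r_nonneg B_nonneg by (simp add: b_def)
  define D where "D = 1 + H x"
  have D: "1 \<le> D" using H_nonneg[OF x] by (simp add: D_def)
  let ?g = "\<lambda>s. exp (b * (t - s)) * D"
  let ?k = "\<lambda>s. rate (fl x s) * (1 + exp (b * (t - s)) * (D + B))"
  have "first_jump (\<lambda>x. ennreal (1 + H x)) (\<lambda>t x. 1 + growth_bound t x) t x \<le> ennreal (?g 0)"
  proof (rule first_jump_le_FTC[OF x t, where k = ?k and g = ?g and g' = "\<lambda>s. - b * exp (b * (t - s)) * D"])
    show "(?g has_real_derivative - b * exp (b * (t - s)) * D) (at s)" for s
      by (auto intro!: derivative_eq_intros)
    show "continuous_on UNIV (\<lambda>s. - b * exp (b * (t - s)) * D)"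
      by (intro continuous_intros)
    show "0 \<le> ?k s" for s using x D B_nonneg by (auto intro!: mult_nonneg_nonneg rate_nonneg add_nonneg_nonneg)
    fix s assume s: "0 \<le> s" "s \<le> t"
    have e: "1 \<le> exp (b * (t - s))" using b s by simp
    have y: "fl x s \<in> space E" using x by simp
    have "(\<integral>\<^sup>+c. 1 + growth_bound (t - s) (jump (fl x s) c) \<partial>C) =
        (\<integral>\<^sup>+c. ennreal (1 + exp (b * (t - s))) + ennreal (exp (b * (t - s))) * ennreal (H (jump (fl x s) c)) \<partial>C)"
      using y unfolding growth_bound_def b_def[symmetric]
    proof (intro nn_integral_cong)
      fix c assume "c \<in> space C"
      then have "0 \<le> H (jump (fl x s) c)" using y by (simp add: H_nonneg)
      then have "1 + ennreal (exp (b * (t - s)) * (1 + H (jump (fl x s) c))) =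
          ennreal (1 + exp (b * (t - s)) + exp (b * (t - s)) * H (jump (fl x s) c))"
        by (subst ennreal_1[symmetric], subst ennreal_plus[symmetric]) (auto simp: algebra_simps)
      also have "\<dots> = ennreal (1 + exp (b * (t - s))) + ennreal (exp (b * (t - s))) * ennreal (H (jump (fl x s) c))"
        using \<open>0 \<le> H (jump (fl x s) c)\<close> by (subst ennreal_plus) (auto simp: ennreal_mult)
      finally show "1 + ennreal (exp (b * (t - s)) * (1 + H (jump (fl x s) c))) =
          ennreal (1 + exp (b * (t - s))) + ennreal (exp (b * (t - s))) * ennreal (H (jump (fl x s) c))" .
    qed
    also have "\<dots> = ennreal (1 + exp (b * (t - s))) + ennreal (exp (b * (t - s))) * (\<integral>\<^sup>+c. ennreal (H (jump (fl x s) c)) \<partial>C)"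
      using y by (subst nn_integral_add) (auto simp: nn_integral_cmult C.emeasure_space_1)
    also have "\<dots> \<le> ennreal (1 + exp (b * (t - s))) + ennreal (exp (b * (t - s))) * ennreal (H (fl x s) + B)"
      by (intro add_mono mult_left_mono H_jump y order_refl) auto
    also have "\<dots> = ennreal (1 + exp (b * (t - s)) * (1 + H (fl x s) + B))"
      using H_nonneg[OF y] B_nonneg 
      by (simp add: ennreal_mult[symmetric] ennreal_plus[symmetric] distrib_left add.assoc del: ennreal_plus)
    also have "\<dots> \<le> ennreal (1 + exp (b * (t - s)) * (D + B))"
      using H_fl[OF x s(1)] by (intro ennreal_leI) (auto simp: D_def)
    finally show "ennreal (rate (fl x s)) * (\<integral>\<^sup>+c. 1 + growth_bound (t - s) (jump (fl x s) c) \<partial>C) \<le> ennreal (?k s)"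
      using D B_nonneg rate_nonneg[OF y] by (subst ennreal_mult) (auto intro!: mult_left_mono)
    have "rate (fl x s) * (1 + exp (b * (t - s)) * B) \<le> (r * D) * (exp (b * (t - s)) * (1 + B))"
    proof (rule mult_mono)
      show "rate (fl x s) \<le> r * D"
        using rate_le[OF y] H_fl[OF x s(1)] r_nonneg unfolding D_def
        by (meson add_left_mono mult_left_mono order_trans)
      show "1 + exp (b * (t - s)) * B \<le> exp (b * (t - s)) * (1 + B)" using e by (simp add: algebra_simps)
    qed (use r_nonneg D B_nonneg in auto)
    then show "- b * exp (b * (t - s)) * D + ?k s \<le> rate (fl x s) * ?g s"
      by (simp add: b_def algebra_simps)
  next
    show "ennreal (1 + H (fl x t)) \<le> ennreal (?g t)"
      using H_fl[OF x t] by (auto simp: D_def intro!: ennreal_leI)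
    show "0 \<le> ?g t" using D by simp
  qed
  then show ?thesis by (simp add: growth_bound_def b_def D_def)
qed

text \<open>
  Markov's inequality for the number of jumps, proved by induction because \<open>growth_bound\<close> absorbs one
  more jump in each step.
\<close>

lemma many_jumps_le:
  assumes "0 \<le> t" "x \<in> space E"
  shows "of_nat m * many_jumps m t x \<le> growth_bound t x"
  using assms
proof (induction m arbitrary: t x)
  case (Suc m)
  have rem1: "many_jumps m s y \<le> 1" if "0 \<le> s" "y \<in> space E" for s y
  proof -
    have "up_to_jumps (\<lambda>_. 0) m s y + up_to_jumps (\<lambda>_. 1) m s y + 1 * many_jumps m s y = 1"
      using that by (intro up_to_jumps_compl) auto
    moreover have "many_jumps m s y \<le> (up_to_jumps (\<lambda>_. 0) m s y + up_to_jumps (\<lambda>_. 1) m s y) + 1 * many_jumps m s y"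
      by (intro add_increasing) auto
    ultimately show ?thesis by simp
  qed
  have "of_nat (Suc m) * many_jumps (Suc m) t x = first_jump (\<lambda>_. of_nat (Suc m) * 0) (\<lambda>t x. of_nat (Suc m) * many_jumps m t x) t x"
    unfolding many_jumps.simps using Suc.prems by (intro first_jump_cmult[symmetric] many_jumps_measurable)
  also have "\<dots> \<le> first_jump (\<lambda>x. ennreal (1 + H x)) (\<lambda>t x. 1 + growth_bound t x) t x"
    using Suc by (intro first_jump_mono) (auto simp: distrib_right intro!: add_mono rem1)
  also have "\<dots> \<le> growth_bound t x" using Suc.prems by (intro first_jump_growth_bound)
  finally show ?case .
qed auto

text \<open>
  The part of \<open>h\<close> with less than \<open>m\<close> jumps lies below \<open>w\<close>, and the rest is at most \<open>k\<close> times a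
  probability that vanishes as \<open>m\<close> grows. The rest is reached through the complement \<open>k - h\<close>, as only
  lower bounds of the semigroup by its iterates are at hand.
\<close>

lemma nn_act_le_bounded:
  assumes h[measurable]: "h \<in> borel_measurable E" and bd: "\<And>x. h x \<le> ennreal k" and k: "0 \<le> k"
    and w: "\<And>t x. 0 \<le> t \<Longrightarrow> x \<in> space E \<Longrightarrow> first_jump h w t x \<le> w t x" 
    and t: "0 \<le> t" and x: "x \<in> space E"
  shows "nn_act h t x \<le> w t x"
proof (rule ennreal_le_epsilon)
  fix e :: real assume e: "0 < e"
  let ?h = "\<lambda>x. ennreal k - h x"
  have hh: "h x + ?h x = ennreal k" for x using bd[of x] by (simp add: add_diff_inverse_ennreal)
  have it: "up_to_jumps ?h m t x \<le> nn_act ?h t x" for m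
    by (rule up_to_jumps_le) (use t x in \<open>auto simp: nn_act_first_jump[symmetric]\<close>)
  have "nn_act h t x + nn_act ?h t x = nn_act (\<lambda>_. ennreal k) t x"
    using x by (simp add: nn_act_traj nn_integral_add[symmetric] hh)
  then have sum: "nn_act h t x + nn_act ?h t x = ennreal k" using x by (simp add: nn_act_const)
  obtain m :: nat where m: "k * (exp (r * (1 + B) * t) * (1 + H x)) / e < m" 
    using reals_Archimedean2 by blast
  have "0 \<le> k * (exp (r * (1 + B) * t) * (1 + H x)) / e" using k e H_nonneg[OF x] by auto
  with m have m0: "0 < m" by (metis of_nat_0_less_iff order_le_less_trans)
  let ?W = "exp (r * (1 + B) * t) * (1 + H x)"
  have W0: "0 \<le> ?W" using H_nonneg[OF x] by simp
  have "many_jumps m t x \<le> ennreal (?W / m)"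
  proof -
    have "ennreal (real m) * many_jumps m t x \<le> ennreal ?W"
      using many_jumps_le[OF t x, of m] by (simp add: growth_bound_def ennreal_of_nat_eq_real_of_nat)
    then have "ennreal (1 / real m) * (ennreal (real m) * many_jumps m t x) \<le> ennreal (1 / real m) * ennreal ?W"
      by (intro mult_left_mono) auto
    then show ?thesis using m0 W0
      by (simp add: mult.assoc[symmetric] ennreal_mult[symmetric])
  qed
  then have "ennreal k * many_jumps m t x \<le> ennreal k * ennreal (?W / m)"
    by (intro mult_left_mono) auto
  also have "\<dots> \<le> ennreal e"
    using m m0 e k W0 by (subst ennreal_mult[symmetric]) (auto intro!: ennreal_leI simp: field_simps)
  finally have rest: "ennreal k * many_jumps m t x \<le> ennreal e" .
  have "nn_act h t x + up_to_jumps ?h m t x \<le> up_to_jumps h m t x + up_to_jumps ?h m t x + ennreal k * many_jumps m t x"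
  proof -
    have "up_to_jumps h m t x + up_to_jumps ?h m t x + ennreal k * many_jumps m t x = ennreal k"
      using up_to_jumps_compl[OF h _ hh t x, of m] by simp
    then show ?thesis using sum it[of m] by (metis add_left_mono)
  qed
  then have "up_to_jumps ?h m t x + nn_act h t x \<le> up_to_jumps ?h m t x + (up_to_jumps h m t x + ennreal k * many_jumps m t x)"
    by (simp add: add_ac)
  moreover have "up_to_jumps ?h m t x < \<top>"
  proof -
    have "nn_act ?h t x \<le> nn_act h t x + nn_act ?h t x" by (intro add_increasing) auto
    also have "\<dots> = ennreal k" by (rule sum)
    finally have "nn_act ?h t x \<le> ennreal k" .
    with it[of m] have "up_to_jumps ?h m t x \<le> ennreal k" by (rule order_trans)
    then show ?thesis using ennreal_less_top by (rule le_less_trans)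
  qed
  ultimately have "nn_act h t x \<le> up_to_jumps h m t x + ennreal k * many_jumps m t x"
    by (auto simp: ennreal_add_left_cancel_le)
  also have "\<dots> \<le> w t x + ennreal e"
    by (intro add_mono rest up_to_jumps_le w t x)
  finally show "nn_act h t x \<le> w t x + ennreal e" .
qed

text \<open>
  The semigroup is the smallest supersolution of the first-jump equation. Without non-explosion this
  would only hold for the process killed at the accumulation point of the jumps.
\<close>

theorem nn_act_le:
  assumes h[measurable]: "h \<in> borel_measurable E"
    and w: "\<And>t x. 0 \<le> t \<Longrightarrow> x \<in> space E \<Longrightarrow> first_jump h w t x \<le> w t x" 
    and t: "0 \<le> t" and x: "x \<in> space E"
  shows "nn_act h t x \<le> w t x"
proof -
  have "nn_act (\<lambda>x. min (h x) (ennreal (real n))) t x \<le> w t x" for n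
  proof (rule nn_act_le_bounded[where k = "real n"])
    fix t :: real and x assume tx: "0 \<le> t" "x \<in> space E"
    have "first_jump (\<lambda>x. min (h x) (ennreal (real n))) w t x \<le> first_jump h w t x"
      using tx by (intro first_jump_mono) auto
    with w[OF tx] show "first_jump (\<lambda>x. min (h x) (ennreal (real n))) w t x \<le> w t x" by auto
  qed (use t x in auto)
  then have "(SUP n. nn_act (\<lambda>x. min (h x) (ennreal (real n))) t x) \<le> w t x" by (rule SUP_least)
  moreover have "(SUP n. nn_act (\<lambda>x. min (h x) (ennreal (real n))) t x) = nn_act h t x"
  proof -
    have min: "(SUP n. min (h y) (ennreal (real n))) = h y" for y
      by (simp add: inf_min[symmetric] inf_SUP[symmetric] ennreal_of_nat_eq_real_of_nat[symmetric] ennreal_SUP_of_nat_eq_top)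
    have "(SUP n. nn_act (\<lambda>x. min (h x) (ennreal (real n))) t x) = (\<integral>\<^sup>+y. (SUP n. min (h y) (ennreal (real n))) \<partial>trans t x)"
      unfolding nn_act_def
      by (intro nn_integral_monotone_convergence_SUP[symmetric])
         (auto simp: incseq_def le_fun_def min_le_iff_disj intro!: min.mono ennreal_leI)
    also have "\<dots> = nn_act h t x" unfolding min nn_act_def ..
    finally show ?thesis .
  qed
  ultimately show ?thesis by simp
qed

end

section \<open>Markov property and images of the process\<close>

text \<open>
  Comparing complements turns an inequality between probability measures into an equality, so for
  identifying two laws the one-sided bound \<open>nn_act_le\<close> suffices.
\<close>

lemma prob_space_eqI_le:
  assumes "prob_space M" "prob_space N" and sets: "sets M = sets N"
    and le: "\<And>A. A \<in> sets M \<Longrightarrow> emeasure M A \<le> emeasure N A"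
  shows "M = N"
proof (rule measure_eqI[OF sets])
  interpret M: prob_space M by fact
  interpret N: prob_space N by fact
  fix A assume A: "A \<in> sets M"
  note sp = sets_eq_imp_space_eq[OF sets]
  from A have "M.prob A \<le> N.prob A" "M.prob (space M - A) \<le> N.prob (space N - A)"
    using le[of A] le[of "space M - A"] sets.compl_sets[OF A]
    by (auto simp: M.emeasure_eq_measure N.emeasure_eq_measure sp)
  then have "M.prob A = N.prob A"
    using A sets by (simp add: M.prob_compl N.prob_compl)
  then show "emeasure M A = emeasure N A"
    by (simp add: M.emeasure_eq_measure N.emeasure_eq_measure)
qed

context pdmp begin

text \<open>
  Restarting at time \<open>r\<close> in the absence of jumps: the hazard is additive along the flow, so the survival
  probability up to \<open>r\<close> turns the first-jump equation from \<open>fl x r\<close> into its part after time \<open>r\<close>.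
\<close>

lemma exp_first_jump_fl:
  assumes x: "x \<in> space E" and r: "0 \<le> r" and s: "0 \<le> s"
    and w: "(\<lambda>p. w (fst p) (snd p)) \<in> borel_measurable (borel \<Otimes>\<^sub>M E)"
  shows "ennreal (exp (- hazard x r)) * first_jump h w s (fl x r) = ennreal (exp (- hazard x (r + s))) * h (fl x (r + s)) +
     (\<integral>\<^sup>+u. jump_flux w (r + s) x u *
        indicator {r..r + s} u \<partial>lborel)"
proof -
  note [measurable] = jump_integral_measurable[OF x w] jump_integral_measurable[OF fl_space[OF x] w]
    rate_fl_measurable[OF x] rate_fl_measurable[OF fl_space[OF x]]
  let ?f = "\<lambda>u. jump_flux w (r + s) x u *
        indicator {r..r + s} u"
  have "(\<integral>\<^sup>+u. ?f u \<partial>lborel) = (\<integral>\<^sup>+v. ?f (r + v) \<partial>lborel)"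
    by (subst nn_integral_real_affine[where c = 1 and t = r]) auto
  also have "\<dots> = (\<integral>\<^sup>+v. ennreal (exp (- hazard x r)) * (ennreal (rate (fl (fl x r) v) * exp (- hazard (fl x r) v)) *
       (\<integral>\<^sup>+c. w (s - v) (jump (fl (fl x r) v) c) \<partial>C) * indicator {0..s} v) \<partial>lborel)"
  proof (intro nn_integral_cong)
    fix v :: real
    show "?f (r + v) = ennreal (exp (- hazard x r)) * (ennreal (rate (fl (fl x r) v) * exp (- hazard (fl x r) v)) *
       (\<integral>\<^sup>+c. w (s - v) (jump (fl (fl x r) v) c) \<partial>C) * indicator {0..s} v)"
    proof (cases "v \<in> {0..s}")
      case True
      then have v: "0 \<le> v" "v \<le> s" by auto
      have "rate (fl x (r + v)) * exp (- hazard x (r + v)) = exp (- hazard x r) * (rate (fl (fl x r) v) * exp (- hazard (fl x r) v))"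
        using x r v by (simp add: hazard_add fl_add exp_add[symmetric] exp_minus_inverse mult_ac)
      then show ?thesis using True x r
        by (simp only: fl_add[OF x]) (simp add: ennreal_mult' mult.assoc)
    qed auto
  qed
  also have "\<dots> = ennreal (exp (- hazard x r)) * (\<integral>\<^sup>+v. ennreal (rate (fl (fl x r) v) * exp (- hazard (fl x r) v)) *
       (\<integral>\<^sup>+c. w (s - v) (jump (fl (fl x r) v) c) \<partial>C) * indicator {0..s} v \<partial>lborel)"
    by (intro nn_integral_cmult) measurable
  finally have I: "(\<integral>\<^sup>+u. ?f u \<partial>lborel) = \<dots>" .
  have "ennreal (exp (- hazard x r)) * (ennreal (exp (- hazard (fl x r) s)) * h (fl (fl x r) s)) =
      ennreal (exp (- hazard x (r + s))) * h (fl x (r + s))"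
    using x r s by (simp add: hazard_add fl_add mult.assoc[symmetric] ennreal_mult[symmetric] exp_add[symmetric])
  then show ?thesis unfolding I by (simp add: first_jump_def distrib_left)
qed

lemma first_jump_split:
  assumes x: "x \<in> space E" and r: "0 \<le> r" and s: "0 \<le> s"
    and w: "(\<lambda>p. w (fst p) (snd p)) \<in> borel_measurable (borel \<Otimes>\<^sub>M E)"
  shows "first_jump h w (r + s) x = ennreal (exp (- hazard x r)) * first_jump h w s (fl x r) +
     (\<integral>\<^sup>+u. jump_flux w (r + s) x u *
        indicator {0..r} u \<partial>lborel)"
proof -
  note [measurable] = jump_integral_measurable[OF x w] rate_fl_measurable[OF x]
  let ?f = "\<lambda>u. jump_flux w (r + s) x u"
  have "(\<integral>\<^sup>+u. ?f u * indicator {0..r + s} u \<partial>lborel) =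
     (\<integral>\<^sup>+u. ?f u * indicator {r..r + s} u + ?f u * indicator {0..r} u \<partial>lborel)"
    using AE_lborel_singleton[of r] r s
    by (intro nn_integral_cong_AE) (auto simp: indicator_def)
  also have "\<dots> = (\<integral>\<^sup>+u. ?f u * indicator {r..r + s} u \<partial>lborel) + (\<integral>\<^sup>+u. ?f u * indicator {0..r} u \<partial>lborel)"
    by (intro nn_integral_add) measurable
  finally show ?thesis
    unfolding exp_first_jump_fl[OF x r s w] by (simp add: first_jump_def add.assoc)
qed

lemma nn_act_measurable2: "h \<in> borel_measurable E \<Longrightarrow> (\<lambda>p. nn_act h (fst p) (snd p)) \<in> borel_measurable (borel \<Otimes>\<^sub>M E)"
  by measurable

lemma nn_act_0: "x \<in> space E \<Longrightarrow> h \<in> borel_measurable E \<Longrightarrow> nn_act h 0 x = h x"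
proof -
  assume x: "x \<in> space E" and h: "h \<in> borel_measurable E"
  have "(\<integral>\<^sup>+s. jump_flux (nn_act h) 0 x s *
        indicator {0..0} s \<partial>lborel) = (\<integral>\<^sup>+s. 0 \<partial>(lborel :: real measure))"
    using AE_lborel_singleton[of 0] by (intro nn_integral_cong_AE) (auto simp: indicator_def)
  then show ?thesis
    using x h by (simp add: nn_act_first_jump[OF x _ h] first_jump_def)
qed

end

context pdmp_lyapunov begin

text \<open>
  Two-step averaging, continued by the semigroup itself for times up to \<open>s\<close>, solves the same first-jump
  equation as the semigroup; the two pieces are joined by \<open>first_jump_split\<close>.
\<close>

lemma nn_act_add_le:
  assumes h: "h \<in> borel_measurable E" and v: "0 \<le> v" and s: "0 \<le> s" and x: "x \<in> space E"
  shows "nn_act h (v + s) x \<le> nn_act (nn_act h s) v x"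
proof -
  have ph: "nn_act h s \<in> borel_measurable E" using h by measurable
  define w where "w = (\<lambda>T y. if T \<le> s then nn_act h T y else nn_act (nn_act h s) (T - s) y)"
  have w_meas: "(\<lambda>p. w (fst p) (snd p)) \<in> borel_measurable (borel \<Otimes>\<^sub>M E)"
    unfolding w_def using h ph by measurable
  have w_le: "first_jump h w T y = nn_act h T y" if "0 \<le> T" "T \<le> s" "y \<in> space E" for T y
    using that h by (subst nn_act_first_jump) (auto intro!: first_jump_cong simp: w_def)
  have "nn_act h (v + s) x \<le> w (v + s) x"
  proof (rule nn_act_le[OF h])
    fix T :: real and y assume T: "0 \<le> T" and y: "y \<in> space E"
    show "first_jump h w T y \<le> w T y"
    proof (cases "T \<le> s")
      case True
      then show ?thesis using w_le[OF T True y] by (simp add: w_def)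
    next
      case False
      define q where "q = T - s"
      have q: "0 \<le> q" "T = q + s" "0 < q" using False by (auto simp: q_def)
      have "first_jump h w T y = ennreal (exp (- hazard y q)) * nn_act h s (fl y q) + 
         (\<integral>\<^sup>+u. jump_flux w (q + s) y u *
        indicator {0..q} u \<partial>lborel)"
        unfolding q(2) first_jump_split[OF y q(1) s w_meas] using y s by (simp add: w_le)
      also have "(\<integral>\<^sup>+u. jump_flux w (q + s) y u *
        indicator {0..q} u \<partial>lborel) = 
        (\<integral>\<^sup>+u. jump_flux (nn_act (nn_act h s)) q y u *
        indicator {0..q} u \<partial>lborel)"
        using AE_lborel_singleton[of q]
        by (intro nn_integral_cong_AE) (auto simp: indicator_def w_def intro!: arg_cong2[where f="(*)"] nn_integral_cong)
      also have "ennreal (exp (- hazard y q)) * nn_act h s (fl y q) + \<dots> = first_jump (nn_act h s) (nn_act (nn_act h s)) q y"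
        by (simp add: first_jump_def)
      also have "\<dots> = nn_act (nn_act h s) q y"
        using y q ph by (simp add: nn_act_first_jump[symmetric])
      finally show ?thesis using False by (simp add: w_def q_def)
    qed
  qed (use v s x in auto)
  also have "w (v + s) x \<le> nn_act (nn_act h s) v x"
    using v x h ph by (auto simp: w_def nn_act_0)
  finally show ?thesis .
qed

theorem trans_add:
  assumes v: "0 \<le> v" and s: "0 \<le> s" and x: "x \<in> space E"
  shows "trans (v + s) x = trans v x \<bind> trans s"
proof (rule prob_space_eqI_le)
  have tm: "trans s \<in> trans v x \<rightarrow>\<^sub>M subprob_algebra E"
    by (intro measurable_prob_algebraD) measurable
  show "prob_space (trans (v + s) x)" by (rule prob_space_trans[OF x])
  show "prob_space (trans v x \<bind> trans s)"
    by (intro prob_space.prob_space_bind[OF prob_space_trans[OF x] _ tm] AE_I2) (simp add: prob_space_trans)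
  have ne: "space (trans v x) \<noteq> {}" using x by auto
  show sets: "sets (trans (v + s) x) = sets (trans v x \<bind> trans s)"
    using ne by (subst sets_bind[of _ _ E]) auto
  fix A assume "A \<in> sets (trans (v + s) x)"
  then have A: "A \<in> sets E" by simp
  have "emeasure (trans (v + s) x) A = nn_act (indicator A) (v + s) x"
    unfolding nn_act_def using A by simp
  also have "\<dots> \<le> nn_act (nn_act (indicator A) s) v x"
    using A by (intro nn_act_add_le v s x) auto
  also have "\<dots> = (\<integral>\<^sup>+y. emeasure (trans s y) A \<partial>trans v x)"
    unfolding nn_act_def using A by (intro nn_integral_cong) simp
  also have "\<dots> = emeasure (trans v x \<bind> trans s) A"
    by (rule emeasure_bind[OF ne tm A, symmetric])
  finally show "emeasure (trans (v + s) x) A \<le> emeasure (trans v x \<bind> trans s) A" .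
qed

end

text \<open>
  The image of a process under \<open>p\<close> is again such a process if \<open>p\<close> commutes with the flows and each jump
  is seen by the image as a jump at the image's own rate, or not at all. The additional jumps that the
  image does not see shift the first-jump time but not the law: averaging the restarted first-jump
  equation over the time of the first unseen jump reproduces it (an exchange of integrals).
\<close>

theorem pdmp_projection:
  fixes E1 :: "'s1 measure" and C1 :: "'c1 measure" and E :: "'s measure" and C :: "'c measure"
  assumes "pdmp_lyapunov E1 C1 fl1 rate1 jump1 cem1 H1 r1 B1"
    and "pdmp E C fl rate jump origin"
    and p[measurable]: "p \<in> E1 \<rightarrow>\<^sub>M E"
    and p_fl: "\<And>z s. z \<in> space E1 \<Longrightarrow> p (fl1 z s) = fl (p z) s"
    and rate_le: "\<And>z. z \<in> space E1 \<Longrightarrow> rate (p z) \<le> rate1 z"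
    and p_jump: "\<And>z k. z \<in> space E1 \<Longrightarrow> k \<in> borel_measurable E \<Longrightarrow>
       ennreal (rate1 z) * (\<integral>\<^sup>+c. k (p (jump1 z c)) \<partial>C1) =
       ennreal (rate (p z)) * (\<integral>\<^sup>+c. k (jump (p z) c) \<partial>C) + ennreal (rate1 z - rate (p z)) * k (p z)"
    and t: "0 \<le> t" and z: "z \<in> space E1"
  shows "distr (pdmp.trans E1 C1 fl1 rate1 jump1 cem1 t z) E p = pdmp.trans E C fl rate jump origin t (p z)"
proof -
  interpret Z: pdmp_lyapunov E1 C1 fl1 rate1 jump1 cem1 H1 r1 B1 by fact
  interpret X: pdmp E C fl rate jump origin by fact
  have p_space[simp]: "p z \<in> space E" if "z \<in> space E1" for z
    using measurable_space[OF p that] .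
  have key: "Z.first_jump (\<lambda>z. h (p z)) (\<lambda>t z. X.nn_act h t (p z)) t z = X.nn_act h t (p z)"
    if h: "h \<in> borel_measurable E" and t: "0 \<le> t" and z: "z \<in> space E1" for h t z
  proof -
    let ?x = "p z"
    have x: "?x \<in> space E" using z by simp
    obtain M where M: "\<And>t. (M has_real_derivative rate1 (fl1 z t)) (at t)" "M 0 = 0" "\<And>t. 0 \<le> t \<Longrightarrow> Z.hazard z t = M t"
      using Z.hazard_antiderivative[OF z] by metis
    obtain F where F: "\<And>t. (F has_real_derivative rate (fl ?x t)) (at t)" "F 0 = 0" "\<And>t. 0 \<le> t \<Longrightarrow> X.hazard ?x t = F t"
      using X.hazard_antiderivative[OF x] by metis
    define K where "K = (\<lambda>s. \<integral>\<^sup>+c. X.nn_act h (t - s) (jump (fl ?x s) c) \<partial>C)"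
    define \<rho> where "\<rho> = (\<lambda>s. ennreal (rate (fl ?x s) * exp (- X.hazard ?x s)) * K s)"
    define g where "g = (\<lambda>s. X.nn_act h (t - s) (fl ?x s))"
    define \<delta> where "\<delta> = (\<lambda>s. rate1 (fl1 z s) - rate (fl ?x s))"
    define D where "D = (\<lambda>s. M s - F s)"
    have \<delta>: "0 \<le> \<delta> s" for s unfolding \<delta>_def using rate_le[of "fl1 z s"] z by (simp add: p_fl)
    have D': "(D has_real_derivative \<delta> s) (at s)" for s
      unfolding D_def \<delta>_def by (intro derivative_intros M F)
    have D_mono: "D s \<le> D s'" if "s \<le> s'" for s s'
      using that D' \<delta> by (intro DERIV_nonneg_imp_nondecreasing[of s s' D]) auto
    have D0: "D 0 = 0" by (simp add: D_def M F)
    have Dnn: "0 \<le> D s" if "0 \<le> s" for s using D_mono[OF that] by (simp add: D0)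
    have \<delta>_cont: "continuous_on UNIV \<delta>"
      unfolding \<delta>_def using z x by (intro continuous_intros Z.rate_cont X.rate_cont)
    have D_cont: "continuous_on UNIV D" using D' by (meson DERIV_isCont continuous_at_imp_continuous_on)
    have K_meas[measurable]: "K \<in> borel_measurable borel"
      unfolding K_def by (intro X.jump_integral_measurable x X.nn_act_measurable2 h)
    have \<rho>_meas[measurable]: "\<rho> \<in> borel_measurable borel"
      unfolding \<rho>_def using X.rate_fl_measurable[OF x] by measurable
    have d_meas[measurable]: "(\<lambda>s. exp (- D s) * \<delta> s) \<in> borel_measurable borel"
      by (intro borel_measurable_continuous_onI continuous_intros D_cont \<delta>_cont)
    have D_meas[measurable]: "D \<in> borel_measurable borel"
      by (intro borel_measurable_continuous_onI D_cont)
    define a where "a = ennreal (exp (- F t)) * h (fl ?x t)"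
    have P: "X.nn_act h t ?x = a + (\<integral>\<^sup>+u. \<rho> u * indicator {0..t} u \<partial>lborel)"
      unfolding X.nn_act_first_jump[OF x t h] X.first_jump_def a_def \<rho>_def K_def F(3)[OF t] by simp
    have G: "ennreal (exp (- F s)) * g s = a + (\<integral>\<^sup>+u. \<rho> u * indicator {s..t} u \<partial>lborel)" if s: "0 \<le> s" "s \<le> t" for s
    proof -
      have "ennreal (exp (- X.hazard ?x s)) * X.first_jump h (X.nn_act h) (t - s) (fl ?x s) = a + (\<integral>\<^sup>+u. \<rho> u * indicator {s..t} u \<partial>lborel)"
        using X.exp_first_jump_fl[OF x s(1), of "t - s" "X.nn_act h" h] s h F(3)[OF t] unfolding a_def \<rho>_def K_def
        by (simp add: X.nn_act_measurable2)
      then show ?thesis using s F(3)[OF s(1)] x h by (simp add: g_def X.nn_act_first_jump[symmetric])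
    qed
    have I: "(\<integral>\<^sup>+s. ennreal (exp (- D s) * \<delta> s) * indicator {0..u} s \<partial>lborel) = ennreal (1 - exp (- D u))" if u: "0 \<le> u" for u
    proof -
      have "(\<integral>\<^sup>+s. ennreal (exp (- D s) * \<delta> s) * indicator {0..u} s \<partial>lborel) = ennreal (- exp (- D u) - (- exp (- D 0)))"
        by (rule nn_integral_FTC_Icc[OF d_meas _ _ u]) (auto intro!: derivative_eq_intros D' mult_nonneg_nonneg \<delta>)
      then show ?thesis by (simp add: D0)
    qed
    \<comment> \<open>Fubini over \<open>0 \<le> s \<le> u \<le> t\<close>, with \<open>s\<close> the first unseen jump and \<open>u\<close> the first seen one\<close>
    have J: "(\<integral>\<^sup>+s. ennreal (exp (- D s) * \<delta> s) * indicator {0..t} s * (\<integral>\<^sup>+u. \<rho> u * indicator {s..t} u \<partial>lborel) \<partial>lborel) =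
       (\<integral>\<^sup>+u. \<rho> u * ennreal (1 - exp (- D u)) * indicator {0..t} u \<partial>lborel)"
    proof -
      let ?h = "\<lambda>s u. ennreal (exp (- D s) * \<delta> s) * \<rho> u * indicator {q. 0 \<le> fst q \<and> fst q \<le> snd q \<and> snd q \<le> t} (s, u)"
      have "(\<integral>\<^sup>+s. ennreal (exp (- D s) * \<delta> s) * indicator {0..t} s * (\<integral>\<^sup>+u. \<rho> u * indicator {s..t} u \<partial>lborel) \<partial>lborel) =
          (\<integral>\<^sup>+s. \<integral>\<^sup>+u. ?h s u \<partial>lborel \<partial>lborel)"
        by (subst nn_integral_cmult[symmetric])
           (auto intro!: nn_integral_cong simp: indicator_def)
      also have "\<dots> = (\<integral>\<^sup>+u. \<integral>\<^sup>+s. ?h s u \<partial>lborel \<partial>lborel)"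
      proof (rule lborel_pair.Fubini'[symmetric])
        show "(\<lambda>(s, u). ?h s u) \<in> borel_measurable (lborel \<Otimes>\<^sub>M lborel)"
          by measurable
      qed
      also have "\<dots> = (\<integral>\<^sup>+u. \<rho> u * ennreal (1 - exp (- D u)) * indicator {0..t} u \<partial>lborel)"
      proof (intro nn_integral_cong)
        fix u :: real
        have "(\<integral>\<^sup>+s. ?h s u \<partial>lborel) = (\<integral>\<^sup>+s. (\<rho> u * indicator {0..t} u) * (ennreal (exp (- D s) * \<delta> s) * indicator {0..u} s) \<partial>lborel)"
          by (intro nn_integral_cong) (auto simp: indicator_def mult_ac)
        also have "\<dots> = (\<rho> u * indicator {0..t} u) * (\<integral>\<^sup>+s. ennreal (exp (- D s) * \<delta> s) * indicator {0..u} s \<partial>lborel)"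
          by (intro nn_integral_cmult) measurable
        also have "\<dots> = \<rho> u * ennreal (1 - exp (- D u)) * indicator {0..t} u"
          using I[of u] by (cases "0 \<le> u \<and> u \<le> t") auto
        finally show "(\<integral>\<^sup>+s. ?h s u \<partial>lborel) = \<rho> u * ennreal (1 - exp (- D u)) * indicator {0..t} u" .
      qed
      finally show ?thesis .
    qed
    have int: "ennreal (rate1 (fl1 z s) * exp (- Z.hazard z s)) * (\<integral>\<^sup>+c. X.nn_act h (t - s) (p (jump1 (fl1 z s) c)) \<partial>C1) =
       \<rho> s * ennreal (exp (- D s)) + (ennreal (exp (- D s) * \<delta> s) * a +
          ennreal (exp (- D s) * \<delta> s) * (\<integral>\<^sup>+u. \<rho> u * indicator {s..t} u \<partial>lborel))" if s: "0 \<le> s" "s \<le> t" for s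
    proof -
      have zs: "fl1 z s \<in> space E1" using z by simp
      have "ennreal (rate1 (fl1 z s) * exp (- Z.hazard z s)) * (\<integral>\<^sup>+c. X.nn_act h (t - s) (p (jump1 (fl1 z s) c)) \<partial>C1) =
         ennreal (exp (- M s)) * (ennreal (rate1 (fl1 z s)) * (\<integral>\<^sup>+c. X.nn_act h (t - s) (p (jump1 (fl1 z s) c)) \<partial>C1))"
        using s by (simp add: M(3) ennreal_mult' Z.rate_nonneg zs mult_ac)
      also have "\<dots> = ennreal (exp (- M s)) * (ennreal (rate (fl ?x s)) * K s + ennreal (\<delta> s) * g s)"
        using zs z h by (subst p_jump) (auto simp: p_fl K_def \<delta>_def g_def)
      also have "\<dots> = ennreal (exp (- D s)) * (ennreal (exp (- F s)) * (ennreal (rate (fl ?x s)) * K s)) +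
          ennreal (exp (- D s)) * ennreal (\<delta> s) * (ennreal (exp (- F s)) * g s)"
      proof -
        have "ennreal (exp (- M s)) = ennreal (exp (- D s)) * ennreal (exp (- F s))"
          by (simp add: ennreal_mult[symmetric] exp_add[symmetric] D_def)
        then show ?thesis by (simp add: distrib_left mult_ac)
      qed
      also have "ennreal (exp (- D s)) * ennreal (\<delta> s) = ennreal (exp (- D s) * \<delta> s)"
        using \<delta> by (simp add: ennreal_mult)
      also have "ennreal (exp (- F s)) * (ennreal (rate (fl ?x s)) * K s) = \<rho> s"
        using s x by (simp add: \<rho>_def F(3) ennreal_mult X.rate_nonneg mult_ac)
      finally show ?thesis unfolding G[OF s] by (simp add: distrib_left mult_ac)
    qed
    have "(\<integral>\<^sup>+s. ennreal (rate1 (fl1 z s) * exp (- Z.hazard z s)) * (\<integral>\<^sup>+c. X.nn_act h (t - s) (p (jump1 (fl1 z s) c)) \<partial>C1)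
        * indicator {0..t} s \<partial>lborel) =
      (\<integral>\<^sup>+s. \<rho> s * ennreal (exp (- D s)) * indicator {0..t} s + (a * (ennreal (exp (- D s) * \<delta> s) * indicator {0..t} s) +
          ennreal (exp (- D s) * \<delta> s) * indicator {0..t} s * (\<integral>\<^sup>+u. \<rho> u * indicator {s..t} u \<partial>lborel)) \<partial>lborel)"
      by (intro nn_integral_cong) (auto simp: indicator_def int mult_ac)
    also have "\<dots> = (\<integral>\<^sup>+s. \<rho> s * ennreal (exp (- D s)) * indicator {0..t} s \<partial>lborel) +
       (a * ennreal (1 - exp (- D t)) + (\<integral>\<^sup>+u. \<rho> u * ennreal (1 - exp (- D u)) * indicator {0..t} u \<partial>lborel))"
    proof -
      have [measurable]: "(\<lambda>s. \<integral>\<^sup>+u. \<rho> u * indicator {s..t} u \<partial>lborel) \<in> borel_measurable borel"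
      proof (rule lborel.borel_measurable_nn_integral)
        have "(\<lambda>q. \<rho> (snd q) * indicator {q. fst q \<le> snd q \<and> snd q \<le> t} q) \<in> borel_measurable (borel \<Otimes>\<^sub>M lborel)"
          by measurable
        then show "(\<lambda>(s, u). \<rho> u * indicator {s..t} u) \<in> borel_measurable (borel \<Otimes>\<^sub>M lborel)"
          by (rule measurable_cong[THEN iffD1, rotated]) (auto simp: indicator_def)
      qed
      show ?thesis
        unfolding I[OF t, symmetric] J[symmetric]
        by (subst nn_integral_add, measurable, subst nn_integral_add, measurable, subst nn_integral_cmult, measurable)
    qed
    finally have "Z.first_jump (\<lambda>z. h (p z)) (\<lambda>t z. X.nn_act h t (p z)) t z = 
       ennreal (exp (- D t)) * a + ((\<integral>\<^sup>+s. \<rho> s * ennreal (exp (- D s)) * indicator {0..t} s \<partial>lborel) +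
       (a * ennreal (1 - exp (- D t)) + (\<integral>\<^sup>+u. \<rho> u * ennreal (1 - exp (- D u)) * indicator {0..t} u \<partial>lborel)))"
      unfolding Z.first_jump_def a_def using z t M(3)[OF t]
      by (simp add: p_fl mult.assoc[symmetric] ennreal_mult[symmetric] exp_add[symmetric] D_def)
    also have "\<dots> = a * (ennreal (exp (- D t)) + ennreal (1 - exp (- D t))) +
       ((\<integral>\<^sup>+s. \<rho> s * ennreal (exp (- D s)) * indicator {0..t} s \<partial>lborel) +
        (\<integral>\<^sup>+u. \<rho> u * ennreal (1 - exp (- D u)) * indicator {0..t} u \<partial>lborel))"
      by (simp add: distrib_left mult_ac add_ac)
    also have "ennreal (exp (- D t)) + ennreal (1 - exp (- D t)) = 1"
      using Dnn[OF t] by (subst ennreal_plus[symmetric]) auto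
    also have "(\<integral>\<^sup>+s. \<rho> s * ennreal (exp (- D s)) * indicator {0..t} s \<partial>lborel) +
        (\<integral>\<^sup>+u. \<rho> u * ennreal (1 - exp (- D u)) * indicator {0..t} u \<partial>lborel) =
       (\<integral>\<^sup>+s. \<rho> s * ennreal (exp (- D s)) * indicator {0..t} s + \<rho> s * ennreal (1 - exp (- D s)) * indicator {0..t} s \<partial>lborel)"
      by (intro nn_integral_add[symmetric]) measurable
    also have "\<dots> = (\<integral>\<^sup>+s. \<rho> s * indicator {0..t} s \<partial>lborel)"
    proof (intro nn_integral_cong)
      fix s :: real
      have "ennreal (exp (- D s)) + ennreal (1 - exp (- D s)) = 1" if "0 \<le> s"
        using Dnn[OF that] by (subst ennreal_plus[symmetric]) auto
      then show "\<rho> s * ennreal (exp (- D s)) * indicator {0..t} s + \<rho> s * ennreal (1 - exp (- D s)) * indicator {0..t} s = 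
         \<rho> s * indicator {0..t} s"
        by (auto simp: indicator_def distrib_left[symmetric])
    qed
    finally show ?thesis by (simp add: P)
  qed
  show ?thesis
  proof (rule prob_space_eqI_le)
    show "prob_space (distr (Z.trans t z) E p)"
      using z by (intro prob_space.prob_space_distr Z.prob_space_trans) auto
    show "prob_space (X.trans t (p z))" using z by (intro X.prob_space_trans) auto
    show "sets (distr (Z.trans t z) E p) = sets (X.trans t (p z))" by simp
    fix A assume "A \<in> sets (distr (Z.trans t z) E p)"
    then have A[measurable]: "A \<in> sets E" by simp
    have "emeasure (distr (Z.trans t z) E p) A = (\<integral>\<^sup>+y. indicator A y \<partial>distr (Z.trans t z) E p)"
      by simp
    also have "\<dots> = Z.nn_act (\<lambda>y. indicator A (p y)) t z"
      unfolding Z.nn_act_def by (intro nn_integral_distr) auto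
    also have "\<dots> \<le> X.nn_act (indicator A) t (p z)"
      by (rule Z.nn_act_le) (use t z key[of "indicator A"] in auto)
    also have "\<dots> = emeasure (X.trans t (p z)) A"
      unfolding X.nn_act_def by simp
    finally show "emeasure (distr (Z.trans t z) E p) A \<le> emeasure (X.trans t (p z)) A" .
  qed
qed

section \<open>Coupling two copies of a process\<close>

definition unif :: "real measure" where
  "unif = uniform_measure lborel {0..1}"

lemma sets_unif[simp, measurable_cong]: "sets unif = sets borel"
  by (simp add: unif_def)

lemma space_unif[simp]: "space unif = UNIV"
  by (simp add: unif_def)

interpretation unif: prob_space unif
  unfolding unif_def by (rule prob_space_uniform_measure) auto

lemma emeasure_unif: "A \<in> sets borel \<Longrightarrow> emeasure unif A = emeasure lborel ({0..1} \<inter> A)"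
  by (simp add: unif_def divide_ennreal_def)

lemma emeasure_unif_Iic: "0 \<le> b \<Longrightarrow> b \<le> 1 \<Longrightarrow> emeasure unif {..b} = ennreal b"
proof -
  assume b: "0 \<le> b" "b \<le> 1"
  then have "{0..1} \<inter> {..b} = {0..b}" by auto
  then show ?thesis using b by (simp add: emeasure_unif)
qed

lemma emeasure_unif_Ioc: "0 \<le> a \<Longrightarrow> a \<le> b \<Longrightarrow> b \<le> 1 \<Longrightarrow> emeasure unif {a<..b} = ennreal (b - a)"
proof -
  assume b: "0 \<le> a" "a \<le> b" "b \<le> 1"
  then have "{0..1} \<inter> {a<..b} = {a<..b}" by auto
  then show ?thesis using b by (simp add: emeasure_unif)
qed

text \<open>
  Of the events at rate \<open>R\<close>, those with uniform label below \<open>r / R\<close> occur at rate \<open>r\<close>.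
\<close>

lemma thinning:
  assumes "0 \<le> r" "r \<le> R"
  shows "ennreal R * (\<integral>\<^sup>+u. (if u * R \<le> r then a else b) \<partial>unif) = ennreal r * a + ennreal (R - r) * b"
proof (cases "R = 0")
  case False
  with assms have R: "0 < R" by auto
  have "(\<integral>\<^sup>+u. (if u * R \<le> r then a else b) \<partial>unif) = 
      (\<integral>\<^sup>+u. a * indicator {..r/R} u + b * indicator {r/R<..1} u \<partial>unif)"
  proof (rule nn_integral_cong_AE)
    have "AE u in unif. u \<in> {0..1}"
      unfolding unif_def by (rule AE_uniform_measureI) auto
    then show "AE u in unif. (if u * R \<le> r then a else b) = a * indicator {..r/R} u + b * indicator {r/R<..1} u"
      by eventually_elim (use R in \<open>auto simp: indicator_def field_simps\<close>)
  qed
  also have "\<dots> = a * ennreal (r/R) + b * ennreal (1 - r/R)"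
    using assms R by (subst nn_integral_add) (auto simp: nn_integral_cmult emeasure_unif_Iic emeasure_unif_Ioc)
  also have "ennreal R * \<dots> = (ennreal R * ennreal (r/R)) * a + (ennreal R * ennreal (1 - r/R)) * b"
    by (simp add: distrib_left mult_ac)
  also have "ennreal R * ennreal (r/R) = ennreal r"
    using assms R by (simp add: ennreal_mult[symmetric])
  also have "ennreal R * ennreal (1 - r/R) = ennreal (R - r)"
    using assms R by (simp add: ennreal_mult[symmetric] algebra_simps)
  finally show ?thesis .
qed (use assms in auto)

lemma thinning_between:
  assumes "0 \<le> r" "r \<le> q" "q \<le> R"
  shows "ennreal R * (\<integral>\<^sup>+u. (if r < u * R \<and> u * R \<le> q then a else 0) \<partial>unif) = ennreal (q - r) * a"
proof (cases "R = 0")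
  case False
  with assms have R: "0 < R" by auto
  have "(\<integral>\<^sup>+u. (if r < u * R \<and> u * R \<le> q then a else 0) \<partial>unif) = (\<integral>\<^sup>+u. a * indicator {r/R<..q/R} u \<partial>unif)"
    using R by (intro nn_integral_cong) (auto simp: indicator_def field_simps)
  also have "\<dots> = a * ennreal (q/R - r/R)"
    using assms R by (subst nn_integral_cmult_indicator) (auto simp: emeasure_unif_Ioc divide_right_mono)
  also have "ennreal R * \<dots> = (ennreal R * ennreal (q/R - r/R)) * a" by (simp add: mult_ac)
  also have "ennreal R * ennreal (q/R - r/R) = ennreal (q - r)"
    using assms R by (simp add: ennreal_mult[symmetric] divide_right_mono algebra_simps)
  finally show ?thesis .
qed (use assms in auto)

context pdmp begin

text \<open>
  Both copies read the same clock of rate \<open>rate x + rate y\<close>, the same mark and the same uniform label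
  \<open>u\<close>, and a copy jumps if \<open>u\<close> is below its own share of the total rate. Hence each copy jumps at its
  own rate, and only one of them jumps at the rate \<open>\<bar>rate x - rate y\<bar>\<close>. Some clock events
  move neither copy. The sum of the rates is used instead of the maximum so that the hazard of the pair
  is the sum of the two hazards.
\<close>

definition pair_flow :: "'s \<times> 's \<Rightarrow> real \<Rightarrow> 's \<times> 's" where
  "pair_flow z s = (fl (fst z) s, fl (snd z) s)"

definition pair_rate :: "'s \<times> 's \<Rightarrow> real" where
  "pair_rate z = rate (fst z) + rate (snd z)"

definition pair_jump :: "'s \<times> 's \<Rightarrow> 'c \<times> real \<Rightarrow> 's \<times> 's" where
  "pair_jump z p =
     (if snd p * pair_rate z \<le> rate (fst z) then jump (fst z) (fst p) else fst z,
      if snd p * pair_rate z \<le> rate (snd z) then jump (snd z) (fst p) else snd z)"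

abbreviation "pair_E \<equiv> E \<Otimes>\<^sub>M E"
abbreviation "pair_C \<equiv> C \<Otimes>\<^sub>M unif"

lemma pair_rate_measurable[measurable]: "pair_rate \<in> borel_measurable pair_E"
  unfolding pair_rate_def[abs_def] by measurable

lemma pdmp_coupled: "pdmp pair_E pair_C pair_flow pair_rate pair_jump (origin, origin)"
proof (rule pdmp.intro)
  interpret P: pair_prob_space C unif ..
  show "prob_space pair_C" by (rule P.P.prob_space_axioms)
  show "(origin, origin) \<in> space pair_E" by (simp add: space_pair_measure)
  show "(\<lambda>p. pair_flow (fst p) (snd p)) \<in> pair_E \<Otimes>\<^sub>M borel \<rightarrow>\<^sub>M pair_E"
    unfolding pair_flow_def by measurable
  show "(\<lambda>p. pair_jump (fst p) (snd p)) \<in> pair_E \<Otimes>\<^sub>M pair_C \<rightarrow>\<^sub>M pair_E"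
    unfolding pair_jump_def by measurable
  fix x assume x: "x \<in> space pair_E"
  then show "pair_flow x 0 = x" "0 \<le> pair_rate x"
    by (auto simp: pair_flow_def pair_rate_def space_pair_measure intro!: rate_nonneg add_nonneg_nonneg)
  show "pair_flow (pair_flow x s) t = pair_flow x (s + t)" for s t
    using x by (auto simp: pair_flow_def space_pair_measure fl_add)
  show "continuous_on UNIV (\<lambda>s. pair_rate (pair_flow x s))"
    using x unfolding pair_flow_def pair_rate_def fst_conv snd_conv
    by (intro continuous_intros rate_cont) (auto simp: space_pair_measure)
qed (rule pair_rate_measurable)

lemma pair_jump_marginal:
  assumes z: "z \<in> space pair_E" and k[measurable]: "k \<in> borel_measurable E"
  shows "ennreal (pair_rate z) * (\<integral>\<^sup>+c. k (fst (pair_jump z c)) \<partial>pair_C) =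
       ennreal (rate (fst z)) * (\<integral>\<^sup>+c. k (jump (fst z) c) \<partial>C) + ennreal (pair_rate z - rate (fst z)) * k (fst z)"
    and "ennreal (pair_rate z) * (\<integral>\<^sup>+c. k (snd (pair_jump z c)) \<partial>pair_C) =
       ennreal (rate (snd z)) * (\<integral>\<^sup>+c. k (jump (snd z) c) \<partial>C) + ennreal (pair_rate z - rate (snd z)) * k (snd z)"
proof -
  interpret cp: pdmp pair_E pair_C pair_flow pair_rate pair_jump "(origin, origin)" by (rule pdmp_coupled)
  have sp: "fst z \<in> space E" "snd z \<in> space E" using z by (auto simp: space_pair_measure)
  have main: "ennreal (pair_rate z) * (\<integral>\<^sup>+p. (if snd p * pair_rate z \<le> rate x then k (jump x (fst p)) else k x) \<partial>pair_C) =
       ennreal (rate x) * (\<integral>\<^sup>+c. k (jump x c) \<partial>C) + ennreal (pair_rate z - rate x) * k x"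
    if x: "x \<in> space E" "rate x \<le> pair_rate z" for x
  proof -
    have m: "(\<lambda>p. if snd p * pair_rate z \<le> rate x then k (jump x (fst p)) else k x) \<in> borel_measurable pair_C"
      using x by measurable
    have [measurable]: "(\<lambda>c. \<integral>\<^sup>+u. (if u * pair_rate z \<le> rate x then k (jump x c) else k x) \<partial>unif) \<in> borel_measurable C"
      using unif.borel_measurable_nn_integral_fst[OF m] unfolding fst_conv snd_conv .
    have [measurable]: "(\<lambda>c. k (jump x c)) \<in> borel_measurable C" using x by measurable
    have "ennreal (pair_rate z) * (\<integral>\<^sup>+p. (if snd p * pair_rate z \<le> rate x then k (jump x (fst p)) else k x) \<partial>pair_C) =
       ennreal (pair_rate z) * (\<integral>\<^sup>+c. \<integral>\<^sup>+u. (if u * pair_rate z \<le> rate x then k (jump x c) else k x) \<partial>unif \<partial>C)"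
      using unif.nn_integral_fst[OF m] unfolding fst_conv snd_conv by (rule arg_cong[OF sym])
    also have "\<dots> = (\<integral>\<^sup>+c. ennreal (pair_rate z) * (\<integral>\<^sup>+u. (if u * pair_rate z \<le> rate x then k (jump x c) else k x) \<partial>unif) \<partial>C)"
      by (rule nn_integral_cmult[symmetric]) measurable
    also have "\<dots> = (\<integral>\<^sup>+c. ennreal (rate x) * k (jump x c) + ennreal (pair_rate z - rate x) * k x \<partial>C)"
      using x by (intro nn_integral_cong thinning rate_nonneg)
    also have "\<dots> = ennreal (rate x) * (\<integral>\<^sup>+c. k (jump x c) \<partial>C) + ennreal (pair_rate z - rate x) * k x"
      by (subst nn_integral_add) (auto simp: nn_integral_cmult C.emeasure_space_1)
    finally show ?thesis .
  qed
  have "k (fst (pair_jump z p)) = (if snd p * pair_rate z \<le> rate (fst z) then k (jump (fst z) (fst p)) else k (fst z))"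
    "k (snd (pair_jump z p)) = (if snd p * pair_rate z \<le> rate (snd z) then k (jump (snd z) (fst p)) else k (snd z))" for p
    by (auto simp: pair_jump_def)
  then show "ennreal (pair_rate z) * (\<integral>\<^sup>+c. k (fst (pair_jump z c)) \<partial>pair_C) =
       ennreal (rate (fst z)) * (\<integral>\<^sup>+c. k (jump (fst z) c) \<partial>C) + ennreal (pair_rate z - rate (fst z)) * k (fst z)"
    and "ennreal (pair_rate z) * (\<integral>\<^sup>+c. k (snd (pair_jump z c)) \<partial>pair_C) =
       ennreal (rate (snd z)) * (\<integral>\<^sup>+c. k (jump (snd z) c) \<partial>C) + ennreal (pair_rate z - rate (snd z)) * k (snd z)"
    using main[OF sp(1)] main[OF sp(2)] rate_nonneg[OF sp(1)] rate_nonneg[OF sp(2)] by (simp_all add: pair_rate_def)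
qed

text \<open>
  Only the labels between the two shares separate the copies.
\<close>

lemma pair_jump_cost:
  assumes z: "x \<in> space E" "y \<in> space E"
    and D[measurable]: "D \<in> borel_measurable pair_E" and q[measurable]: "q \<in> borel_measurable C"
    and both: "\<And>c. c \<in> space C \<Longrightarrow> D (jump x c, jump y c) \<le> D (x, y)"
    and one: "\<And>c. c \<in> space C \<Longrightarrow> D (jump x c, y) \<le> D (x, y) + q c" "\<And>c. c \<in> space C \<Longrightarrow> D (x, jump y c) \<le> D (x, y) + q c"
  shows "ennreal (pair_rate (x, y)) * (\<integral>\<^sup>+c. D (pair_jump (x, y) c) \<partial>pair_C) \<le>
     ennreal (pair_rate (x, y)) * D (x, y) + ennreal \<bar>rate x - rate y\<bar> * (\<integral>\<^sup>+c. q c \<partial>C)"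
proof -
  interpret cp: pdmp pair_E pair_C pair_flow pair_rate pair_jump "(origin, origin)" by (rule pdmp_coupled)
  interpret P: pair_prob_space C unif ..
  define R where "R = pair_rate (x, y)"
  define m where "m = min (rate x) (rate y)"
  define M where "M = max (rate x) (rate y)"
  have r: "0 \<le> m" "m \<le> M" "M \<le> R" "M - m = \<bar>rate x - rate y\<bar>"
    using rate_nonneg[OF z(1)] rate_nonneg[OF z(2)] by (auto simp: R_def m_def M_def pair_rate_def)
  let ?i = "\<lambda>c u. if m < u * R \<and> u * R \<le> M then q c else 0"
  have mi: "(\<lambda>p. ?i (fst p) (snd p)) \<in> borel_measurable pair_C" by measurable
  have mi'[measurable]: "(\<lambda>c. \<integral>\<^sup>+u. ?i c u \<partial>unif) \<in> borel_measurable C"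
    using unif.borel_measurable_nn_integral_fst[OF mi] unfolding fst_conv snd_conv .
  have "(\<integral>\<^sup>+c. D (pair_jump (x, y) c) \<partial>pair_C) \<le> (\<integral>\<^sup>+p. D (x, y) + ?i (fst p) (snd p) \<partial>pair_C)"
  proof (rule nn_integral_mono)
    fix p assume "p \<in> space pair_C"
    then have "fst p \<in> space C" by (auto simp: space_pair_measure)
    then show "D (pair_jump (x, y) p) \<le> D (x, y) + ?i (fst p) (snd p)"
      using both[of "fst p"] one[of "fst p"] by (auto simp: pair_jump_def R_def[symmetric] m_def M_def)
  qed
  also have "\<dots> = D (x, y) + (\<integral>\<^sup>+p. ?i (fst p) (snd p) \<partial>pair_C)"
    using mi by (subst nn_integral_add) (auto simp: cp.C.emeasure_space_1)
  also have "(\<integral>\<^sup>+p. ?i (fst p) (snd p) \<partial>pair_C) = (\<integral>\<^sup>+c. \<integral>\<^sup>+u. ?i c u \<partial>unif \<partial>C)"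
    using unif.nn_integral_fst[OF mi] unfolding fst_conv snd_conv by (rule sym)
  finally have "ennreal R * (\<integral>\<^sup>+c. D (pair_jump (x, y) c) \<partial>pair_C) \<le> ennreal R * (D (x, y) + (\<integral>\<^sup>+c. \<integral>\<^sup>+u. ?i c u \<partial>unif \<partial>C))"
    by (rule mult_left_mono) simp
  also have "\<dots> = ennreal R * D (x, y) + (\<integral>\<^sup>+c. ennreal R * (\<integral>\<^sup>+u. ?i c u \<partial>unif) \<partial>C)"
    by (simp add: distrib_left nn_integral_cmult)
  also have "(\<integral>\<^sup>+c. ennreal R * (\<integral>\<^sup>+u. ?i c u \<partial>unif) \<partial>C) = (\<integral>\<^sup>+c. ennreal (M - m) * q c \<partial>C)"
    by (simp add: thinning_between r)
  also have "\<dots> = ennreal (M - m) * (\<integral>\<^sup>+c. q c \<partial>C)" by (rule nn_integral_cmult) simp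
  finally show ?thesis by (simp add: R_def r)
qed

abbreviation "pair_trans \<equiv> pdmp.trans pair_E pair_C pair_flow pair_rate pair_jump (origin, origin)"

end

context pdmp_lyapunov begin

text \<open>
  Lyapunov functions of the two copies add up.
\<close>

lemma pdmp_lyapunov_coupled:
  "pdmp_lyapunov pair_E pair_C pair_flow pair_rate pair_jump (origin, origin) (\<lambda>z. H (fst z) + H (snd z)) (2 * r) (2 * B)"
proof -
  interpret cp: pdmp pair_E pair_C pair_flow pair_rate pair_jump "(origin, origin)" by (rule pdmp_coupled)
  interpret P: pair_prob_space C unif ..
  show ?thesis
  proof
    show "(\<lambda>z. H (fst z) + H (snd z)) \<in> borel_measurable pair_E" by measurable
    show "0 \<le> 2 * r" "0 \<le> 2 * B" using r_nonneg B_nonneg by auto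
    fix z assume "z \<in> space pair_E"
    then obtain x y where xy: "z = (x, y)" "x \<in> space E" "y \<in> space E"
      by (auto simp: space_pair_measure)
    show "0 \<le> H (fst z) + H (snd z)" using xy by (simp add: H_nonneg)
    show "H (fst (pair_flow z s)) + H (snd (pair_flow z s)) \<le> H (fst z) + H (snd z)" if "0 \<le> s" for s
      using xy that by (auto simp: pair_flow_def intro!: add_mono H_fl)
    have "pair_rate z \<le> r * (1 + H x) + r * (1 + H y)"
      using xy by (auto simp: pair_rate_def intro!: add_mono rate_le)
    also have "\<dots> \<le> 2 * r * (1 + (H x + H y))"
      using r_nonneg H_nonneg[OF xy(2)] H_nonneg[OF xy(3)] by (simp add: algebra_simps)
    finally show "pair_rate z \<le> 2 * r * (1 + (H (fst z) + H (snd z)))" using xy by simp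
    have one: "(\<integral>\<^sup>+p. ennreal (H (if snd p * pair_rate z \<le> a then jump v (fst p) else v)) \<partial>pair_C) \<le> ennreal (H v + B)"
      if v: "v \<in> space E" for v a
    proof -
      have [measurable]: "(\<lambda>c. jump v c) \<in> C \<rightarrow>\<^sub>M E" "v \<in> space E" using v by measurable
      have m: "(\<lambda>p. ennreal (H (if snd p * pair_rate z \<le> a then jump v (fst p) else v))) \<in> borel_measurable pair_C"
        by measurable
      have "(\<integral>\<^sup>+p. ennreal (H (if snd p * pair_rate z \<le> a then jump v (fst p) else v)) \<partial>pair_C) =
        (\<integral>\<^sup>+u. \<integral>\<^sup>+c. ennreal (H (if u * pair_rate z \<le> a then jump v c else v)) \<partial>C \<partial>unif)"
        using P.nn_integral_snd[OF m] unfolding fst_conv snd_conv by (rule sym)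
      also have "\<dots> \<le> (\<integral>\<^sup>+u. ennreal (H v + B) \<partial>unif)"
      proof (rule nn_integral_mono)
        fix u
        show "(\<integral>\<^sup>+c. ennreal (H (if u * pair_rate z \<le> a then jump v c else v)) \<partial>C) \<le> ennreal (H v + B)"
          using H_jump[OF v] B_nonneg
          by (cases "u * pair_rate z \<le> a") (simp_all add: C.emeasure_space_1 ennreal_leI del: ennreal_plus)
      qed
      finally show ?thesis by (simp add: unif.emeasure_space_1[unfolded space_unif])
    qed
    have "(\<integral>\<^sup>+c. ennreal (H (fst (pair_jump z c)) + H (snd (pair_jump z c))) \<partial>pair_C) =
      (\<integral>\<^sup>+c. ennreal (H (fst (pair_jump z c))) + ennreal (H (snd (pair_jump z c))) \<partial>pair_C)"
    proof (intro nn_integral_cong)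
      fix c assume "c \<in> space pair_C"
      then have "pair_jump z c \<in> space pair_E" using xy by (intro cp.jump_space) (auto simp: space_pair_measure)
      then show "ennreal (H (fst (pair_jump z c)) + H (snd (pair_jump z c))) = ennreal (H (fst (pair_jump z c))) + ennreal (H (snd (pair_jump z c)))"
        by (subst ennreal_plus) (auto simp: space_pair_measure H_nonneg)
    qed
    also have "\<dots> = (\<integral>\<^sup>+c. ennreal (H (fst (pair_jump z c))) \<partial>pair_C) + (\<integral>\<^sup>+c. ennreal (H (snd (pair_jump z c))) \<partial>pair_C)"
    proof -
      have [measurable]: "pair_jump z \<in> pair_C \<rightarrow>\<^sub>M pair_E" using xy by (intro cp.jump_measurable) (auto simp: space_pair_measure)
      show ?thesis by (intro nn_integral_add) measurable
    qed
    also have "\<dots> \<le> ennreal (H x + B) + ennreal (H y + B)"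
      unfolding pair_jump_def fst_conv snd_conv xy(1)
      using one[OF xy(2), of "rate x"] one[OF xy(3), of "rate y"] by (intro add_mono) (simp_all add: xy(1))
    also have "\<dots> = ennreal (H (fst z) + H (snd z) + 2 * B)"
      using xy H_nonneg B_nonneg by (subst ennreal_plus[symmetric]) (auto simp: algebra_simps)
    finally show "(\<integral>\<^sup>+c. ennreal (H (fst (pair_jump z c)) + H (snd (pair_jump z c))) \<partial>pair_C) \<le> ennreal (H (fst z) + H (snd z) + 2 * B)" .
  qed
qed

theorem pair_trans_marginals:
  assumes t: "0 \<le> t" and z: "z \<in> space pair_E"
  shows "distr (pair_trans t z) E fst = trans t (fst z)" "distr (pair_trans t z) E snd = trans t (snd z)"
  using rate_nonneg z pair_jump_marginal
  by (auto intro!: pdmp_projection[OF pdmp_lyapunov_coupled pdmp_axioms] t simp: pair_flow_def pair_rate_def space_pair_measure)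

end

section \<open>The linear flow of the cascades\<close>

lemma finite_coords[simp]: "finite (coords L n)"
  by (simp add: coords_def)

lemma coords_iff: "(i, k) \<in> coords L n \<longleftrightarrow> i \<in> {1..L} \<and> k \<le> n i"
  by (auto simp: coords_def)

lemma sum_coords: "(\<Sum>p\<in>coords L n. g p) = (\<Sum>i=1..L. \<Sum>k=0..n i. g (i, k))"
  unfolding coords_def by (subst sum.Sigma) auto

lemma space_state_space: "x \<in> space (state_space L n) \<longleftrightarrow> x \<in> extensional (coords L n)"
  by (simp add: state_space_def space_PiM PiE_def)

text \<open>
  Each cascade \<open>x (i, 0), \<dots>, x (i, n i)\<close> evolves by the exponential of \<open>t\<close> times a Jordan block with
  eigenvalue \<open>- \<alpha> i\<close>.
\<close>

definition eflow ::
  "nat \<Rightarrow> (nat \<Rightarrow> nat) \<Rightarrow> (nat \<Rightarrow> real) \<Rightarrow> (nat \<times> nat \<Rightarrow> real) \<Rightarrow> real \<Rightarrow> (nat \<times> nat \<Rightarrow> real)" where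
  "eflow L n \<alpha> x t =
     (\<lambda>(i,k)\<in>coords L n. exp (- \<alpha> i * t) * (\<Sum>j=0..n i - k. t ^ j / fact j * x (i, k + j)))"

lemma DERIV_exp_series:
  "((\<lambda>t. \<Sum>j=0..m. t ^ j / fact j * c j) has_real_derivative
     (if m = 0 then 0 else (\<Sum>j=0..m - 1. t ^ j / fact j * c (Suc j)))) (at t)"
proof (cases m)
  case (Suc l)
  have "(\<lambda>t. \<Sum>j=0..m. t ^ j / fact j * c j) = (\<lambda>t. c 0 + (\<Sum>j=0..l. t ^ Suc j / fact (Suc j) * c (Suc j)))"
    unfolding Suc by (subst sum.atLeast0_atMost_Suc_shift) (simp add: o_def)
  moreover have "((\<lambda>t. t ^ Suc j / fact (Suc j) * c (Suc j)) has_real_derivative t ^ j / fact j * c (Suc j)) (at t)" for j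
  proof -
    have "((\<lambda>t. t ^ Suc j / fact (Suc j) * c (Suc j)) has_real_derivative (real (Suc j) * t ^ j) / fact (Suc j) * c (Suc j)) (at t)"
      by (rule derivative_eq_intros | simp)+
    moreover have "(real (Suc j) * t ^ j) / fact (Suc j) = t ^ j / fact j"
      by (simp add: fact_Suc divide_simps del: of_nat_Suc)
    ultimately show ?thesis by simp
  qed
  then have "((\<lambda>t. c 0 + (\<Sum>j=0..l. t ^ Suc j / fact (Suc j) * c (Suc j))) has_real_derivative 
     0 + (\<Sum>j=0..l. t ^ j / fact j * c (Suc j))) (at t)"
    by (intro DERIV_add DERIV_const DERIV_sum)
  ultimately show ?thesis using Suc by simp
qed simp

lemma eflow_solves: "solves_ode L n \<alpha> (eflow L n \<alpha> x)"
  unfolding solves_ode_def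
proof (intro conjI allI ballI)
  fix t
  show "eflow L n \<alpha> x t \<in> space (state_space L n)"
    by (simp add: space_state_space eflow_def)
  fix p assume "p \<in> coords L n"
  then obtain i k where p: "p = (i, k)" "(i, k) \<in> coords L n" "k \<le> n i" by (cases p) (auto simp: coords_iff)
  let ?S = "\<lambda>t. \<Sum>j=0..n i - k. t ^ j / fact j * x (i, k + j)"
  let ?S' = "if n i - k = 0 then 0 else (\<Sum>j=0..n i - k - 1. t ^ j / fact j * x (i, k + Suc j))"
  have "((\<lambda>t. exp (- \<alpha> i * t) * ?S t) has_real_derivative
     (- \<alpha> i) * (exp (- \<alpha> i * t) * ?S t) + exp (- \<alpha> i * t) * ?S') (at t)"
    by (rule derivative_eq_intros DERIV_exp_series refl | simp)+
  moreover have "exp (- \<alpha> i * t) * ?S' = (if k < n i then eflow L n \<alpha> x t (i, k + 1) else 0)"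
    using p by (auto simp: eflow_def coords_iff)
  moreover have ef: "eflow L n \<alpha> x s p = exp (- \<alpha> i * s) * ?S s" for s
    using p by (simp add: eflow_def)
  moreover have "vector_field L n \<alpha> (eflow L n \<alpha> x t) p =
      - \<alpha> i * eflow L n \<alpha> x t p + (if k < n i then eflow L n \<alpha> x t (i, k + 1) else 0)"
    using p by (simp add: vector_field_def)
  ultimately show "((\<lambda>s. eflow L n \<alpha> x s p) has_real_derivative vector_field L n \<alpha> (eflow L n \<alpha> x t) p) (at t)"
    by (simp only:)
qed

lemma eflow_0: "x \<in> space (state_space L n) \<Longrightarrow> eflow L n \<alpha> x 0 = x"
proof (rule extensionalityI[of _ "coords L n"])
  fix p assume "p \<in> coords L n"
  then obtain i k where p: "p = (i, k)" "(i, k) \<in> coords L n" by (cases p) auto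
  have "(\<Sum>j=0..n i - k. (0::real) ^ j / fact j * x (i, k + j)) = (\<Sum>j=0..n i - k. if j = 0 then x (i, k) else 0)"
    by (intro sum.cong) auto
  then show "eflow L n \<alpha> x 0 p = x p" using p by (simp add: eflow_def sum.delta)
qed (auto simp: space_state_space eflow_def)

text \<open>
  The system is triangular: the last coordinate of a cascade solves a scalar equation, and then each
  coordinate is determined by the next one.
\<close>

lemma solves_ode_unique:
  assumes u: "solves_ode L n \<alpha> u" and v: "solves_ode L n \<alpha> v" and init: "u 0 = v 0"
  shows "u = v"
proof -
  have *: "u t (i, n i - m) = v t (i, n i - m)" if i: "i \<in> {1..L}" for i m t
  proof (induction m arbitrary: t)
    case IH: 0
    let ?z = "\<lambda>t. exp (\<alpha> i * t) * (u t (i, n i) - v t (i, n i))"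
    have c: "(i, n i) \<in> coords L n" using i by (simp add: coords_iff)
    have d: "((\<lambda>s. u s (i, n i)) has_real_derivative - \<alpha> i * u t (i, n i)) (at t)" 
        "((\<lambda>s. v s (i, n i)) has_real_derivative - \<alpha> i * v t (i, n i)) (at t)" for t
      using u v c unfolding solves_ode_def by (force simp: vector_field_def)+
    have "(?z has_real_derivative 0) (at t)" for t
      by (rule derivative_eq_intros d refl | simp add: algebra_simps)+
    then have "?z t = ?z 0" by (intro DERIV_isconst_all) auto
    then show ?case using init by simp
  next
    case (Suc m)
    show ?case
    proof (cases "Suc m \<le> n i")
      case False
      then have "n i - Suc m = n i - m" by simp
      then show ?thesis using Suc[of t] by simp
    next
      case True
      define k where "k = n i - Suc m"
      have k: "k < n i" "k + 1 = n i - m" using True by (auto simp: k_def)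
      let ?z = "\<lambda>t. exp (\<alpha> i * t) * (u t (i, k) - v t (i, k))"
      have c: "(i, k) \<in> coords L n" using i k by (simp add: coords_iff)
      have d: "((\<lambda>s. u s (i, k)) has_real_derivative - \<alpha> i * u t (i, k) + u t (i, k + 1)) (at t)" 
          "((\<lambda>s. v s (i, k)) has_real_derivative - \<alpha> i * v t (i, k) + v t (i, k + 1)) (at t)" for t
        using u v c k unfolding solves_ode_def by (force simp: vector_field_def)+
      have e: "v t (i, k + 1) = u t (i, k + 1)" for t using Suc k by simp
      have "(?z has_real_derivative 0) (at t)" for t
        by (rule derivative_eq_intros d[unfolded e] refl | simp add: algebra_simps)+
      then have "?z t = ?z 0" by (intro DERIV_isconst_all) auto
      then show ?thesis using init by (simp add: k_def)
    qed
  qed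
  show ?thesis
  proof
    fix t
    show "u t = v t"
    proof (rule extensionalityI[of _ "coords L n"])
      fix p assume "p \<in> coords L n"
      then obtain i k where p: "p = (i, k)" "i \<in> {1..L}" "k \<le> n i" by (cases p) (auto simp: coords_iff)
      then show "u t p = v t p" using *[of i t "n i - k"] by simp
    qed (use u v in \<open>auto simp: solves_ode_def space_state_space\<close>)
  qed
qed

lemma flow_eq: 
  assumes "x \<in> space (state_space L n)"
  shows "flow L n \<alpha> x = eflow L n \<alpha> x"
  unfolding flow_def
  using eflow_solves eflow_0[OF assms]
  by (intro the_equality) (auto intro: solves_ode_unique)

lemma eflow_add:
  "eflow L n \<alpha> (eflow L n \<alpha> x s) t = eflow L n \<alpha> x (s + t)"
proof -
  let ?u = "eflow L n \<alpha> x"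
  have "solves_ode L n \<alpha> (\<lambda>t. ?u (s + t))"
    unfolding solves_ode_def
  proof (intro conjI allI ballI)
    fix t p assume p: "p \<in> coords L n"
    have "((\<lambda>s. ?u s p) has_real_derivative vector_field L n \<alpha> (?u (s + t)) p) (at (s + t))"
      using eflow_solves[of L n \<alpha> x] p unfolding solves_ode_def by blast
    then show "((\<lambda>t. ?u (s + t) p) has_real_derivative vector_field L n \<alpha> (?u (s + t)) p) (at t)"
      using DERIV_shift[of "\<lambda>s. ?u s p" "vector_field L n \<alpha> (?u (s + t)) p" t s]
      by (simp add: add.commute)
  qed (simp add: space_state_space eflow_def)
  moreover have "eflow L n \<alpha> (?u s) 0 = ?u s"
    by (intro eflow_0) (simp add: space_state_space eflow_def)
  ultimately have "eflow L n \<alpha> (?u s) = (\<lambda>t. ?u (s + t))"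
    by (intro solves_ode_unique[OF eflow_solves]) auto
  then show ?thesis by (rule fun_cong)
qed

lemma eflow_measurable:
  "(\<lambda>q. eflow L n \<alpha> (fst q) (snd q)) \<in> state_space L n \<Otimes>\<^sub>M borel \<rightarrow>\<^sub>M state_space L n"
  unfolding eflow_def state_space_def
proof (rule measurable_restrict)
  fix p assume "p \<in> coords L n"
  then obtain i k where p: "p = (i, k)" "(i, k) \<in> coords L n" by (cases p) auto
  have [measurable]: "(\<lambda>q. fst q (i, k + j)) \<in> borel_measurable ((\<Pi>\<^sub>M p\<in>coords L n. borel) \<Otimes>\<^sub>M borel)" if "j \<in> {0..n i - k}" for j
    using that p by (intro measurable_compose[OF measurable_fst measurable_component_singleton]) (auto simp: coords_iff)
  show "(\<lambda>q. case p of (i, k) \<Rightarrow> exp (- \<alpha> i * snd q) * (\<Sum>j=0..n i - k. snd q ^ j / fact j * fst q (i, k + j)))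
      \<in> borel_measurable ((\<Pi>\<^sub>M p\<in>coords L n. borel) \<Otimes>\<^sub>M borel)"
    unfolding p(1) prod.case
    by (intro borel_measurable_times borel_measurable_sum) (measurable; simp)+
qed

definition absdiff :: "nat \<Rightarrow> (nat \<Rightarrow> nat) \<Rightarrow> (nat \<times> nat \<Rightarrow> real) \<Rightarrow> (nat \<times> nat \<Rightarrow> real) \<Rightarrow> (nat \<times> nat \<Rightarrow> real)" where
  "absdiff L n x y = (\<lambda>p\<in>coords L n. \<bar>x p - y p\<bar>)"

lemma absdiff_space[simp]: "absdiff L n x y \<in> space (state_space L n)"
  by (simp add: absdiff_def space_state_space)

text \<open>
  For \<open>t \<ge> 0\<close> the flow is linear with nonnegative coefficients.
\<close>

lemma eflow_absdiff:
  assumes "0 \<le> t" and p: "p \<in> coords L n"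
  shows "\<bar>eflow L n \<alpha> x t p - eflow L n \<alpha> y t p\<bar> \<le> eflow L n \<alpha> (absdiff L n x y) t p"
proof -
  obtain i k where p: "p = (i, k)" "(i, k) \<in> coords L n" using p by (cases p) auto
  have "eflow L n \<alpha> x t p - eflow L n \<alpha> y t p =
     exp (- \<alpha> i * t) * (\<Sum>j=0..n i - k. t ^ j / fact j * (x (i, k + j) - y (i, k + j)))"
    using p by (simp add: eflow_def right_diff_distrib sum_subtractf)
  also have "\<bar>\<dots>\<bar> \<le> exp (- \<alpha> i * t) * (\<Sum>j=0..n i - k. t ^ j / fact j * \<bar>x (i, k + j) - y (i, k + j)\<bar>)"
    unfolding abs_mult using assms 
    by (intro mult_mono order_trans[OF sum_abs] sum_mono) (auto simp: abs_mult)
  also have "\<dots> = eflow L n \<alpha> (absdiff L n x y) t p"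
    using p by (auto simp: eflow_def absdiff_def coords_iff intro!: sum.cong)
  finally show ?thesis .
qed

lemma eflow_nonneg:
  assumes "0 \<le> t" and p: "p \<in> coords L n"
  shows "0 \<le> eflow L n \<alpha> (absdiff L n x y) t p"
  using eflow_absdiff[OF assms, of \<alpha> x y] by (meson abs_ge_zero order_trans)

section \<open>Contraction of the coupled process\<close>

lemma sum_shift_index:
  fixes a v :: "nat \<Rightarrow> real"
  shows "(\<Sum>k=0..m. a k * (if k < m then v (k + 1) else 0)) = (\<Sum>k=0..m. (if k = 0 then 0 else a (k - 1)) * v k)"
proof (cases m)
  case (Suc l)
  have "(\<Sum>k=0..Suc l. a k * (if k < Suc l then v (k + 1) else 0)) = (\<Sum>k=0..l. a k * v (k + 1))"
    by simp
  also have "\<dots> = (\<Sum>k=0..Suc l. (if k = 0 then 0 else a (k - 1)) * v k)"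
    by (subst sum.atLeast0_atMost_Suc_shift) simp
  finally show ?thesis using Suc by simp
qed simp

text \<open>
  For the contraction only the inequalities \<open>drift\<close> between the weights matter. With \<open>\<alpha> i\<close> on the
  right, they compare the damping of a coordinate with what it feeds: the preceding coordinate, or, for
  \<open>k = 0\<close>, the jumps through the Lipschitz rate function.
\<close>

locale network =
  fixes L :: nat and n :: "nat \<Rightarrow> nat" and \<alpha> :: "nat \<Rightarrow> real" and G :: "(nat \<Rightarrow> real) measure"
    and f :: "real \<Rightarrow> real" and K :: real and w :: "nat \<times> nat \<Rightarrow> real" and d :: real
  assumes sets_G[measurable_cong]: "sets G = sets (mark_space L)" and prob_G: "prob_space G"
    and f_nonneg: "\<And>s. 0 \<le> f s" and f_Lipschitz: "K-lipschitz_on UNIV f"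
    and w_pos: "\<And>p. p \<in> coords L n \<Longrightarrow> 0 < w p"
    and jump_size_integrable: "integrable G (\<lambda>c. \<Sum>i=1..L. w (i, n i) * \<bar>c i\<bar>)"
    and d_nonneg: "0 \<le> d"
    and drift: "\<And>i k. (i, k) \<in> coords L n \<Longrightarrow>
      (if k = 0 then K * (\<integral>c. (\<Sum>i=1..L. w (i, n i) * \<bar>c i\<bar>) \<partial>G) else w (i, k - 1)) \<le> (\<alpha> i - d) * w (i, k)"
begin

abbreviation "E \<equiv> state_space L n"
abbreviation "zero \<equiv> (\<lambda>_\<in>coords L n. 0 :: real)"
abbreviation "rate \<equiv> jump_rate L f"

definition jump_size :: "(nat \<Rightarrow> real) \<Rightarrow> real" where
  "jump_size c = (\<Sum>i=1..L. w (i, n i) * \<bar>c i\<bar>)"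

definition mean_jump :: real where
  "mean_jump = (\<integral>c. jump_size c \<partial>G)"

definition wdist :: "(nat \<times> nat \<Rightarrow> real) \<Rightarrow> (nat \<times> nat \<Rightarrow> real) \<Rightarrow> real" where
  "wdist x y = (\<Sum>p\<in>coords L n. w p * \<bar>x p - y p\<bar>)"

definition wnorm :: "(nat \<times> nat \<Rightarrow> real) \<Rightarrow> real" where
  "wnorm x = wdist x zero"

lemma component_measurable[measurable (raw)]:
  "p \<in> coords L n \<Longrightarrow> g \<in> M \<rightarrow>\<^sub>M E \<Longrightarrow> (\<lambda>\<omega>. g \<omega> p) \<in> borel_measurable M"
  unfolding state_space_def by (rule measurable_compose[OF _ measurable_component_singleton])

lemma mark_measurable: "i \<in> {1..L} \<Longrightarrow> (\<lambda>c. c i) \<in> borel_measurable G"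
  using sets_G unfolding mark_space_def
  by (subst measurable_cong_sets[OF sets_G refl]) (simp add: mark_space_def)

lemma jump_size_measurable[measurable]: "jump_size \<in> borel_measurable G"
  unfolding jump_size_def[abs_def]
  by (intro borel_measurable_sum borel_measurable_times borel_measurable_const borel_measurable_abs mark_measurable)

lemma K_nonneg: "0 \<le> K"
  using f_Lipschitz by (rule lipschitz_on_nonneg)

lemma f_lip: "\<bar>f s - f t\<bar> \<le> K * \<bar>s - t\<bar>"
  using lipschitz_onD[OF f_Lipschitz, of s t] by (simp add: dist_real_def)

lemma f_cont: "continuous_on UNIV f"
  by (rule lipschitz_on_continuous_on[OF f_Lipschitz])

lemma jump_size_nonneg: "0 \<le> jump_size c"
  unfolding jump_size_def by (intro sum_nonneg mult_nonneg_nonneg less_imp_le[OF w_pos]) (auto simp: coords_iff)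

lemma mean_jump_nonneg: "0 \<le> mean_jump"
  unfolding mean_jump_def by (intro integral_nonneg_AE AE_I2 jump_size_nonneg)

lemma nn_integral_jump_size: "(\<integral>\<^sup>+c. ennreal (jump_size c) \<partial>G) = ennreal mean_jump"
  unfolding mean_jump_def using jump_size_integrable jump_size_nonneg
  by (intro nn_integral_eq_integral) (auto simp: jump_size_def[abs_def])

lemma wdist_nonneg: "0 \<le> wdist x y"
  unfolding wdist_def by (intro sum_nonneg mult_nonneg_nonneg less_imp_le[OF w_pos]) auto

lemma wdist_measurable[measurable (raw)]:
  assumes "g \<in> M \<rightarrow>\<^sub>M E" "h \<in> M \<rightarrow>\<^sub>M E" shows "(\<lambda>\<omega>. wdist (g \<omega>) (h \<omega>)) \<in> borel_measurable M"
  unfolding wdist_def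
  by (intro borel_measurable_sum borel_measurable_times borel_measurable_const borel_measurable_abs borel_measurable_diff
      component_measurable[OF _ assms(1)] component_measurable[OF _ assms(2)])

lemma zero_space: "zero \<in> space E"
  by (simp add: space_state_space)

lemma wnorm_measurable[measurable]: "wnorm \<in> borel_measurable E"
  unfolding wnorm_def[abs_def] using zero_space by measurable

lemma jump_sum: "(\<Sum>(i,k)\<in>coords L n. w (i, k) * (if k = n i then \<bar>c i\<bar> else 0)) = jump_size c"
proof -
  have "w (i, k) * (if k = n i then \<bar>c i\<bar> else 0) = (if k = n i then w (i, n i) * \<bar>c i\<bar> else 0)" for i k
    by simp
  then show ?thesis unfolding sum_coords jump_size_def by (simp add: sum.delta)
qed

lemma wdist_add_jump:
  "wdist (add_jump L n x c) (add_jump L n y c) = wdist x y"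
  "wdist (add_jump L n x c) y \<le> wdist x y + jump_size c"
  "wdist x (add_jump L n y c) \<le> wdist x y + jump_size c"
proof -
  show "wdist (add_jump L n x c) (add_jump L n y c) = wdist x y"
    unfolding wdist_def by (intro sum.cong) (auto simp: add_jump_def)
  have 1: "w p * \<bar>add_jump L n x c p - y p\<bar> \<le> w p * \<bar>x p - y p\<bar> + w p * (if snd p = n (fst p) then \<bar>c (fst p)\<bar> else 0)"
    and 2: "w p * \<bar>x p - add_jump L n y c p\<bar> \<le> w p * \<bar>x p - y p\<bar> + w p * (if snd p = n (fst p) then \<bar>c (fst p)\<bar> else 0)"
    if "p \<in> coords L n" for p
    unfolding distrib_left[symmetric] using that w_pos[OF that]
    by (intro mult_left_mono; auto simp: add_jump_def split: prod.splits)+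
  show "wdist (add_jump L n x c) y \<le> wdist x y + jump_size c"
    unfolding wdist_def jump_sum[symmetric] sum.distrib[symmetric] using 1
    by (intro sum_mono) (auto simp: split_beta)
  show "wdist x (add_jump L n y c) \<le> wdist x y + jump_size c"
    unfolding wdist_def jump_sum[symmetric] sum.distrib[symmetric] using 2
    by (intro sum_mono) (auto simp: split_beta)
qed

lemma wnorm_add_jump: "wnorm (add_jump L n x c) \<le> wnorm x + jump_size c"
  unfolding wnorm_def by (rule wdist_add_jump(2))

text \<open>
  A smooth majorant of the weighted distance of two trajectories without jumps, and its derivative.
\<close>

definition major :: "(nat \<times> nat \<Rightarrow> real) \<Rightarrow> (nat \<times> nat \<Rightarrow> real) \<Rightarrow> real \<Rightarrow> real" where
  "major x y s = (\<Sum>p\<in>coords L n. w p * eflow L n \<alpha> (absdiff L n x y) s p)"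

definition major' :: "(nat \<times> nat \<Rightarrow> real) \<Rightarrow> (nat \<times> nat \<Rightarrow> real) \<Rightarrow> real \<Rightarrow> real" where
  "major' x y s = (\<Sum>p\<in>coords L n. w p * vector_field L n \<alpha> (eflow L n \<alpha> (absdiff L n x y) s) p)"

lemma eflow_DERIV:
  "p \<in> coords L n \<Longrightarrow> ((\<lambda>s. eflow L n \<alpha> x s p) has_real_derivative vector_field L n \<alpha> (eflow L n \<alpha> x s) p) (at s)"
  using eflow_solves[of L n \<alpha> x] unfolding solves_ode_def by blast

lemma eflow_cont: "p \<in> coords L n \<Longrightarrow> continuous_on UNIV (\<lambda>s. eflow L n \<alpha> x s p)"
  using eflow_DERIV by (meson DERIV_isCont continuous_at_imp_continuous_on)

lemma major_DERIV: "(major x y has_real_derivative major' x y s) (at s)"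
  unfolding major_def[abs_def] major'_def
  by (intro DERIV_sum DERIV_cmult eflow_DERIV)

lemma major'_cont: "continuous_on UNIV (major' x y)"
proof -
  have "continuous_on UNIV (\<lambda>s. vector_field L n \<alpha> (eflow L n \<alpha> (absdiff L n x y) s) p)"
    if p: "p \<in> coords L n" for p
  proof -
    obtain i k where ik: "p = (i, k)" "i \<in> {1..L}" "k \<le> n i" using p by (cases p) (auto simp: coords_iff)
    show ?thesis
    proof (cases "k < n i")
      case True
      then show ?thesis using p ik
        by (auto simp: vector_field_def coords_iff intro!: continuous_intros eflow_cont)
    next
      case False
      then show ?thesis using p ik
        by (auto simp: vector_field_def coords_iff intro!: continuous_intros eflow_cont)
    qed
  qed
  then show ?thesis unfolding major'_def[abs_def] by (intro continuous_intros)
qed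

lemma major_0: "major x y 0 = wdist x y"
  unfolding major_def wdist_def eflow_0[OF absdiff_space] by (intro sum.cong) (auto simp: absdiff_def)

lemma major_nonneg: "0 \<le> s \<Longrightarrow> 0 \<le> major x y s"
  unfolding major_def
  by (intro sum_nonneg mult_nonneg_nonneg less_imp_le[OF w_pos] eflow_nonneg)

lemma wdist_flow_le_major:
  assumes "x \<in> space E" "y \<in> space E" "0 \<le> s"
  shows "wdist (flow L n \<alpha> x s) (flow L n \<alpha> y s) \<le> major x y s"
  unfolding wdist_def major_def flow_eq[OF assms(1)] flow_eq[OF assms(2)]
  by (intro sum_mono mult_left_mono eflow_absdiff assms less_imp_le[OF w_pos])

text \<open>
  Summation by parts within each cascade moves the coupling of neighbouring coordinates to the weights,
  where \<open>drift\<close> applies term by term.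
\<close>

lemma major_drift:
  assumes s: "0 \<le> s"
  shows "d * major x y s + major' x y s + K * mean_jump * (\<Sum>i=1..L. eflow L n \<alpha> (absdiff L n x y) s (i, 0)) \<le> 0"
proof -
  define u where "u = eflow L n \<alpha> (absdiff L n x y) s"
  have u: "0 \<le> u p" if "p \<in> coords L n" for p
    unfolding u_def using that s by (intro eflow_nonneg)
  have "major' x y s = (\<Sum>i=1..L. \<Sum>k=0..n i. w (i, k) * (- \<alpha> i * u (i, k) + (if k < n i then u (i, k + 1) else 0)))"
    unfolding major'_def u_def[symmetric] sum_coords
    by (intro sum.cong refl) (auto simp: vector_field_def coords_iff)
  also have "\<dots> = (\<Sum>i=1..L. (\<Sum>k=0..n i. w (i, k) * (- \<alpha> i * u (i, k))) + (\<Sum>k=0..n i. w (i, k) * (if k < n i then u (i, k + 1) else 0)))"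
    unfolding distrib_left sum.distrib ..
  also have "\<dots> = (\<Sum>i=1..L. (\<Sum>k=0..n i. w (i, k) * (- \<alpha> i * u (i, k))) + (\<Sum>k=0..n i. (if k = 0 then 0 else w (i, k - 1)) * u (i, k)))"
    using sum_shift_index[of "\<lambda>k. w (i, k)" "n i" "\<lambda>k. u (i, k)" for i] by simp
  also have "\<dots> = (\<Sum>i=1..L. \<Sum>k=0..n i. (- \<alpha> i * w (i, k) + (if k = 0 then 0 else w (i, k - 1))) * u (i, k))"
    unfolding sum.distrib[symmetric] by (intro sum.cong refl) (simp add: algebra_simps)
  finally have m': "major' x y s = \<dots>" .
  have m: "d * major x y s = (\<Sum>i=1..L. \<Sum>k=0..n i. d * w (i, k) * u (i, k))"
    unfolding major_def u_def[symmetric] sum_coords by (simp add: sum_distrib_left mult_ac)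
  have Kq: "K * mean_jump * (\<Sum>i=1..L. u (i, 0)) = (\<Sum>i=1..L. \<Sum>k=0..n i. (if k = 0 then K * mean_jump else 0) * u (i, k))"
  proof -
    have "(if k = 0 then K * mean_jump else 0) * u (i, k) = (if k = 0 then K * mean_jump * u (i, 0) else 0)" for i k by simp
    then show ?thesis by (simp add: sum_distrib_left sum.delta)
  qed
  have "d * major x y s + major' x y s + K * mean_jump * (\<Sum>i=1..L. u (i, 0)) =
      (\<Sum>i=1..L. \<Sum>k=0..n i. ((if k = 0 then K * mean_jump else w (i, k - 1)) - (\<alpha> i - d) * w (i, k)) * u (i, k))"
    unfolding m m' Kq sum.distrib[symmetric] by (intro sum.cong refl) (auto simp: algebra_simps)
  also have "\<dots> \<le> 0"
  proof (intro sum_nonpos mult_nonpos_nonneg)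
    fix i k assume "i \<in> {1..L}" "k \<in> {0..n i}"
    then have ik: "(i, k) \<in> coords L n" by (auto simp: coords_iff)
    show "0 \<le> u (i, k)" by (rule u[OF ik])
    show "(if k = 0 then K * mean_jump else w (i, k - 1)) - (\<alpha> i - d) * w (i, k) \<le> 0"
      using drift[OF ik] unfolding mean_jump_def jump_size_def by simp
  qed
  finally show ?thesis unfolding u_def .
qed

lemma major_decr: "0 \<le> s \<Longrightarrow> major x y s \<le> wdist x y"
proof -
  assume s: "0 \<le> s"
  have "major x y s \<le> major x y 0"
  proof (rule DERIV_nonpos_imp_nonincreasing[OF s])
    fix r assume r: "0 \<le> r" "r \<le> s"
    have "0 \<le> K * mean_jump * (\<Sum>i=1..L. eflow L n \<alpha> (absdiff L n x y) r (i, 0))"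
      using r by (intro mult_nonneg_nonneg sum_nonneg K_nonneg mean_jump_nonneg eflow_nonneg) (auto simp: coords_iff)
    moreover have "0 \<le> d * major x y r" using d_nonneg major_nonneg[OF r(1)] by simp
    ultimately have "major' x y r \<le> 0" using major_drift[OF r(1), of x y] by simp
    then show "\<exists>D. (major x y has_real_derivative D) (at r) \<and> D \<le> 0" using major_DERIV by blast
  qed
  then show ?thesis by (simp add: major_0)
qed

lemma flow_zero: "flow L n \<alpha> zero s = zero"
proof (rule extensionalityI[of _ "coords L n"])
  fix p assume "p \<in> coords L n"
  then show "flow L n \<alpha> zero s p = zero p"
    unfolding flow_eq[OF zero_space] eflow_def
    by (cases p) (auto simp: coords_iff intro!: sum.neutral)
qed (simp_all add: flow_eq[OF zero_space] eflow_def)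

lemma rate_measurable: "rate \<in> borel_measurable E"
  unfolding jump_rate_def[abs_def]
  by (rule measurable_compose[OF _ borel_measurable_continuous_onI[OF f_cont]])
     (intro borel_measurable_sum component_measurable, auto simp: coords_iff)

lemma rate_diff: "\<bar>rate x - rate y\<bar> \<le> K * (\<Sum>i=1..L. \<bar>x (i, 0) - y (i, 0)\<bar>)"
proof -
  have "\<bar>rate x - rate y\<bar> \<le> K * \<bar>(\<Sum>i=1..L. x (i, 0)) - (\<Sum>i=1..L. y (i, 0))\<bar>"
    unfolding jump_rate_def by (rule f_lip)
  also have "\<dots> \<le> K * (\<Sum>i=1..L. \<bar>x (i, 0) - y (i, 0)\<bar>)"
    unfolding sum_subtractf[symmetric] by (intro mult_left_mono sum_abs K_nonneg)
  finally show ?thesis .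
qed

definition rate_growth :: real where
  "rate_growth = f 0 + K * (\<Sum>i=1..L. 1 / w (i, 0))"

lemma rate_bound: "rate x \<le> rate_growth * (1 + wnorm x)"
proof -
  have "rate x - rate zero \<le> K * (\<Sum>i=1..L. \<bar>x (i, 0) - zero (i, 0)\<bar>)"
    using rate_diff[of x zero] by (rule order_trans[OF abs_ge_self])
  also have "\<dots> \<le> K * (\<Sum>i=1..L. 1 / w (i, 0) * wnorm x)"
  proof (intro mult_left_mono sum_mono K_nonneg)
    fix i assume "i \<in> {1..L}"
    then have c: "(i, 0) \<in> coords L n" by (auto simp: coords_iff)
    have "w (i, 0) * \<bar>x (i, 0) - zero (i, 0)\<bar> \<le> wnorm x"
      unfolding wnorm_def wdist_def using c w_pos
      by (intro member_le_sum[where f="\<lambda>p. w p * \<bar>x p - zero p\<bar>"] mult_nonneg_nonneg) (auto intro: less_imp_le)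
    then show "\<bar>x (i, 0) - zero (i, 0)\<bar> \<le> 1 / w (i, 0) * wnorm x"
      using w_pos[OF c] by (simp add: field_simps)
  qed
  also have "\<dots> = (K * (\<Sum>i=1..L. 1 / w (i, 0))) * wnorm x"
    unfolding sum_distrib_right[symmetric] by simp
  finally have "rate x \<le> f 0 + (K * (\<Sum>i=1..L. 1 / w (i, 0))) * wnorm x"
    by (simp add: jump_rate_def coords_iff)
  also have "\<dots> \<le> rate_growth * (1 + wnorm x)"
  proof -
    have "0 \<le> K * (\<Sum>i=1..L. 1 / w (i, 0))"
      using w_pos by (intro mult_nonneg_nonneg K_nonneg sum_nonneg) (auto simp: coords_iff intro: less_imp_le)
    moreover have "0 \<le> wnorm x" "0 \<le> f 0" by (auto simp: wnorm_def wdist_nonneg f_nonneg)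
    ultimately show ?thesis unfolding rate_growth_def by (auto simp: algebra_simps)
  qed
  finally show ?thesis .
qed

text \<open>
  The weighted distance from \<open>0\<close> is a Lyapunov function, since the flow contracts it and the rate is at
  most linear in it.
\<close>

sublocale P: pdmp_lyapunov E G "flow L n \<alpha>" rate "add_jump L n" zero wnorm rate_growth mean_jump
proof (rule pdmp_lyapunov.intro[OF pdmp.intro pdmp_lyapunov_axioms.intro])
  interpret G: prob_space G by (rule prob_G)
  show "prob_space G" by (rule prob_G)
  show "zero \<in> space E" by (rule zero_space)
  have "(\<lambda>p. flow L n \<alpha> (fst p) (snd p)) \<in> E \<Otimes>\<^sub>M borel \<rightarrow>\<^sub>M E \<longleftrightarrow>
     (\<lambda>p. eflow L n \<alpha> (fst p) (snd p)) \<in> E \<Otimes>\<^sub>M borel \<rightarrow>\<^sub>M E"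
    by (intro measurable_cong) (auto simp: space_pair_measure flow_eq)
  then show "(\<lambda>p. flow L n \<alpha> (fst p) (snd p)) \<in> E \<Otimes>\<^sub>M borel \<rightarrow>\<^sub>M E"
    using eflow_measurable by simp
  show "rate \<in> borel_measurable E" by (rule rate_measurable)
  show "(\<lambda>p. add_jump L n (fst p) (snd p)) \<in> E \<Otimes>\<^sub>M G \<rightarrow>\<^sub>M E"
  proof -
    have "(\<lambda>p. \<lambda>r\<in>coords L n. fst p r + (if snd r = n (fst r) then snd p (fst r) else 0)) \<in> E \<Otimes>\<^sub>M G \<rightarrow>\<^sub>M (\<Pi>\<^sub>M p\<in>coords L n. borel)"
    proof (rule measurable_restrict)
      fix r assume r: "r \<in> coords L n"
      then have m: "(\<lambda>c. c (fst r)) \<in> borel_measurable G" by (intro mark_measurable) (auto simp: coords_def)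
      have "(\<lambda>p. if snd r = n (fst r) then snd p (fst r) else (0::real)) \<in> borel_measurable (E \<Otimes>\<^sub>M G)"
        using measurable_compose[OF measurable_snd m, of E] by (cases "snd r = n (fst r)") simp_all
      then show "(\<lambda>p. fst p r + (if snd r = n (fst r) then snd p (fst r) else 0)) \<in> borel_measurable (E \<Otimes>\<^sub>M G)"
        by (rule borel_measurable_add[OF component_measurable[OF r measurable_fst]])
    qed
    then show ?thesis by (simp add: add_jump_def state_space_def split_beta')
  qed
  show "wnorm \<in> borel_measurable E" by simp
  show "0 \<le> rate_growth" unfolding rate_growth_def using w_pos
    by (intro add_nonneg_nonneg mult_nonneg_nonneg K_nonneg sum_nonneg f_nonneg) (auto simp: coords_iff intro: less_imp_le)
  show "0 \<le> mean_jump" by (rule mean_jump_nonneg)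
  fix x assume x: "x \<in> space E"
  show "flow L n \<alpha> x 0 = x" using x by (simp add: flow_eq eflow_0)
  have es: "eflow L n \<alpha> x s \<in> space E" for s by (simp add: space_state_space eflow_def)
  show "flow L n \<alpha> (flow L n \<alpha> x s) t = flow L n \<alpha> x (s + t)" for s t
    using x es by (simp add: flow_eq eflow_add)
  show "0 \<le> rate x" by (simp add: jump_rate_def f_nonneg)
  show "continuous_on UNIV (\<lambda>s. rate (flow L n \<alpha> x s))"
    unfolding jump_rate_def flow_eq[OF x]
    by (rule continuous_on_compose2[OF f_cont]) (auto intro!: continuous_intros eflow_cont simp: coords_iff)
  show "0 \<le> wnorm x" by (simp add: wnorm_def wdist_nonneg)
  show "wnorm (flow L n \<alpha> x s) \<le> wnorm x" if "0 \<le> s" for s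
    using wdist_flow_le_major[OF x zero_space that] major_decr[OF that, of x zero]
    by (simp add: wnorm_def flow_zero)
  show "rate x \<le> rate_growth * (1 + wnorm x)" by (rule rate_bound)
  have "(\<integral>\<^sup>+c. ennreal (wnorm (add_jump L n x c)) \<partial>G) \<le> (\<integral>\<^sup>+c. ennreal (wnorm x) + ennreal (jump_size c) \<partial>G)"
    using wnorm_add_jump[of x] jump_size_nonneg wdist_nonneg[of x zero]
    by (intro nn_integral_mono) (auto simp: ennreal_plus[symmetric] wnorm_def[symmetric] simp del: ennreal_plus intro!: ennreal_leI)
  also have "\<dots> = ennreal (wnorm x) + ennreal mean_jump"
    by (subst nn_integral_add) (auto simp: G.emeasure_space_1 nn_integral_jump_size)
  also have "\<dots> = ennreal (wnorm x + mean_jump)"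
    using wdist_nonneg[of x zero] mean_jump_nonneg by (simp add: wnorm_def)
  finally show "(\<integral>\<^sup>+c. ennreal (wnorm (add_jump L n x c)) \<partial>G) \<le> ennreal (wnorm x + mean_jump)" .
qed

text \<open>
  The given process is the instance of the general construction for this flow, rate and jump map.
\<close>

lemma hold_eq: "P.hold = holding_time L n \<alpha> f"
  by (intro ext) (simp add: P.hold_def P.hazard_def holding_time_def)

lemma skeleton_eq: "skeleton L n \<alpha> f x \<omega> m = P.chain x \<omega> m"
  by (induction m) (simp_all add: hold_eq)

lemma process_eq: "process L n \<alpha> f x t \<omega> = P.traj x t \<omega>"
  unfolding process_def jump_process_def skeleton_eq ..

lemma transition_eq: "transition L n \<alpha> f G t x = P.trans t x"
  unfolding transition_def P.trans_def noise_def P.noiseM_def exp1_def process_eq[abs_def] ..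

abbreviation cost :: "((nat \<times> nat \<Rightarrow> real) \<times> (nat \<times> nat \<Rightarrow> real)) measure \<Rightarrow> ennreal" where
  "cost \<gamma> \<equiv> (\<integral>\<^sup>+z. ennreal (wdist (fst z) (snd z)) \<partial>\<gamma>)"

text \<open>
  The weighted distance decays exponentially in mean under the coupling. The supersolution
  \<open>exp (- d * t) * wdist x y\<close> is checked with the smooth majorant \<open>major x y\<close> instead of the distance
  along the flow, for which the generator inequality is \<open>major_drift\<close>.
\<close>

theorem coupled_contraction:
  assumes x: "x \<in> space E" and y: "y \<in> space E" and t: "0 \<le> t"
  shows "cost (P.pair_trans t (x, y)) \<le> ennreal (exp (- d * t) * wdist x y)"
proof -
  interpret Q: pdmp_lyapunov "P.pair_E" "P.pair_C" "P.pair_flow" "P.pair_rate" "P.pair_jump" "(zero, zero)"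
    "\<lambda>z. wnorm (fst z) + wnorm (snd z)" "2 * rate_growth" "2 * mean_jump"
    by (rule P.pdmp_lyapunov_coupled)
  have "Q.nn_act (\<lambda>z. ennreal (wdist (fst z) (snd z))) t (x, y) \<le> ennreal (exp (- d * t) * wdist (fst (x, y)) (snd (x, y)))"
  proof (rule Q.nn_act_le[OF _ _ t])
    show "(\<lambda>z. ennreal (wdist (fst z) (snd z))) \<in> borel_measurable P.pair_E" by measurable
    show "(x, y) \<in> space P.pair_E" using x y by (simp add: space_pair_measure)
    fix t :: real and z assume t: "0 \<le> t" and z: "z \<in> space P.pair_E"
    obtain x y where xy: "z = (x, y)" "x \<in> space E" "y \<in> space E" using z by (auto simp: space_pair_measure)
    let ?fx = "\<lambda>s. flow L n \<alpha> x s" and ?fy = "\<lambda>s. flow L n \<alpha> y s"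
    let ?e = "\<lambda>s. exp (- d * (t - s))"
    let ?u = "\<lambda>s. \<Sum>i=1..L. eflow L n \<alpha> (absdiff L n x y) s (i, 0)"
    let ?g = "\<lambda>s. ?e s * major x y s"
    let ?g' = "\<lambda>s. ?e s * (d * major x y s + major' x y s)"
    let ?k = "\<lambda>s. ?e s * (P.pair_rate (P.pair_flow z s) * major x y s + K * ?u s * mean_jump)"
    have major_cont: "continuous_on UNIV (major x y)"
      using major_DERIV by (meson DERIV_isCont continuous_at_imp_continuous_on)
    have u: "0 \<le> ?u s" if "0 \<le> s" for s
      using that by (intro sum_nonneg eflow_nonneg) (auto simp: coords_iff)
    have "Q.first_jump (\<lambda>z. ennreal (wdist (fst z) (snd z))) (\<lambda>t z. ennreal (exp (- d * t) * wdist (fst z) (snd z))) t z \<le> ennreal (?g 0)"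
    proof (rule Q.first_jump_le_FTC[OF z t, where g = ?g and g' = ?g' and k = ?k])
      show "(?g has_real_derivative ?g' s) (at s)" for s
        by (auto intro!: derivative_eq_intros major_DERIV simp: algebra_simps)
      show "continuous_on UNIV ?g'"
        by (intro continuous_intros major_cont major'_cont)
      show "ennreal (wdist (fst (P.pair_flow z t)) (snd (P.pair_flow z t))) \<le> ennreal (?g t)"
        using wdist_flow_le_major[OF xy(2,3) t] by (simp add: P.pair_flow_def xy(1) ennreal_leI)
      show "0 \<le> ?g t" using major_nonneg[OF t] by simp
      fix s assume s: "0 \<le> s" "s \<le> t"
      have zs: "P.pair_flow z s \<in> space P.pair_E" using z by simp
      have r0: "0 \<le> P.pair_rate (P.pair_flow z s)" using zs by (rule Q.rate_nonneg)
      show "0 \<le> ?k s"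
        using r0 u[OF s(1)] major_nonneg[OF s(1)] K_nonneg mean_jump_nonneg by (intro mult_nonneg_nonneg add_nonneg_nonneg) auto
      have "d * major x y s + major' x y s + K * ?u s * mean_jump \<le> 0"
        using major_drift[OF s(1), of x y] by (simp add: mult_ac)
      then have "?e s * (d * major x y s + major' x y s + K * ?u s * mean_jump) \<le> 0"
        by (simp add: mult_le_0_iff)
      then show "?g' s + ?k s \<le> P.pair_rate (P.pair_flow z s) * ?g s"
        by (simp add: algebra_simps)
      have fs: "?fx s \<in> space E" "?fy s \<in> space E" using xy by auto
      let ?D = "\<lambda>z. ennreal (?e s * wdist (fst z) (snd z))"
      have "ennreal (P.pair_rate (P.pair_flow z s)) * (\<integral>\<^sup>+c. ?D (P.pair_jump (P.pair_flow z s) c) \<partial>P.pair_C) \<le>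
         ennreal (P.pair_rate (P.pair_flow z s)) * ?D (?fx s, ?fy s) + ennreal \<bar>rate (?fx s) - rate (?fy s)\<bar> * (\<integral>\<^sup>+c. ennreal (?e s * jump_size c) \<partial>G)"
      proof -
        have "P.pair_flow z s = (?fx s, ?fy s)" by (simp add: P.pair_flow_def xy)
        moreover have le: "ennreal (?e s * v) \<le> ennreal (?e s * v') + ennreal (?e s * jump_size c)" if "v \<le> v' + jump_size c" "0 \<le> v'" for v v' c
          using that jump_size_nonneg[of c]
          by (subst ennreal_plus[symmetric]) (auto simp: distrib_left[symmetric] intro!: ennreal_leI)
        ultimately show ?thesis
          using fs
          by (simp only:) (intro P.pair_jump_cost, auto simp: wdist_add_jump(1) intro!: le wdist_add_jump wdist_nonneg)
      qed
      also have "(\<integral>\<^sup>+c. ennreal (?e s * jump_size c) \<partial>G) = ennreal (?e s * mean_jump)"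
        using jump_size_nonneg mean_jump_nonneg by (simp add: ennreal_mult nn_integral_cmult nn_integral_jump_size)
      also have "ennreal (P.pair_rate (P.pair_flow z s)) * ?D (?fx s, ?fy s) + ennreal \<bar>rate (?fx s) - rate (?fy s)\<bar> * ennreal (?e s * mean_jump)
        = ennreal (P.pair_rate (P.pair_flow z s) * (?e s * wdist (?fx s) (?fy s)) + \<bar>rate (?fx s) - rate (?fy s)\<bar> * (?e s * mean_jump))"
        using r0 mean_jump_nonneg wdist_nonneg by (simp add: ennreal_mult[symmetric] ennreal_plus[symmetric] del: ennreal_plus)
      also have "\<dots> \<le> ennreal (?k s)"
      proof (rule ennreal_leI)
        have "\<bar>rate (?fx s) - rate (?fy s)\<bar> \<le> K * (\<Sum>i=1..L. \<bar>?fx s (i, 0) - ?fy s (i, 0)\<bar>)" by (rule rate_diff)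
        also have "\<dots> \<le> K * ?u s"
          unfolding flow_eq[OF xy(2)] flow_eq[OF xy(3)]
          by (intro mult_left_mono sum_mono eflow_absdiff K_nonneg s) (auto simp: coords_iff)
        finally have "\<bar>rate (?fx s) - rate (?fy s)\<bar> * (?e s * mean_jump) \<le> K * ?u s * (?e s * mean_jump)"
          using mean_jump_nonneg by (intro mult_right_mono) auto
        moreover have "P.pair_rate (P.pair_flow z s) * (?e s * wdist (?fx s) (?fy s)) \<le> P.pair_rate (P.pair_flow z s) * (?e s * major x y s)"
          using wdist_flow_le_major[OF xy(2,3) s(1)] r0 by (intro mult_left_mono) auto
        moreover have "?k s = P.pair_rate (P.pair_flow z s) * (?e s * major x y s) + K * ?u s * (?e s * mean_jump)"
          by (simp add: distrib_left mult_ac)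
        ultimately show "P.pair_rate (P.pair_flow z s) * (?e s * wdist (?fx s) (?fy s)) + \<bar>rate (?fx s) - rate (?fy s)\<bar> * (?e s * mean_jump) \<le> ?k s"
          by (simp only: add_mono)
      qed
      finally show "ennreal (P.pair_rate (P.pair_flow z s)) * (\<integral>\<^sup>+c. ennreal (exp (- d * (t - s)) * wdist (fst (P.pair_jump (P.pair_flow z s) c)) (snd (P.pair_jump (P.pair_flow z s) c))) \<partial>P.pair_C) \<le> ennreal (?k s)" .
    qed
    then show "Q.first_jump (\<lambda>z. ennreal (wdist (fst z) (snd z))) (\<lambda>t z. ennreal (exp (- d * t) * wdist (fst z) (snd z))) t z
       \<le> ennreal (exp (- d * t) * wdist (fst z) (snd z))"
      by (simp add: major_0 xy(1))
  qed
  then show ?thesis by (simp add: Q.nn_act_def)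
qed

end

section \<open>Bounded Lipschitz functions\<close>

definition lower_box :: "nat \<Rightarrow> (nat \<Rightarrow> nat) \<Rightarrow> (nat \<times> nat \<Rightarrow> real) \<Rightarrow> (nat \<times> nat \<Rightarrow> real) set" where
  "lower_box L n a = {x \<in> space (state_space L n). \<forall>p\<in>coords L n. x p \<le> a p}"

lemma ex_coords_bound: "\<exists>m::nat. \<forall>p\<in>coords L n. x p \<le> real m"
proof -
  obtain m :: nat where m: "Max ((\<lambda>q. x q) ` coords L n) \<le> m" using real_arch_simple by blast
  then have "x q \<le> m" if "q \<in> coords L n" for q
    using that by (meson Max_ge finite_coords finite_imageI image_eqI order_trans)
  then show ?thesis by blast
qed

lemma sets_state_space_lower_box: "sets (state_space L n) = sigma_sets (space (state_space L n)) (range (lower_box L n))"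
proof (rule equalityI)
  let ?E = "state_space L n"
  let ?S = "sigma (space (state_space L n)) (range (lower_box L n))"
  have sub: "range (lower_box L n) \<subseteq> Pow (space ?E)" by (auto simp: lower_box_def)
  have spS: "space ?S = space ?E" and setsS: "sets ?S = sigma_sets (space ?E) (range (lower_box L n))"
    using sub by (simp_all add: space_measure_of)
  have comp: "(\<lambda>x. x p) \<in> borel_measurable ?E" if "p \<in> coords L n" for p
    unfolding state_space_def using that by (rule measurable_component_singleton)
  have "lower_box L n a \<in> sets ?E" for a
    unfolding lower_box_def
    by (rule sets.sets_Collect_finite_All[OF _ finite_coords], rule borel_measurable_le[OF comp]) auto
  then show "sigma_sets (space ?E) (range (lower_box L n)) \<subseteq> sets ?E"
    by (intro sets.sigma_sets_subset) auto
  have "(\<lambda>x p. x p) \<in> ?S \<rightarrow>\<^sub>M (\<Pi>\<^sub>M p\<in>coords L n. borel)"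
  proof (rule measurable_PiM_single'[where f = "\<lambda>p x. x p"])
    show "(\<lambda>x p. x p) \<in> space ?S \<rightarrow> (\<Pi>\<^sub>E p\<in>coords L n. space (borel :: real measure))"
      unfolding spS by (auto simp: state_space_def space_PiM)
    fix p assume p: "p \<in> coords L n"
    have "{x \<in> space ?S. x p \<le> a} \<in> sets ?S" for a
    proof -
      have "{x \<in> space ?S. x p \<le> a} = (\<Union>m::nat. lower_box L n ((\<lambda>_. real m)(p := a)))"
      proof (rule equalityI; rule subsetI)
        fix x assume x: "x \<in> {x \<in> space ?S. x p \<le> a}"
        obtain m :: nat where "\<forall>q\<in>coords L n. x q \<le> m" using ex_coords_bound by blast
        then have "x \<in> lower_box L n ((\<lambda>_. real m)(p := a))"
          using x unfolding spS by (auto simp: lower_box_def)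
        then show "x \<in> (\<Union>m::nat. lower_box L n ((\<lambda>_. real m)(p := a)))" by blast
      next
        fix x assume "x \<in> (\<Union>m::nat. lower_box L n ((\<lambda>_. real m)(p := a)))"
        then obtain m :: nat where "x \<in> lower_box L n ((\<lambda>_. real m)(p := a))" by blast
        then show "x \<in> {x \<in> space ?S. x p \<le> a}"
          using p unfolding spS lower_box_def by fastforce
      qed
      also have "\<dots> \<in> sets ?S" unfolding setsS by (rule sigma_sets.Union) (rule sigma_sets.Basic, simp)
      finally show ?thesis .
    qed
    then show "(\<lambda>x. x p) \<in> borel_measurable ?S"
      by (subst borel_measurable_iff_le) blast
  qed
  then have id: "(\<lambda>x. x) \<in> ?S \<rightarrow>\<^sub>M ?E" by (simp add: state_space_def)
  show "sets ?E \<subseteq> sigma_sets (space ?E) (range (lower_box L n))"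
  proof
    fix A assume A: "A \<in> sets ?E"
    from measurable_sets[OF id A] have "A \<inter> space ?E \<in> sets ?S" by (simp only: spS vimage_ident)
    then show "A \<in> sigma_sets (space ?E) (range (lower_box L n))"
      using sets.sets_into_space[OF A] by (simp only: setsS Int_absorb2)
  qed
qed

context network begin

definition bounded_lip :: "real \<Rightarrow> ((nat \<times> nat \<Rightarrow> real) \<Rightarrow> real) \<Rightarrow> bool" where
  "bounded_lip C h \<longleftrightarrow> h \<in> borel_measurable E \<and> 0 \<le> C \<and> (\<forall>x\<in>space E. \<bar>h x\<bar> \<le> 1) \<and>
     (\<forall>x\<in>space E. \<forall>y\<in>space E. \<bar>h x - h y\<bar> \<le> C * wdist x y)"

lemma bounded_lip_integrable:
  assumes h: "bounded_lip C h" and M: "prob_space M" "sets M = sets E"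
  shows "integrable M h"
proof (rule finite_measure.integrable_const_bound[where B = 1])
  show "finite_measure M" using M(1) by (rule prob_space.finite_measure)
  show "h \<in> borel_measurable M" using h by (simp add: bounded_lip_def measurable_cong_sets[OF M(2) refl])
  show "AE x in M. norm (h x) \<le> 1"
    using h sets_eq_imp_space_eq[OF M(2)] by (auto simp: bounded_lip_def)
qed

lemma wdist_triangle: "wdist x y \<le> wdist x z + wdist z y"
  unfolding wdist_def sum.distrib[symmetric] distrib_left[symmetric]
  by (intro sum_mono mult_left_mono less_imp_le[OF w_pos]) simp_all

lemma wdist_commute: "wdist x y = wdist y x"
  by (simp add: wdist_def abs_minus_commute)

text \<open>
  Indicators of lower boxes, which form a generator stable under intersection, are decreasing limits of
  the Lipschitz functions \<open>max 0 (1 - k * g)\<close>, where \<open>g\<close> is the weighted excess over the box.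
\<close>

lemma bounded_lip_determines:
  assumes \<mu>: "\<mu> \<in> prob_measures L n" and \<nu>: "\<nu> \<in> prob_measures L n"
    and eq: "\<And>C h. bounded_lip C h \<Longrightarrow> (\<integral>x. h x \<partial>\<mu>) = (\<integral>x. h x \<partial>\<nu>)"
  shows "\<mu> = \<nu>"
proof (rule measure_eqI_generator_eq[where \<Omega> = "space E" and E = "range (lower_box L n)" and A = "\<lambda>m. lower_box L n (\<lambda>_. real m)"])
  have lower_box_Int: "lower_box L n a \<inter> lower_box L n b = lower_box L n (\<lambda>p. min (a p) (b p))" for a b
    by (auto simp: lower_box_def)
  show "Int_stable (range (lower_box L n))"
    by (auto simp: Int_stable_def lower_box_Int)
  show "range (lower_box L n) \<subseteq> Pow (space E)" by (auto simp: lower_box_def)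
  show "sets \<mu> = sigma_sets (space E) (range (lower_box L n))" "sets \<nu> = sigma_sets (space E) (range (lower_box L n))"
    using \<mu> \<nu> by (auto simp: prob_measures_def sets_state_space_lower_box)
  show "range (\<lambda>m. lower_box L n (\<lambda>_. real m)) \<subseteq> range (lower_box L n)" by auto
  interpret \<mu>: prob_space \<mu> using \<mu> by (simp add: prob_measures_def)
  interpret \<nu>: prob_space \<nu> using \<nu> by (simp add: prob_measures_def)
  show "emeasure \<mu> (lower_box L n (\<lambda>_. real m)) \<noteq> \<infinity>" for m by simp
  show "(\<Union>m. lower_box L n (\<lambda>_. real m)) = space E"
  proof safe
    fix x assume x: "x \<in> space E"
    obtain m :: nat where "\<forall>q\<in>coords L n. x q \<le> m" using ex_coords_bound by blast
    then show "x \<in> (\<Union>m. lower_box L n (\<lambda>_. real m))" using x by (auto simp: lower_box_def)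
  qed (auto simp: lower_box_def)
  fix X assume "X \<in> range (lower_box L n)"
  then obtain a where X: "X = lower_box L n a" by auto
  define g where "g = (\<lambda>x. \<Sum>p\<in>coords L n. w p * max 0 (x p - a p))"
  define h where "h = (\<lambda>k x. max 0 (1 - real k * g x))"
  have g_nonneg: "0 \<le> g x" for x
    unfolding g_def by (intro sum_nonneg mult_nonneg_nonneg less_imp_le[OF w_pos]) auto
  have g_meas: "g \<in> borel_measurable E"
    unfolding g_def[abs_def]
    by (intro borel_measurable_sum borel_measurable_times borel_measurable_const borel_measurable_max borel_measurable_diff component_measurable) auto
  have g_lip: "\<bar>g x - g y\<bar> \<le> wdist x y" for x y
  proof -
    have "\<bar>g x - g y\<bar> \<le> (\<Sum>p\<in>coords L n. \<bar>w p * max 0 (x p - a p) - w p * max 0 (y p - a p)\<bar>)"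
      unfolding g_def sum_subtractf[symmetric] by (rule sum_abs)
    also have "\<dots> \<le> wdist x y"
      unfolding wdist_def
    proof (rule sum_mono)
      fix p assume "p \<in> coords L n"
      then have wp: "0 \<le> w p" by (intro less_imp_le[OF w_pos])
      have "\<bar>w p * max 0 (x p - a p) - w p * max 0 (y p - a p)\<bar> = w p * \<bar>max 0 (x p - a p) - max 0 (y p - a p)\<bar>"
        using wp by (simp add: right_diff_distrib[symmetric] abs_mult)
      also have "\<dots> \<le> w p * \<bar>x p - y p\<bar>" using wp by (intro mult_left_mono) auto
      finally show "\<bar>w p * max 0 (x p - a p) - w p * max 0 (y p - a p)\<bar> \<le> w p * \<bar>x p - y p\<bar>" .
    qed
    finally show ?thesis .
  qed
  have hl: "bounded_lip (real k) (h k)" for k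
  proof -
    have "\<bar>h k x - h k y\<bar> \<le> real k * wdist x y" for x y
    proof -
      have "\<bar>h k x - h k y\<bar> \<le> \<bar>real k * g x - real k * g y\<bar>" unfolding h_def by auto
      also have "\<dots> = real k * \<bar>g x - g y\<bar>" by (simp add: right_diff_distrib[symmetric] abs_mult)
      also have "\<dots> \<le> real k * wdist x y" by (intro mult_left_mono g_lip) auto
      finally show ?thesis .
    qed
    moreover have "h k \<in> borel_measurable E" unfolding h_def[abs_def] using g_meas by measurable
    moreover have "\<bar>h k x\<bar> \<le> 1" for x using g_nonneg[of x] by (simp add: h_def)
    ultimately show ?thesis unfolding bounded_lip_def by auto
  qed
  have lim: "(\<lambda>k. h k x) \<longlonglongrightarrow> indicator X x" if x: "x \<in> space E" for x
  proof (cases "x \<in> X")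
    case True
    then have "g x = 0" unfolding g_def X lower_box_def by (intro sum.neutral) auto
    then show ?thesis using True by (simp add: h_def)
  next
    case False
    then obtain p where p: "p \<in> coords L n" "a p < x p" using x by (auto simp: X lower_box_def not_le)
    have "0 < w p * max 0 (x p - a p)" using p w_pos[OF p(1)] by simp
    also have "\<dots> \<le> g x" unfolding g_def using p
      by (intro member_le_sum[where f="\<lambda>p. w p * max 0 (x p - a p)"] mult_nonneg_nonneg less_imp_le[OF w_pos]) auto
    finally have "0 < g x" .
    then obtain m :: nat where "1 < real m * g x" by (metis mult.commute reals_Archimedean3)
    have "h k x = 0" if "k \<ge> m" for k
    proof -
      have "real m * g x \<le> real k * g x" using that g_nonneg by (intro mult_right_mono) auto
      with \<open>1 < real m * g x\<close> show ?thesis unfolding h_def by simp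
    qed
    then have "(\<lambda>k. h k x) \<longlonglongrightarrow> 0" by (intro tendsto_eventually) (auto simp: eventually_sequentially)
    then show ?thesis using False by simp
  qed
  have Xm: "X \<in> sets E" unfolding X sets_state_space_lower_box by auto
  have conv: "(\<lambda>k. \<integral>x. h k x \<partial>M) \<longlonglongrightarrow> measure M X" if "M \<in> prob_measures L n" for M
  proof -
    interpret M: prob_space M using that by (simp add: prob_measures_def)
    have sM: "sets M = sets E" using that by (simp add: prob_measures_def)
    note spM = sets_eq_imp_space_eq[OF sM]
    have "(\<lambda>k. \<integral>x. h k x \<partial>M) \<longlonglongrightarrow> (\<integral>x. indicator X x \<partial>M)"
    proof (rule integral_dominated_convergence[where w = "\<lambda>_. 1"])
      show "h k \<in> borel_measurable M" for k using hl[of k] by (simp add: bounded_lip_def measurable_cong_sets[OF sM refl])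
      show "AE x in M. norm (h k x) \<le> 1" for k using hl[of k] spM by (auto simp: bounded_lip_def)
      show "AE x in M. (\<lambda>k. h k x) \<longlonglongrightarrow> indicator X x" using lim spM by auto
    qed (use Xm sM in auto)
    then show ?thesis using Xm sM sets.sets_into_space[OF Xm] spM by (simp add: Int_absorb2)
  qed
  have "measure \<mu> X = measure \<nu> X"
    using conv[OF \<mu>] conv[OF \<nu>] unfolding eq[OF hl] by (rule LIMSEQ_unique)
  then show "emeasure \<mu> X = emeasure \<nu> X"
    by (simp add: \<mu>.emeasure_eq_measure \<nu>.emeasure_eq_measure)
qed

section \<open>Contraction in Wasserstein distance\<close>

lemma evolve_eq: "evolve L n \<alpha> f G t \<mu> = \<mu> \<bind> P.trans t"
  unfolding evolve_def transition_eq[abs_def] ..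

lemma trans_kernel: "P.trans t \<in> E \<rightarrow>\<^sub>M subprob_algebra E"
  by (intro measurable_prob_algebraD) measurable

lemma prob_measuresD:
  assumes "\<mu> \<in> prob_measures L n"
  shows "prob_space \<mu>" "sets \<mu> = sets E" "space \<mu> = space E"
  using assms sets_eq_imp_space_eq[of \<mu> E] by (simp_all add: prob_measures_def)

lemma trans_prob_measures: "x \<in> space E \<Longrightarrow> P.trans t x \<in> prob_measures L n"
  by (simp add: prob_measures_def P.prob_space_trans)

lemma evolve_prob_measures:
  assumes "\<mu> \<in> prob_measures L n" shows "\<mu> \<bind> P.trans t \<in> prob_measures L n"
proof -
  note \<mu> = prob_measuresD[OF assms]
  have k: "P.trans t \<in> \<mu> \<rightarrow>\<^sub>M subprob_algebra E"
    using trans_kernel by (simp add: measurable_cong_sets[OF \<mu>(2) refl])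
  show ?thesis unfolding prob_measures_def
  proof (intro CollectI conjI)
    show "sets (\<mu> \<bind> P.trans t) = sets E"
      by (rule sets_bind[OF _ prob_space.not_empty[OF \<mu>(1)]]) simp
    show "prob_space (\<mu> \<bind> P.trans t)"
      by (rule prob_space.prob_space_bind[OF \<mu>(1) _ k], intro AE_I2 P.prob_space_trans) (simp add: \<mu>(3))
  qed
qed

lemma pair_trans_kernel: "P.pair_trans t \<in> P.pair_E \<rightarrow>\<^sub>M subprob_algebra P.pair_E"
proof -
  interpret Q: pdmp "P.pair_E" "P.pair_C" "P.pair_flow" "P.pair_rate" "P.pair_jump" "(zero, zero)" by (rule P.pdmp_coupled)
  show ?thesis by (intro measurable_prob_algebraD) measurable
qed

text \<open>
  Running the coupled process from a random initial pair transports couplings of \<open>\<mu>\<close> and \<open>\<nu>\<close> to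
  couplings of the evolved laws.
\<close>

lemma coupling_evolve:
  assumes t: "0 \<le> t" and \<gamma>: "\<gamma> \<in> couplings L n \<mu> \<nu>"
  shows "\<gamma> \<bind> P.pair_trans t \<in> couplings L n (\<mu> \<bind> P.trans t) (\<nu> \<bind> P.trans t)"
    and "cost (\<gamma> \<bind> P.pair_trans t) \<le>
       ennreal (exp (- d * t)) * cost \<gamma>"
proof -
  interpret Q: pdmp "P.pair_E" "P.pair_C" "P.pair_flow" "P.pair_rate" "P.pair_jump" "(zero, zero)" by (rule P.pdmp_coupled)
  have g: "prob_space \<gamma>" "sets \<gamma> = sets P.pair_E" "distr \<gamma> E fst = \<mu>" "distr \<gamma> E snd = \<nu>"
    using \<gamma> by (auto simp: couplings_def)
  note sp = sets_eq_imp_space_eq[OF g(2)]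
  have ne: "space \<gamma> \<noteq> {}" using prob_space.not_empty[OF g(1)] .
  have k: "P.pair_trans t \<in> \<gamma> \<rightarrow>\<^sub>M subprob_algebra P.pair_E"
    using pair_trans_kernel by (simp add: measurable_cong_sets[OF g(2) refl])
  have fm: "fst \<in> \<gamma> \<rightarrow>\<^sub>M E" "snd \<in> \<gamma> \<rightarrow>\<^sub>M E" by (simp_all add: measurable_cong_sets[OF g(2) refl])
  have "distr (\<gamma> \<bind> P.pair_trans t) E fst = \<mu> \<bind> P.trans t"
  proof -
    have "distr (\<gamma> \<bind> P.pair_trans t) E fst = \<gamma> \<bind> (\<lambda>z. distr (P.pair_trans t z) E fst)"
      by (rule distr_bind[OF k ne measurable_fst])
    also have "\<dots> = \<gamma> \<bind> (\<lambda>z. P.trans t (fst z))"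
      using t sp by (intro bind_cong refl P.pair_trans_marginals) auto
    also have "\<dots> = distr \<gamma> E fst \<bind> P.trans t"
      by (rule bind_distr[OF fm(1) trans_kernel ne, symmetric])
    finally show ?thesis using g by simp
  qed
  moreover have "distr (\<gamma> \<bind> P.pair_trans t) E snd = \<nu> \<bind> P.trans t"
  proof -
    have "distr (\<gamma> \<bind> P.pair_trans t) E snd = \<gamma> \<bind> (\<lambda>z. distr (P.pair_trans t z) E snd)"
      by (rule distr_bind[OF k ne measurable_snd])
    also have "\<dots> = \<gamma> \<bind> (\<lambda>z. P.trans t (snd z))"
      using t sp by (intro bind_cong refl P.pair_trans_marginals) auto
    also have "\<dots> = distr \<gamma> E snd \<bind> P.trans t"
      by (rule bind_distr[OF fm(2) trans_kernel ne, symmetric])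
    finally show ?thesis using g by simp
  qed
  moreover have "prob_space (\<gamma> \<bind> P.pair_trans t)"
    using sp by (intro prob_space.prob_space_bind[OF g(1) _ k] AE_I2 Q.prob_space_trans) auto
  moreover have "sets (\<gamma> \<bind> P.pair_trans t) = sets P.pair_E"
    using ne by (subst sets_bind[of _ _ P.pair_E]) auto
  ultimately show "\<gamma> \<bind> P.pair_trans t \<in> couplings L n (\<mu> \<bind> P.trans t) (\<nu> \<bind> P.trans t)"
    by (simp add: couplings_def)
  have wm: "(\<lambda>z. ennreal (wdist (fst z) (snd z))) \<in> borel_measurable P.pair_E" by measurable
  have "cost (\<gamma> \<bind> P.pair_trans t) =
     (\<integral>\<^sup>+z. \<integral>\<^sup>+z'. ennreal (wdist (fst z') (snd z')) \<partial>P.pair_trans t z \<partial>\<gamma>)"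
    by (rule nn_integral_bind[OF wm k])
  also have "\<dots> \<le> (\<integral>\<^sup>+z. ennreal (exp (- d * t)) * ennreal (wdist (fst z) (snd z)) \<partial>\<gamma>)"
  proof (rule nn_integral_mono)
    fix z assume "z \<in> space \<gamma>"
    then have "fst z \<in> space E" "snd z \<in> space E" by (simp_all add: sp space_pair_measure mem_Times_iff)
    from coupled_contraction[OF this t]
    show "(\<integral>\<^sup>+z'. ennreal (wdist (fst z') (snd z')) \<partial>P.pair_trans t z) \<le> ennreal (exp (- d * t)) * ennreal (wdist (fst z) (snd z))"
      by (simp add: ennreal_mult wdist_nonneg)
  qed
  also have "\<dots> = ennreal (exp (- d * t)) * cost \<gamma>"
    using wm by (intro nn_integral_cmult) (simp add: measurable_cong_sets[OF g(2) refl])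
  finally show "cost (\<gamma> \<bind> P.pair_trans t) \<le>
       ennreal (exp (- d * t)) * cost \<gamma>" .
qed

text \<open>
  The constant \<open>M / m\<close> is the price for passing from the unweighted to the weighted distance and back.
\<close>

theorem W1_evolve_le:
  assumes t: "0 \<le> t" and m: "0 < m" "\<And>p. p \<in> coords L n \<Longrightarrow> m \<le> w p" and M: "\<And>p. p \<in> coords L n \<Longrightarrow> w p \<le> M"
    and C: "M / m \<le> C" "0 < C"
  shows "W1 L n (evolve L n \<alpha> f G t \<mu>) (evolve L n \<alpha> f G t \<nu>) \<le> ennreal (C * exp (- d * t)) * W1 L n \<mu> \<nu>"
proof -
  have d1: "dist1 L n x y = (\<Sum>p\<in>coords L n. \<bar>x p - y p\<bar>)" for x y by (simp add: dist1_def sum_coords)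
  have lower: "m * dist1 L n x y \<le> wdist x y" for x y
    unfolding d1 wdist_def sum_distrib_left using m by (intro sum_mono mult_right_mono) auto
  have upper: "wdist x y \<le> M * dist1 L n x y" for x y
    unfolding d1 wdist_def sum_distrib_left using M by (intro sum_mono mult_right_mono) auto
  have dist1_meas: "(\<lambda>z. ennreal (dist1 L n (fst z) (snd z))) \<in> borel_measurable P.pair_E"
    unfolding d1 by (intro measurable_compose[OF _ measurable_ennreal] borel_measurable_sum borel_measurable_abs
       borel_measurable_diff component_measurable) auto
  have *: "W1 L n (evolve L n \<alpha> f G t \<mu>) (evolve L n \<alpha> f G t \<nu>) \<le>
      ennreal (C * exp (- d * t)) * (\<integral>\<^sup>+z. ennreal (dist1 L n (fst z) (snd z)) \<partial>\<gamma>)"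
    if \<gamma>: "\<gamma> \<in> couplings L n \<mu> \<nu>" for \<gamma>
  proof -
    have s: "sets \<gamma> = sets P.pair_E" using \<gamma> by (simp add: couplings_def)
    let ?\<gamma> = "\<gamma> \<bind> P.pair_trans t"
    have c: "?\<gamma> \<in> couplings L n (evolve L n \<alpha> f G t \<mu>) (evolve L n \<alpha> f G t \<nu>)"
      unfolding evolve_eq by (rule coupling_evolve[OF t \<gamma>])
    have s': "sets ?\<gamma> = sets P.pair_E" using c by (simp add: couplings_def)
    have "W1 L n (evolve L n \<alpha> f G t \<mu>) (evolve L n \<alpha> f G t \<nu>) \<le> (\<integral>\<^sup>+z. ennreal (dist1 L n (fst z) (snd z)) \<partial>?\<gamma>)"
      unfolding W1_def using c by (intro INF_lower2[OF c]) (simp add: split_beta')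
    also have "\<dots> \<le> (\<integral>\<^sup>+z. ennreal (1 / m) * ennreal (wdist (fst z) (snd z)) \<partial>?\<gamma>)"
      using lower m by (intro nn_integral_mono) (auto simp: ennreal_mult[symmetric] wdist_nonneg field_simps intro!: ennreal_leI)
    also have "\<dots> = ennreal (1 / m) * cost ?\<gamma>"
      by (intro nn_integral_cmult) (auto simp: measurable_cong_sets[OF s' refl])
    also have "\<dots> \<le> ennreal (1 / m) * (ennreal (exp (- d * t)) * cost \<gamma>)"
      by (intro mult_left_mono coupling_evolve[OF t \<gamma>]) auto
    also have "\<dots> = (\<integral>\<^sup>+z. ennreal (1 / m * exp (- d * t) * wdist (fst z) (snd z)) \<partial>\<gamma>)"
    proof -
      have wm: "(\<lambda>z. ennreal (wdist (fst z) (snd z))) \<in> borel_measurable \<gamma>"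
        unfolding measurable_cong_sets[OF s refl] by measurable
      have "ennreal (1 / m * exp (- d * t) * wdist (fst z) (snd z)) = ennreal (1 / m) * (ennreal (exp (- d * t)) * ennreal (wdist (fst z) (snd z)))" for z
        using m wdist_nonneg by (simp only: mult.assoc ennreal_mult exp_ge_zero mult_nonneg_nonneg divide_nonneg_pos zero_le_one)
      then show ?thesis using wm by (simp only: nn_integral_cmult borel_measurable_times_ennreal borel_measurable_const)
    qed
    also have "\<dots> \<le> (\<integral>\<^sup>+z. ennreal (C * exp (- d * t)) * ennreal (dist1 L n (fst z) (snd z)) \<partial>\<gamma>)"
    proof (rule nn_integral_mono)
      fix z
      have dn: "0 \<le> dist1 L n (fst z) (snd z)" unfolding d1 by (intro sum_nonneg) auto
      have "1 / m * exp (- d * t) * wdist (fst z) (snd z) \<le> 1 / m * exp (- d * t) * (M * dist1 L n (fst z) (snd z))"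
        using m by (intro mult_left_mono upper) auto
      also have "\<dots> = (M / m) * (exp (- d * t) * dist1 L n (fst z) (snd z))" by simp
      also have "\<dots> \<le> C * (exp (- d * t) * dist1 L n (fst z) (snd z))"
        using C dn by (intro mult_right_mono) auto
      finally show "ennreal (1 / m * exp (- d * t) * wdist (fst z) (snd z)) \<le> ennreal (C * exp (- d * t)) * ennreal (dist1 L n (fst z) (snd z))"
        using C dn by (subst ennreal_mult[symmetric]) (auto intro!: ennreal_leI simp: mult.assoc)
    qed
    also have "\<dots> = ennreal (C * exp (- d * t)) * (\<integral>\<^sup>+z. ennreal (dist1 L n (fst z) (snd z)) \<partial>\<gamma>)"
      using dist1_meas by (intro nn_integral_cmult) (simp add: measurable_cong_sets[OF s refl])
    finally show ?thesis .
  qed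
  define e where "e = C * exp (- d * t)"
  have e: "0 < e" using C by (simp add: e_def)
  let ?W = "W1 L n (evolve L n \<alpha> f G t \<mu>) (evolve L n \<alpha> f G t \<nu>)"
  \<comment> \<open>dividing by \<open>e\<close> first allows to pass to the infimum without a case distinction on infinite values\<close>
  have "ennreal (1 / e) * ?W \<le> W1 L n \<mu> \<nu>"
    unfolding W1_def[of L n \<mu> \<nu>]
  proof (rule INF_greatest)
    fix \<gamma> assume "\<gamma> \<in> couplings L n \<mu> \<nu>"
    from *[OF this] have "ennreal (1 / e) * ?W \<le> ennreal (1 / e) * (ennreal e * (\<integral>\<^sup>+z. ennreal (dist1 L n (fst z) (snd z)) \<partial>\<gamma>))"
      unfolding e_def by (intro mult_left_mono) auto
    also have "\<dots> = (\<integral>\<^sup>+z. ennreal (dist1 L n (fst z) (snd z)) \<partial>\<gamma>)"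
      using e by (simp add: mult.assoc[symmetric] ennreal_mult[symmetric])
    finally show "ennreal (1 / e) * ?W \<le> (\<integral>\<^sup>+(x, y). ennreal (dist1 L n x y) \<partial>\<gamma>)"
      by (simp add: split_beta')
  qed
  then have "ennreal e * (ennreal (1 / e) * ?W) \<le> ennreal e * W1 L n \<mu> \<nu>"
    by (intro mult_left_mono) auto
  moreover have "ennreal e * (ennreal (1 / e) * ?W) = ?W"
    using e by (simp add: mult.assoc[symmetric] ennreal_mult[symmetric])
  ultimately show ?thesis unfolding e_def by (simp only:)
qed

text \<open>
  The semigroup on bounded real functions.
\<close>

definition act :: "((nat \<times> nat \<Rightarrow> real) \<Rightarrow> real) \<Rightarrow> real \<Rightarrow> (nat \<times> nat \<Rightarrow> real) \<Rightarrow> real" where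
  "act h t x = (\<integral>y. h y \<partial>P.trans t x)"

text \<open>
  Dual form of the contraction of the coupled process.
\<close>

lemma act_lip:
  assumes h: "bounded_lip C h" and t: "0 \<le> t"
  shows "bounded_lip (C * exp (- d * t)) (act h t)"
  unfolding bounded_lip_def
proof (intro conjI ballI)
  have hm: "h \<in> borel_measurable E" and C: "0 \<le> C" using h by (auto simp: bounded_lip_def)
  show "0 \<le> C * exp (- d * t)" using C by simp
  show "act h t \<in> borel_measurable E"
    unfolding act_def[abs_def]
    by (rule measurable_compose[OF trans_kernel integral_measurable_subprob_algebra[OF hm]])
  fix x assume x: "x \<in> space E"
  interpret T: prob_space "P.trans t x" using x by (rule P.prob_space_trans)
  have "\<bar>act h t x\<bar> \<le> (\<integral>y. \<bar>h y\<bar> \<partial>P.trans t x)" unfolding act_def by (rule integral_abs_bound)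
  also have "\<dots> \<le> (\<integral>y. 1 \<partial>P.trans t x)"
    using h by (intro integral_mono integrable_abs bounded_lip_integrable[OF h] T.prob_space_axioms) (auto simp: bounded_lip_def)
  finally show "\<bar>act h t x\<bar> \<le> 1" by (simp add: T.prob_space[unfolded P.space_trans])
  fix y assume y: "y \<in> space E"
  interpret Q: pdmp "P.pair_E" "P.pair_C" "P.pair_flow" "P.pair_rate" "P.pair_jump" "(zero, zero)" by (rule P.pdmp_coupled)
  have z: "(x, y) \<in> space P.pair_E" using x y by (simp add: space_pair_measure)
  interpret QT: prob_space "P.pair_trans t (x, y)" using z by (rule Q.prob_space_trans)
  let ?Q = "P.pair_trans t (x, y)"
  have fm: "fst \<in> ?Q \<rightarrow>\<^sub>M E" "snd \<in> ?Q \<rightarrow>\<^sub>M E" by simp_all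
  have hf: "(\<lambda>z. h (fst z)) \<in> borel_measurable ?Q" "(\<lambda>z. h (snd z)) \<in> borel_measurable ?Q"
    using measurable_compose[OF fm(1) hm] measurable_compose[OF fm(2) hm] by auto
  have i: "integrable ?Q (\<lambda>z. h (fst z))" "integrable ?Q (\<lambda>z. h (snd z))"
    using h hf by (auto intro!: QT.integrable_const_bound[where B = 1] AE_I2 simp: bounded_lip_def space_pair_measure)
  have "act h t x = (\<integral>z. h (fst z) \<partial>?Q)"
    unfolding act_def using P.pair_trans_marginals(1)[OF t z] integral_distr[OF fm(1) hm] by simp
  moreover have "act h t y = (\<integral>z. h (snd z) \<partial>?Q)"
    unfolding act_def using P.pair_trans_marginals(2)[OF t z] integral_distr[OF fm(2) hm] by simp
  ultimately have "\<bar>act h t x - act h t y\<bar> = \<bar>\<integral>z. h (fst z) - h (snd z) \<partial>?Q\<bar>" using i by simp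
  also have "\<dots> \<le> (\<integral>z. \<bar>h (fst z) - h (snd z)\<bar> \<partial>?Q)" by (rule integral_abs_bound)
  finally have "ennreal \<bar>act h t x - act h t y\<bar> \<le> ennreal (\<integral>z. \<bar>h (fst z) - h (snd z)\<bar> \<partial>?Q)" by (rule ennreal_leI)
  also have "\<dots> = (\<integral>\<^sup>+z. ennreal \<bar>h (fst z) - h (snd z)\<bar> \<partial>?Q)"
    using i by (intro nn_integral_eq_integral[symmetric] integrable_abs integrable_diff) auto
  also have "\<dots> \<le> (\<integral>\<^sup>+z. ennreal C * ennreal (wdist (fst z) (snd z)) \<partial>?Q)"
    using h C by (intro nn_integral_mono) (auto simp: bounded_lip_def space_pair_measure ennreal_mult[symmetric] wdist_nonneg intro!: ennreal_leI)
  also have "\<dots> = ennreal C * cost ?Q"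
    by (intro nn_integral_cmult) measurable
  also have "\<dots> \<le> ennreal C * ennreal (exp (- d * t) * wdist x y)"
    by (intro mult_left_mono coupled_contraction x y t) auto
  also have "\<dots> = ennreal (C * exp (- d * t) * wdist x y)"
    using C by (simp add: ennreal_mult[symmetric] wdist_nonneg mult.assoc)
  finally show "\<bar>act h t x - act h t y\<bar> \<le> C * exp (- d * t) * wdist x y"
    using C wdist_nonneg by (subst (asm) ennreal_le_iff) auto
qed

lemma integral_evolve:
  assumes h: "bounded_lip C h" and \<nu>: "\<nu> \<in> prob_measures L n"
  shows "(\<integral>x. h x \<partial>(\<nu> \<bind> P.trans t)) = (\<integral>x. act h t x \<partial>\<nu>)"
  unfolding act_def
proof (rule integral_bind[where K = E and B = 1 and B' = 1])
  note \<nu>' = prob_measuresD[OF \<nu>]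
  show "P.trans t \<in> \<nu> \<rightarrow>\<^sub>M subprob_algebra E"
    using trans_kernel by (simp add: measurable_cong_sets[OF \<nu>'(2) refl])
  show "finite_measure \<nu>" using \<nu>'(1) by (rule prob_space.finite_measure)
  show "h \<in> borel_measurable E" "\<And>x. x \<in> space E \<Longrightarrow> \<bar>h x\<bar> \<le> 1" using h by (auto simp: bounded_lip_def)
  show "AE x in \<nu>. emeasure (P.trans t x) (space (P.trans t x)) \<le> ennreal 1"
    using \<nu>'(3) by (intro AE_I2) (simp only: prob_space.emeasure_space_1[OF P.prob_space_trans] ennreal_1)
qed

end

section \<open>Gluing a sequence of couplings\<close>

lemma measurable_Pair_discrete:
  fixes f :: "'b \<Rightarrow> 'a::countable" and g :: "'b \<Rightarrow> 'c::countable"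
  assumes "f \<in> M \<rightarrow>\<^sub>M count_space UNIV" "g \<in> M \<rightarrow>\<^sub>M count_space UNIV"
  shows "(\<lambda>x. (f x, g x)) \<in> M \<rightarrow>\<^sub>M count_space UNIV"
  using measurable_Pair[OF assms] by (simp add: pair_measure_countable)

lemma pmf_of_distr:
  fixes g :: "'b \<Rightarrow> 'a::countable"
  assumes "prob_space M" and g: "g \<in> M \<rightarrow>\<^sub>M count_space UNIV"
  obtains p where "measure_pmf p = distr M (count_space UNIV) g"
proof -
  interpret M: prob_space M by fact
  define D where "D = distr M (count_space UNIV) g"
  interpret D: prob_space D unfolding D_def by (rule M.prob_space_distr[OF g])
  have sD: "sets D = UNIV" by (simp add: D_def)
  have "(\<Union>x\<in>{x. measure D {x} = 0}. {x}) \<in> null_sets D"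
    by (intro null_sets_UN') (auto simp: null_sets_def sD D.emeasure_eq_measure)
  then have "AE x in D. measure D {x} \<noteq> 0"
    by (rule AE_I') auto
  then have "measure_pmf (Abs_pmf D) = D"
    by (intro Abs_pmf_inverse) (auto simp: sD D.prob_space_axioms)
  then show ?thesis using that unfolding D_def by blast
qed

lemma bind_pmf_disintegrate: "bind_pmf (map_pmf fst q) (\<lambda>a. cond_pmf q {z. fst z = a}) = q"
proof (rule bind_cond_pmf_cancel)
  fix x y assume y: "y \<in> set_pmf q" and xy: "fst y = x"
  show "measure (measure_pmf q) {y. fst y = x} = measure (measure_pmf (map_pmf fst q)) {x. fst y = x}"
    unfolding measure_map_pmf using xy by (intro arg_cong[where f="measure (measure_pmf q)"]) auto
qed auto


text \<open>
  For discrete laws the conditional law of the second component given the first is elementary, so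
  couplings with matching marginals can be composed to a Markov chain; its law on the space of sequences
  is provided by the Ionescu-Tulcea theorem.
\<close>

lemma glue_pmf_sequence:
  fixes p :: "nat \<Rightarrow> ('a::countable \<times> 'a) pmf"
  assumes marg: "\<And>k. map_pmf snd (p k) = map_pmf fst (p (Suc k))"
  obtains \<Omega> :: "(nat \<Rightarrow> 'a) measure" where "prob_space \<Omega>"
    "\<And>k. (\<lambda>\<omega>. \<omega> k) \<in> \<Omega> \<rightarrow>\<^sub>M count_space UNIV"
    "\<And>k F. (\<integral>\<^sup>+\<omega>. F (\<omega> k, \<omega> (Suc k)) \<partial>\<Omega>) = (\<integral>\<^sup>+z. F z \<partial>measure_pmf (p k))"
proof -
  define \<kappa> where "\<kappa> = (\<lambda>k a. map_pmf snd (cond_pmf (p k) {z. fst z = a}))"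
  define P where "P = (\<lambda>i (\<omega>::nat \<Rightarrow> 'a). case i of 0 \<Rightarrow> measure_pmf (map_pmf fst (p 0)) | Suc k \<Rightarrow> measure_pmf (\<kappa> k (\<omega> k)))"
  let ?M = "\<lambda>i::nat. count_space (UNIV :: 'a set)"
  interpret IT: Ionescu_Tulcea P ?M
  proof (rule Ionescu_Tulcea.intro)
    fix i
    show "P i \<in> PiM {0..<i} ?M \<rightarrow>\<^sub>M subprob_algebra (?M i)"
    proof (cases i)
      case 0
      then show ?thesis by (simp add: P_def measure_pmf_in_subprob_algebra)
    next
      case (Suc k)
      have "(\<lambda>a. measure_pmf (\<kappa> k a)) \<in> count_space UNIV \<rightarrow>\<^sub>M subprob_algebra (count_space UNIV)"
        by (simp add: measure_pmf_in_subprob_algebra)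
      then have "(\<lambda>\<omega>. measure_pmf (\<kappa> k (\<omega> k))) \<in> PiM {0..<Suc k} ?M \<rightarrow>\<^sub>M subprob_algebra (count_space UNIV)"
        by (rule measurable_compose[OF measurable_component_singleton, rotated]) auto
      then show ?thesis unfolding P_def Suc by simp
    qed
  next
    fix i :: nat and x assume "x \<in> space (PiM {0..<i} ?M)"
    show "prob_space (P i x)"
      by (cases i) (auto simp: P_def measure_pmf.prob_space_axioms)
  qed
  define c where "c = (\<lambda>m. IT.C 0 m (\<lambda>_. undefined))"
  have undef: "(\<lambda>_. undefined) \<in> space (PiM {0..<0::nat} ?M)" by (simp add: space_PiM)
  have c_prob: "prob_space (c m)" for m
    unfolding c_def by (rule IT.prob_space_C[OF undef])
  have c_sets: "sets (c m) = sets (PiM {0..<m} ?M)" for m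
    using IT.sets_C[OF undef, of m] by (simp add: c_def)
  have c_space: "space (c m) = space (PiM {0..<m} ?M)" for m
    by (rule sets_eq_imp_space_eq[OF c_sets])
  have comp: "(\<lambda>\<omega>. \<omega> k) \<in> PiM {0..<m} ?M \<rightarrow>\<^sub>M count_space UNIV" if "k < m" for k m :: nat
    using that by (intro measurable_component_singleton) auto
  have c_Suc: "(\<integral>\<^sup>+\<omega>. F \<omega> \<partial>c (Suc m)) = (\<integral>\<^sup>+\<omega>. \<integral>\<^sup>+x. F (fun_upd \<omega> m x) \<partial>P m \<omega> \<partial>c m)"
    if F: "F \<in> borel_measurable (PiM {0..<Suc m} ?M)" for F m
  proof -
    have "IT.eP m \<in> c m \<rightarrow>\<^sub>M subprob_algebra (PiM {0..<Suc m} ?M)"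
      unfolding measurable_cong_sets[OF c_sets refl] by (rule IT.measurable_eP)
    then have "(\<integral>\<^sup>+\<omega>. F \<omega> \<partial>(c m \<bind> IT.eP m)) = (\<integral>\<^sup>+\<omega>. \<integral>\<^sup>+\<omega>'. F \<omega>' \<partial>IT.eP m \<omega> \<partial>c m)"
      by (rule nn_integral_bind[OF F])
    moreover have "c (Suc m) = c m \<bind> IT.eP m" by (simp add: c_def)
    moreover have "(\<integral>\<^sup>+\<omega>. \<integral>\<^sup>+\<omega>'. F \<omega>' \<partial>IT.eP m \<omega> \<partial>c m) = (\<integral>\<^sup>+\<omega>. \<integral>\<^sup>+x. F (fun_upd \<omega> m x) \<partial>P m \<omega> \<partial>c m)"
      by (intro nn_integral_cong IT.nn_integral_eP F) (simp only: c_space)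
    ultimately show ?thesis by (simp only:)
  qed
  have law: "(\<integral>\<^sup>+\<omega>. H (\<omega> m) \<partial>c (Suc m)) = (\<integral>\<^sup>+a. H a \<partial>measure_pmf (map_pmf fst (p m)))" for H :: "'a \<Rightarrow> ennreal" and m
  proof (induction m arbitrary: H)
    case 0
    interpret c0: prob_space "c 0" by (rule c_prob)
    have "(\<integral>\<^sup>+\<omega>. H (\<omega> 0) \<partial>c (Suc 0)) = (\<integral>\<^sup>+\<omega>. \<integral>\<^sup>+x. H x \<partial>P 0 \<omega> \<partial>c 0)"
      by (subst c_Suc) (auto intro!: measurable_compose[OF comp])
    then show ?case by (simp add: P_def c0.emeasure_space_1)
  next
    case (Suc k)
    have "(\<integral>\<^sup>+\<omega>. H (\<omega> (Suc k)) \<partial>c (Suc (Suc k))) = (\<integral>\<^sup>+\<omega>. \<integral>\<^sup>+x. H x \<partial>P (Suc k) \<omega> \<partial>c (Suc k))"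
      by (subst c_Suc) (auto intro!: measurable_compose[OF comp])
    also have "\<dots> = (\<integral>\<^sup>+\<omega>. (\<lambda>a. \<integral>\<^sup>+x. H x \<partial>measure_pmf (\<kappa> k a)) (\<omega> k) \<partial>c (Suc k))"
      by (simp add: P_def)
    also have "\<dots> = (\<integral>\<^sup>+a. \<integral>\<^sup>+x. H x \<partial>measure_pmf (\<kappa> k a) \<partial>measure_pmf (map_pmf fst (p k)))"
      by (rule Suc)
    also have "\<dots> = (\<integral>\<^sup>+x. H x \<partial>measure_pmf (bind_pmf (map_pmf fst (p k)) (\<kappa> k)))"
      unfolding nn_integral_bind_pmf ..
    also have "bind_pmf (map_pmf fst (p k)) (\<kappa> k) = map_pmf snd (p k)"
      unfolding \<kappa>_def map_bind_pmf[symmetric] bind_pmf_disintegrate ..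
    finally show ?case by (simp only: marg)
  qed
  have joint: "(\<integral>\<^sup>+\<omega>. F (\<omega> k, \<omega> (Suc k)) \<partial>c (Suc (Suc k))) = (\<integral>\<^sup>+z. F z \<partial>measure_pmf (p k))" for F k
  proof -
    have m: "(\<lambda>\<omega>. F (\<omega> k, \<omega> (Suc k))) \<in> borel_measurable (PiM {0..<Suc (Suc k)} ?M)"
      by (rule measurable_compose[OF measurable_Pair_discrete[OF comp comp]]) simp_all
    have "(\<integral>\<^sup>+\<omega>. F (\<omega> k, \<omega> (Suc k)) \<partial>c (Suc (Suc k))) = (\<integral>\<^sup>+\<omega>. (\<lambda>a. \<integral>\<^sup>+x. F (a, x) \<partial>measure_pmf (\<kappa> k a)) (\<omega> k) \<partial>c (Suc k))"
      by (subst c_Suc[OF m]) (simp add: P_def)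
    also have "\<dots> = (\<integral>\<^sup>+a. \<integral>\<^sup>+x. F (a, x) \<partial>measure_pmf (\<kappa> k a) \<partial>measure_pmf (map_pmf fst (p k)))"
      by (rule law)
    also have "\<dots> = (\<integral>\<^sup>+a. \<integral>\<^sup>+z. F z \<partial>measure_pmf (cond_pmf (p k) {z. fst z = a}) \<partial>measure_pmf (map_pmf fst (p k)))"
    proof (intro nn_integral_cong_AE AE_pmfI)
      fix a assume a: "a \<in> set_pmf (map_pmf fst (p k))"
      then have ne: "set_pmf (p k) \<inter> {z. fst z = a} \<noteq> {}" by auto
      have "(\<integral>\<^sup>+x. F (a, x) \<partial>measure_pmf (\<kappa> k a)) = (\<integral>\<^sup>+z. F (a, snd z) \<partial>measure_pmf (cond_pmf (p k) {z. fst z = a}))"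
        by (simp add: \<kappa>_def)
      also have "\<dots> = (\<integral>\<^sup>+z. F z \<partial>measure_pmf (cond_pmf (p k) {z. fst z = a}))"
        by (intro nn_integral_cong_AE AE_pmfI) (auto simp: set_cond_pmf[OF ne])
      finally show "(\<integral>\<^sup>+x. F (a, x) \<partial>measure_pmf (\<kappa> k a)) = (\<integral>\<^sup>+z. F z \<partial>measure_pmf (cond_pmf (p k) {z. fst z = a}))" .
    qed
    also have "\<dots> = (\<integral>\<^sup>+z. F z \<partial>measure_pmf (p k))"
      unfolding nn_integral_bind_pmf[symmetric] bind_pmf_disintegrate ..
    finally show ?thesis .
  qed
  define \<Omega> where "\<Omega> = IT.PF.lim"
  have sets_\<Omega>: "sets \<Omega> = sets (PiM UNIV ?M)" by (simp add: \<Omega>_def)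
  have restr: "(\<lambda>\<omega>. restrict \<omega> J) \<in> \<Omega> \<rightarrow>\<^sub>M PiM J ?M" for J
    unfolding measurable_cong_sets[OF sets_\<Omega> refl] by (rule measurable_restrict_subset) simp
  have lim_c: "distr \<Omega> (PiM {0..<m} ?M) (\<lambda>\<omega>. restrict \<omega> {0..<m}) = c m" for m
  proof -
    have up: "IT.up_to {0..<m} = m"
      unfolding IT.up_to_def by (rule Least_equality) (auto simp: not_le[symmetric])
    have "distr \<Omega> (PiM {0..<m} ?M) (\<lambda>\<omega>. restrict \<omega> {0..<m}) = IT.CI {0..<m}"
      unfolding \<Omega>_def by (rule IT.distr_lim) simp
    also have "\<dots> = distr (c m) (PiM {0..<m} ?M) (\<lambda>\<omega>. restrict \<omega> {0..<m})"
      unfolding IT.CI_def up c_def ..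
    also have "\<dots> = distr (c m) (c m) (\<lambda>\<omega>. \<omega>)"
      by (rule distr_cong) (auto simp: c_sets c_space space_PiM)
    finally show ?thesis by (simp add: distr_id2)
  qed
  show ?thesis
  proof (rule that[of \<Omega>])
    show "prob_space \<Omega>"
      using c_prob[of 0] restr[of "{0..<0}"] unfolding lim_c[of 0, symmetric] by (rule prob_space_distrD[rotated])
    show "(\<lambda>\<omega>. \<omega> k) \<in> \<Omega> \<rightarrow>\<^sub>M count_space UNIV" for k
      unfolding measurable_cong_sets[OF sets_\<Omega> refl] by (rule measurable_component_singleton) simp
    fix k and F :: "'a \<times> 'a \<Rightarrow> ennreal"
    have m: "(\<lambda>\<omega>. F (\<omega> k, \<omega> (Suc k))) \<in> borel_measurable (PiM {0..<Suc (Suc k)} ?M)"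
      by (rule measurable_compose[OF measurable_Pair_discrete[OF comp comp]]) simp_all
    have "(\<integral>\<^sup>+\<omega>. F (\<omega> k, \<omega> (Suc k)) \<partial>\<Omega>) =
       (\<integral>\<^sup>+\<omega>. (\<lambda>\<omega>. F (\<omega> k, \<omega> (Suc k))) (restrict \<omega> {0..<Suc (Suc k)}) \<partial>\<Omega>)" by simp
    also have "\<dots> = (\<integral>\<^sup>+\<omega>. F (\<omega> k, \<omega> (Suc k)) \<partial>c (Suc (Suc k)))"
      unfolding lim_c[symmetric] by (rule nn_integral_distr[OF restr, symmetric]) (use m in simp)
    finally show "(\<integral>\<^sup>+\<omega>. F (\<omega> k, \<omega> (Suc k)) \<partial>\<Omega>) = (\<integral>\<^sup>+z. F z \<partial>measure_pmf (p k))"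
      by (simp only: joint)
  qed
qed

context network begin

text \<open>
  Rounding down to multiples of \<open>1 / 2 ^ k\<close> makes arbitrary couplings discrete at a geometrically small
  cost. Grid points of all levels are encoded by natural numbers, so that the chain of roundings has
  one countable state space.
\<close>

definition grid :: "nat \<Rightarrow> (nat \<times> nat \<Rightarrow> real) \<Rightarrow> (nat \<times> nat \<Rightarrow> real)" where
  "grid k x = (\<lambda>p\<in>coords L n. real_of_int \<lfloor>2 ^ k * x p\<rfloor> / 2 ^ k)"

definition grids :: "(nat \<times> nat \<Rightarrow> real) set" where
  "grids = (\<Union>k. range (grid k))"

lemma countable_grids: "countable grids"
  unfolding grids_def
proof (rule countable_UN)
  show "countable (UNIV :: nat set)" by simp
  fix k
  have "range (grid k) \<subseteq> (\<Pi>\<^sub>E p\<in>coords L n. range (\<lambda>i::int. real_of_int i / 2 ^ k))"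
    by (auto simp: grid_def)
  moreover have "countable (\<Pi>\<^sub>E p\<in>coords L n. range (\<lambda>i::int. real_of_int i / 2 ^ k))"
    by (intro countable_PiE) auto
  ultimately show "countable (range (grid k))" by (rule countable_subset)
qed

lemma grids_space: "x \<in> grids \<Longrightarrow> x \<in> space E"
  by (auto simp: grids_def grid_def space_state_space)

definition code :: "nat \<Rightarrow> (nat \<times> nat \<Rightarrow> real) \<Rightarrow> nat" where
  "code k x = to_nat_on grids (grid k x)"

definition decode :: "nat \<Rightarrow> (nat \<times> nat \<Rightarrow> real)" where
  "decode i = from_nat_into grids i"

lemma decode_space: "decode i \<in> space E"
  unfolding decode_def by (intro grids_space from_nat_into) (auto simp: grids_def)

lemma decode_code: "decode (code k x) = grid k x"
  unfolding decode_def code_def by (intro from_nat_into_to_nat_on countable_grids) (auto simp: grids_def)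

lemma code_measurable[measurable]: "code k \<in> E \<rightarrow>\<^sub>M count_space UNIV"
proof -
  have "{x \<in> space E. code k x = i} \<in> sets E" for i
  proof (cases "i \<in> to_nat_on grids ` grids")
    case True
    then have i: "to_nat_on grids (decode i) = i" unfolding decode_def
      using countable_grids by (metis (no_types, lifting) image_iff from_nat_into_to_nat_on)
    have "{x \<in> space E. code k x = i} = {x \<in> space E. \<forall>p\<in>coords L n. real_of_int \<lfloor>2 ^ k * x p\<rfloor> / 2 ^ k = decode i p}"
    proof (intro Collect_cong conj_cong refl)
      fix x
      have "code k x = i \<longleftrightarrow> grid k x = decode i"
        using decode_code[of k x] i unfolding code_def by metis
      also have "\<dots> \<longleftrightarrow> (\<forall>p\<in>coords L n. grid k x p = decode i p)"
      proof
        assume "\<forall>p\<in>coords L n. grid k x p = decode i p"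
        then show "grid k x = decode i"
          using decode_space[of i] by (intro extensionalityI[of _ "coords L n"]) (simp_all add: space_state_space grid_def)
      qed simp
      finally show "code k x = i \<longleftrightarrow> (\<forall>p\<in>coords L n. real_of_int \<lfloor>2 ^ k * x p\<rfloor> / 2 ^ k = decode i p)"
        by (simp add: grid_def)
    qed
    also have "\<dots> \<in> sets E"
    proof (rule sets.sets_Collect_finite_All[OF _ finite_coords])
      fix p assume p: "p \<in> coords L n"
      have [measurable]: "(\<lambda>x. x p) \<in> borel_measurable E" using p by (intro component_measurable) auto
      show "{x \<in> space E. real_of_int \<lfloor>2 ^ k * x p\<rfloor> / 2 ^ k = decode i p} \<in> sets E" by measurable
    qed
    finally show ?thesis .
  next
    case False
    then have "{x \<in> space E. code k x = i} = {}" by (auto simp: code_def grids_def)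
    then show ?thesis by (simp only: sets.empty_sets)
  qed
  then show ?thesis
    by (subst measurable_count_space_eq2_countable) (auto simp: vimage_def Int_def conj_commute)
qed

definition total_weight :: real where
  "total_weight = (\<Sum>p\<in>coords L n. w p)"

lemma total_weight_nonneg: "0 \<le> total_weight"
  unfolding total_weight_def by (intro sum_nonneg less_imp_le[OF w_pos])

lemma wdist_grid: "wdist x (grid k x) \<le> total_weight * (1 / 2) ^ k"
proof -
  have "\<bar>x p - grid k x p\<bar> \<le> (1 / 2) ^ k" if "p \<in> coords L n" for p
  proof -
    have "real_of_int \<lfloor>2 ^ k * x p\<rfloor> \<le> 2 ^ k * x p" "2 ^ k * x p \<le> real_of_int \<lfloor>2 ^ k * x p\<rfloor> + 1"
      by (rule of_int_floor_le, rule less_imp_le[OF real_of_int_floor_add_one_gt])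
    then have "\<bar>2 ^ k * x p - real_of_int \<lfloor>2 ^ k * x p\<rfloor>\<bar> \<le> 1" by (simp only: abs_le_iff) linarith
    then have "\<bar>2 ^ k * x p - real_of_int \<lfloor>2 ^ k * x p\<rfloor>\<bar> / 2 ^ k \<le> 1 / 2 ^ k"
      by (intro divide_right_mono) auto
    moreover have "x p - real_of_int \<lfloor>2 ^ k * x p\<rfloor> / 2 ^ k = (2 ^ k * x p - real_of_int \<lfloor>2 ^ k * x p\<rfloor>) / 2 ^ k"
      by (simp add: diff_divide_distrib)
    ultimately show ?thesis using that by (simp add: grid_def power_one_over abs_divide)
  qed
  then show ?thesis
    unfolding wdist_def total_weight_def sum_distrib_right by (intro sum_mono mult_left_mono less_imp_le[OF w_pos])
qed

lemma coupling_pmf: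
  assumes "\<gamma> \<in> couplings L n \<mu> \<nu>"
  obtains p where "measure_pmf p = distr \<gamma> (count_space UNIV) (\<lambda>z. (code k (fst z), code l (snd z)))"
    "measure_pmf (map_pmf fst p) = distr \<mu> (count_space UNIV) (code k)"
    "measure_pmf (map_pmf snd p) = distr \<nu> (count_space UNIV) (code l)"
proof -
  have \<gamma>: "prob_space \<gamma>" "sets \<gamma> = sets P.pair_E" "\<mu> = distr \<gamma> E fst" "\<nu> = distr \<gamma> E snd"
    using assms by (auto simp: couplings_def)
  have m: "(\<lambda>z. (code k (fst z), code l (snd z))) \<in> \<gamma> \<rightarrow>\<^sub>M count_space UNIV"
    unfolding measurable_cong_sets[OF \<gamma>(2) refl] by (rule measurable_Pair_discrete) measurable
  obtain p where p: "measure_pmf p = distr \<gamma> (count_space UNIV) (\<lambda>z. (code k (fst z), code l (snd z)))"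
    using pmf_of_distr[OF \<gamma>(1) m] by blast
  have fm: "fst \<in> \<gamma> \<rightarrow>\<^sub>M E" "snd \<in> \<gamma> \<rightarrow>\<^sub>M E" unfolding measurable_cong_sets[OF \<gamma>(2) refl] by simp_all
  show ?thesis
  proof (rule that[OF p])
    show "measure_pmf (map_pmf fst p) = distr \<mu> (count_space UNIV) (code k)"
      unfolding map_pmf_rep_eq p \<gamma>(3) by (simp add: distr_distr m fm o_def)
    show "measure_pmf (map_pmf snd p) = distr \<nu> (count_space UNIV) (code l)"
      unfolding map_pmf_rep_eq p \<gamma>(4) by (simp add: distr_distr m fm o_def)
  qed
qed

lemma wdist_Cauchy_limit:
  assumes summable: "summable (\<lambda>k. wdist (y k) (y (Suc k)))"
  shows "(\<lambda>k. wdist (y k) (\<lambda>p\<in>coords L n. lim (\<lambda>k. y k p))) \<longlonglongrightarrow> 0"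
proof -
  have conv: "(\<lambda>k. y k p) \<longlonglongrightarrow> lim (\<lambda>k. y k p)" if p: "p \<in> coords L n" for p
  proof -
    have "summable (\<lambda>k. y (Suc k) p - y k p)"
    proof (rule summable_comparison_test'[where N = 0])
      show "summable (\<lambda>k. 1 / w p * wdist (y k) (y (Suc k)))" by (rule summable_mult[OF summable])
      fix k
      have "w p * \<bar>y k p - y (Suc k) p\<bar> \<le> wdist (y k) (y (Suc k))"
        unfolding wdist_def using p
        by (intro member_le_sum[where f="\<lambda>q. w q * \<bar>y k q - y (Suc k) q\<bar>"] mult_nonneg_nonneg less_imp_le[OF w_pos]) auto
      then show "norm (y (Suc k) p - y k p) \<le> 1 / w p * wdist (y k) (y (Suc k))"
        using w_pos[OF p] by (simp add: field_simps abs_minus_commute)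
    qed
    then have "convergent (\<lambda>m. \<Sum>k<m. y (Suc k) p - y k p)" by (simp add: summable_iff_convergent)
    then have "convergent (\<lambda>m. y m p - y 0 p)" by (simp only: sum_lessThan_telescope[of "\<lambda>k. y k p"])
    then have "convergent (\<lambda>m. y m p - y 0 p + y 0 p)" by (intro convergent_add convergent_const)
    then show ?thesis by (simp add: convergent_LIMSEQ_iff)
  qed
  have "(\<lambda>k. \<Sum>p\<in>coords L n. w p * \<bar>y k p - lim (\<lambda>k. y k p)\<bar>) \<longlonglongrightarrow> (\<Sum>p\<in>coords L n. w p * \<bar>lim (\<lambda>k. y k p) - lim (\<lambda>k. y k p)\<bar>)"
    by (intro tendsto_intros conv)
  moreover have "(\<lambda>k. wdist (y k) (\<lambda>p\<in>coords L n. lim (\<lambda>k. y k p))) = (\<lambda>k. \<Sum>p\<in>coords L n. w p * \<bar>y k p - lim (\<lambda>k. y k p)\<bar>)"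
    unfolding wdist_def by (intro ext sum.cong) auto
  ultimately show ?thesis by simp
qed

lemma bounded_lip_tendsto:
  assumes "bounded_lip C h" "\<And>k. y k \<in> space E" "z \<in> space E" "(\<lambda>k. wdist (y k) z) \<longlonglongrightarrow> 0"
  shows "(\<lambda>k. h (y k)) \<longlonglongrightarrow> h z"
proof -
  have "(\<lambda>k. C * wdist (y k) z) \<longlonglongrightarrow> 0" using tendsto_mult[OF tendsto_const assms(4), of C] by simp
  then have "(\<lambda>k. h (y k) - h z) \<longlonglongrightarrow> 0"
  proof (rule Lim_null_comparison[rotated])
    show "\<forall>\<^sub>F k in sequentially. norm (h (y k) - h z) \<le> C * wdist (y k) z"
      using assms(1-3) by (intro always_eventually allI) (simp add: bounded_lip_def)
  qed
  then show ?thesis by (rule LIM_zero_cancel)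
qed

text \<open>
  The part of the completeness of the Wasserstein space that is needed for the existence of an invariant
  measure. The glued chain of rounded states has summable expected increments, hence it converges almost
  surely, and the law of its limit is the limit law.
\<close>

theorem limit_of_couplings:
  assumes \<mu>: "\<And>k. \<mu> k \<in> prob_measures L n" and \<gamma>: "\<And>k. \<gamma> k \<in> couplings L n (\<mu> k) (\<mu> (Suc k))"
    and \<epsilon>: "\<And>k. cost (\<gamma> k) \<le> ennreal (\<epsilon> k)" "\<And>k. 0 \<le> \<epsilon> k" "summable \<epsilon>"
  obtains \<pi> where "\<pi> \<in> prob_measures L n" "\<And>C h. bounded_lip C h \<Longrightarrow> (\<lambda>k. \<integral>x. h x \<partial>\<mu> k) \<longlonglongrightarrow> (\<integral>x. h x \<partial>\<pi>)"
proof -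
  have "\<forall>k. \<exists>p. measure_pmf p = distr (\<gamma> k) (count_space UNIV) (\<lambda>z. (code k (fst z), code (Suc k) (snd z))) \<and>
    measure_pmf (map_pmf fst p) = distr (\<mu> k) (count_space UNIV) (code k) \<and>
    measure_pmf (map_pmf snd p) = distr (\<mu> (Suc k)) (count_space UNIV) (code (Suc k))"
  proof
    fix k
    show "\<exists>p. measure_pmf p = distr (\<gamma> k) (count_space UNIV) (\<lambda>z. (code k (fst z), code (Suc k) (snd z))) \<and>
      measure_pmf (map_pmf fst p) = distr (\<mu> k) (count_space UNIV) (code k) \<and>
      measure_pmf (map_pmf snd p) = distr (\<mu> (Suc k)) (count_space UNIV) (code (Suc k))"
      by (rule coupling_pmf[OF \<gamma>[of k], of k "Suc k"]) blast
  qed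
  then obtain p where p: "\<And>k. measure_pmf (p k) = distr (\<gamma> k) (count_space UNIV) (\<lambda>z. (code k (fst z), code (Suc k) (snd z)))"
    "\<And>k. measure_pmf (map_pmf fst (p k)) = distr (\<mu> k) (count_space UNIV) (code k)"
    "\<And>k. measure_pmf (map_pmf snd (p k)) = distr (\<mu> (Suc k)) (count_space UNIV) (code (Suc k))"
    unfolding choice_iff by blast
  have "map_pmf snd (p k) = map_pmf fst (p (Suc k))" for k
    by (simp only: measure_pmf_inject[symmetric] p)
  from glue_pmf_sequence[of p, OF this]
  obtain \<Omega> :: "(nat \<Rightarrow> nat) measure" where \<Omega>: "prob_space \<Omega>"
    and co: "\<And>k. (\<lambda>\<omega>. \<omega> k) \<in> \<Omega> \<rightarrow>\<^sub>M count_space UNIV"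
    and joint: "\<And>k F. (\<integral>\<^sup>+\<omega>. F (\<omega> k, \<omega> (Suc k)) \<partial>\<Omega>) = (\<integral>\<^sup>+z. F z \<partial>measure_pmf (p k))"
    by blast
  interpret \<Omega>: prob_space \<Omega> by fact
  have law: "distr \<Omega> (count_space UNIV) (\<lambda>\<omega>. \<omega> k) = distr (\<mu> k) (count_space UNIV) (code k)" for k
  proof (rule measure_eqI)
    fix A
    have "emeasure (distr \<Omega> (count_space UNIV) (\<lambda>\<omega>. \<omega> k)) A = (\<integral>\<^sup>+i. indicator A i \<partial>distr \<Omega> (count_space UNIV) (\<lambda>\<omega>. \<omega> k))"
      by simp
    also have "\<dots> = (\<integral>\<^sup>+\<omega>. indicator A (\<omega> k) \<partial>\<Omega>)"
      by (rule nn_integral_distr[OF co]) simp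
    also have "\<dots> = (\<integral>\<^sup>+\<omega>. (\<lambda>z. indicator A (fst z)) (\<omega> k, \<omega> (Suc k)) \<partial>\<Omega>)" by simp
    also have "\<dots> = (\<integral>\<^sup>+z. indicator A (fst z) \<partial>measure_pmf (p k))" by (rule joint)
    also have "\<dots> = (\<integral>\<^sup>+i. indicator A i \<partial>measure_pmf (map_pmf fst (p k)))" by simp
    also have "\<dots> = emeasure (measure_pmf (map_pmf fst (p k))) A" by (rule nn_integral_indicator) simp
    finally show "emeasure (distr \<Omega> (count_space UNIV) (\<lambda>\<omega>. \<omega> k)) A = emeasure (distr (\<mu> k) (count_space UNIV) (code k)) A"
      unfolding p .
  qed simp
  define Y where "Y = (\<lambda>k (\<omega>::nat \<Rightarrow> nat). decode (\<omega> k))"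
  have Y_space: "Y k \<omega> \<in> space E" for k \<omega> by (simp add: Y_def decode_space)
  have Y_meas: "(\<lambda>\<omega>. H (Y k \<omega>)) \<in> borel_measurable \<Omega>" for k and H :: "_ \<Rightarrow> real"
    unfolding Y_def by (rule measurable_compose[OF co]) simp
  have wY_meas: "(\<lambda>\<omega>. ennreal (wdist (Y k \<omega>) (Y (Suc k) \<omega>))) \<in> borel_measurable \<Omega>" for k
  proof -
    have m: "(\<lambda>\<omega>. (\<omega> k, \<omega> (Suc k))) \<in> \<Omega> \<rightarrow>\<^sub>M count_space UNIV"
      by (rule measurable_Pair_discrete[OF co co])
    have "(\<lambda>\<omega>. (\<lambda>z. ennreal (wdist (decode (fst z)) (decode (snd z)))) (\<omega> k, \<omega> (Suc k))) \<in> borel_measurable \<Omega>"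
      by (rule measurable_compose[OF m]) simp
    then show ?thesis by (simp add: Y_def)
  qed
  define \<delta> where "\<delta> = (\<lambda>k. \<epsilon> k + 2 * total_weight * (1 / 2) ^ k)"
  have \<delta>: "summable \<delta>" "0 \<le> \<delta> k" for k
    unfolding \<delta>_def using \<epsilon> total_weight_nonneg by (auto intro!: summable_add summable_mult summable_geometric)
  have increment: "(\<integral>\<^sup>+\<omega>. ennreal (wdist (Y k \<omega>) (Y (Suc k) \<omega>)) \<partial>\<Omega>) \<le> ennreal (\<delta> k)" for k
  proof -
    have s: "sets (\<gamma> k) = sets P.pair_E" and pr: "prob_space (\<gamma> k)" using \<gamma>[of k] by (auto simp: couplings_def)
    interpret \<gamma>k: prob_space "\<gamma> k" by (rule pr)
    have m: "(\<lambda>z. (code k (fst z), code (Suc k) (snd z))) \<in> \<gamma> k \<rightarrow>\<^sub>M count_space UNIV"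
      unfolding measurable_cong_sets[OF s refl] by (rule measurable_Pair_discrete) measurable
    have wm: "(\<lambda>z. ennreal (wdist (fst z) (snd z))) \<in> borel_measurable (\<gamma> k)"
      unfolding measurable_cong_sets[OF s refl] by measurable
    have "(\<integral>\<^sup>+\<omega>. ennreal (wdist (Y k \<omega>) (Y (Suc k) \<omega>)) \<partial>\<Omega>) =
       (\<integral>\<^sup>+z. ennreal (wdist (decode (fst z)) (decode (snd z))) \<partial>measure_pmf (p k))"
      using joint[of "\<lambda>z. ennreal (wdist (decode (fst z)) (decode (snd z)))" k] by (simp add: Y_def)
    also have "\<dots> = (\<integral>\<^sup>+z. ennreal (wdist (grid k (fst z)) (grid (Suc k) (snd z))) \<partial>\<gamma> k)"
      unfolding p(1) by (subst nn_integral_distr[OF m]) (simp_all add: decode_code)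
    also have "\<dots> \<le> (\<integral>\<^sup>+z. ennreal (wdist (fst z) (snd z)) + ennreal (2 * total_weight * (1 / 2) ^ k) \<partial>\<gamma> k)"
    proof (rule nn_integral_mono)
      fix z
      have "wdist (grid k (fst z)) (grid (Suc k) (snd z)) \<le> wdist (grid k (fst z)) (fst z) + (wdist (fst z) (snd z) + wdist (snd z) (grid (Suc k) (snd z)))"
        using wdist_triangle[of "grid k (fst z)" "grid (Suc k) (snd z)" "fst z"] wdist_triangle[of "fst z" "grid (Suc k) (snd z)" "snd z"] by linarith
      also have "\<dots> \<le> total_weight * (1 / 2) ^ k + (wdist (fst z) (snd z) + total_weight * (1 / 2) ^ k)"
      proof (intro add_mono order_refl)
        show "wdist (grid k (fst z)) (fst z) \<le> total_weight * (1 / 2) ^ k" by (subst wdist_commute) (rule wdist_grid)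
        have "wdist (snd z) (grid (Suc k) (snd z)) \<le> total_weight * (1 / 2) ^ Suc k" by (rule wdist_grid)
        also have "\<dots> \<le> total_weight * (1 / 2) ^ k" using total_weight_nonneg by (intro mult_left_mono) auto
        finally show "wdist (snd z) (grid (Suc k) (snd z)) \<le> total_weight * (1 / 2) ^ k" .
      qed
      finally have "wdist (grid k (fst z)) (grid (Suc k) (snd z)) \<le> wdist (fst z) (snd z) + 2 * total_weight * (1 / 2) ^ k" by simp
      then have "ennreal (wdist (grid k (fst z)) (grid (Suc k) (snd z))) \<le> ennreal (wdist (fst z) (snd z) + 2 * total_weight * (1 / 2) ^ k)"
        by (rule ennreal_leI)
      also have "\<dots> = ennreal (wdist (fst z) (snd z)) + ennreal (2 * total_weight * (1 / 2) ^ k)"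
        using total_weight_nonneg by (intro ennreal_plus wdist_nonneg mult_nonneg_nonneg) auto
      finally show "ennreal (wdist (grid k (fst z)) (grid (Suc k) (snd z))) \<le> ennreal (wdist (fst z) (snd z)) + ennreal (2 * total_weight * (1 / 2) ^ k)" .
    qed
    also have "\<dots> = cost (\<gamma> k) + ennreal (2 * total_weight * (1 / 2) ^ k)"
      using wm by (subst nn_integral_add) (simp_all add: \<gamma>k.emeasure_space_1)
    also have "\<dots> \<le> ennreal (\<epsilon> k) + ennreal (2 * total_weight * (1 / 2) ^ k)" by (intro add_mono \<epsilon> order_refl)
    also have "\<dots> = ennreal (\<delta> k)" unfolding \<delta>_def using \<epsilon> total_weight_nonneg by (subst ennreal_plus[symmetric]) auto
    finally show ?thesis .
  qed
  \<comment> \<open>a nonnegative series with finite expectation converges almost surely\<close>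
  have AE: "AE \<omega> in \<Omega>. summable (\<lambda>k. wdist (Y k \<omega>) (Y (Suc k) \<omega>))"
  proof -
    have "(\<integral>\<^sup>+\<omega>. (\<Sum>k. ennreal (wdist (Y k \<omega>) (Y (Suc k) \<omega>))) \<partial>\<Omega>) = (\<Sum>k. \<integral>\<^sup>+\<omega>. ennreal (wdist (Y k \<omega>) (Y (Suc k) \<omega>)) \<partial>\<Omega>)"
      by (rule nn_integral_suminf[OF wY_meas])
    also have "\<dots> \<le> (\<Sum>k. ennreal (\<delta> k))" by (intro suminf_le increment) auto
    also have "\<dots> = ennreal (\<Sum>k. \<delta> k)" using \<delta> by (intro suminf_ennreal2) auto
    finally have "(\<integral>\<^sup>+\<omega>. (\<Sum>k. ennreal (wdist (Y k \<omega>) (Y (Suc k) \<omega>))) \<partial>\<Omega>) \<noteq> \<infinity>"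
      by (metis ennreal_less_top infinity_ennreal_def less_top neq_top_trans top.not_eq_extremum)
    then have "AE \<omega> in \<Omega>. (\<Sum>k. ennreal (wdist (Y k \<omega>) (Y (Suc k) \<omega>))) \<noteq> \<infinity>"
      by (intro nn_integral_noteq_infinite borel_measurable_suminf_order wY_meas)
    then show ?thesis
      by eventually_elim (rule summable_suminf_not_top, auto simp: wdist_nonneg)
  qed
  define Z where "Z = (\<lambda>\<omega>. \<lambda>p\<in>coords L n. lim (\<lambda>k. Y k \<omega> p))"
  have Z_space: "Z \<omega> \<in> space E" for \<omega> by (simp add: Z_def space_state_space)
  have Z_meas: "Z \<in> \<Omega> \<rightarrow>\<^sub>M E"
    unfolding Z_def state_space_def
    by (rule measurable_restrict, rule borel_measurable_lim_metric) (rule Y_meas)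
  have YZ: "AE \<omega> in \<Omega>. (\<lambda>k. wdist (Y k \<omega>) (Z \<omega>)) \<longlonglongrightarrow> 0"
    using AE by eventually_elim (unfold Z_def, rule wdist_Cauchy_limit)
  show ?thesis
  proof (rule that[of "distr \<Omega> E Z"])
    show "distr \<Omega> E Z \<in> prob_measures L n"
      by (simp add: prob_measures_def \<Omega>.prob_space_distr[OF Z_meas])
    fix C h assume h: "bounded_lip C h"
    then have hm: "h \<in> borel_measurable E" and C: "0 \<le> C" by (auto simp: bounded_lip_def)
    have 1: "(\<lambda>k. \<integral>\<omega>. h (Y k \<omega>) \<partial>\<Omega>) \<longlonglongrightarrow> (\<integral>\<omega>. h (Z \<omega>) \<partial>\<Omega>)"
    proof (rule integral_dominated_convergence[where w = "\<lambda>_. 1"])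
      show "(\<lambda>\<omega>. h (Z \<omega>)) \<in> borel_measurable \<Omega>" by (rule measurable_compose[OF Z_meas hm])
      show "(\<lambda>\<omega>. h (Y k \<omega>)) \<in> borel_measurable \<Omega>" for k by (rule Y_meas)
      show "AE \<omega> in \<Omega>. (\<lambda>k. h (Y k \<omega>)) \<longlonglongrightarrow> h (Z \<omega>)"
        using YZ by eventually_elim (rule bounded_lip_tendsto[OF h Y_space Z_space])
      show "AE \<omega> in \<Omega>. norm (h (Y k \<omega>)) \<le> 1" for k using h Y_space by (auto simp: bounded_lip_def)
    qed simp
    have 2: "(\<integral>\<omega>. h (Z \<omega>) \<partial>\<Omega>) = (\<integral>x. h x \<partial>distr \<Omega> E Z)"
      by (rule integral_distr[OF Z_meas hm, symmetric])
    have 3: "\<bar>(\<integral>x. h x \<partial>\<mu> k) - (\<integral>\<omega>. h (Y k \<omega>) \<partial>\<Omega>)\<bar> \<le> C * total_weight * (1 / 2) ^ k" for k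
    proof -
      note \<mu>k = prob_measuresD[OF \<mu>[of k]]
      interpret \<mu>k: prob_space "\<mu> k" by (rule \<mu>k)
      have cm: "code k \<in> \<mu> k \<rightarrow>\<^sub>M count_space UNIV"
        unfolding measurable_cong_sets[OF \<mu>k(2) refl] by (rule code_measurable)
      have "(\<integral>\<omega>. h (Y k \<omega>) \<partial>\<Omega>) = (\<integral>i. h (decode i) \<partial>distr \<Omega> (count_space UNIV) (\<lambda>\<omega>. \<omega> k))"
        unfolding Y_def by (rule integral_distr[OF co, symmetric]) simp
      also have "\<dots> = (\<integral>x. h (decode (code k x)) \<partial>\<mu> k)"
        unfolding law by (rule integral_distr[OF cm]) simp
      finally have e: "(\<integral>\<omega>. h (Y k \<omega>) \<partial>\<Omega>) = (\<integral>x. h (grid k x) \<partial>\<mu> k)" by (simp add: decode_code)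
      have gsp: "grid k x \<in> space E" for x by (simp add: grid_def space_state_space)
      have i1: "integrable (\<mu> k) h" using h \<mu>k by (intro bounded_lip_integrable)
      have i2: "integrable (\<mu> k) (\<lambda>x. h (grid k x))"
      proof (rule \<mu>k.integrable_const_bound[where B = 1])
        show "AE x in \<mu> k. norm (h (grid k x)) \<le> 1" using h gsp by (auto simp: bounded_lip_def)
        have "(\<lambda>x. h (decode (code k x))) \<in> borel_measurable (\<mu> k)" by (rule measurable_compose[OF cm]) simp
        then show "(\<lambda>x. h (grid k x)) \<in> borel_measurable (\<mu> k)" by (simp add: decode_code)
      qed
      have "\<bar>(\<integral>x. h x \<partial>\<mu> k) - (\<integral>x. h (grid k x) \<partial>\<mu> k)\<bar> = \<bar>\<integral>x. h x - h (grid k x) \<partial>\<mu> k\<bar>"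
        using i1 i2 by simp
      also have "\<dots> \<le> (\<integral>x. \<bar>h x - h (grid k x)\<bar> \<partial>\<mu> k)" by (rule integral_abs_bound)
      also have "\<dots> \<le> (\<integral>x. C * total_weight * (1 / 2) ^ k \<partial>\<mu> k)"
      proof (rule integral_mono)
        show "integrable (\<mu> k) (\<lambda>x. \<bar>h x - h (grid k x)\<bar>)" by (intro integrable_abs Bochner_Integration.integrable_diff i1 i2)
        fix x assume "x \<in> space (\<mu> k)"
        then have "\<bar>h x - h (grid k x)\<bar> \<le> C * wdist x (grid k x)"
          using h gsp[of x] unfolding \<mu>k(3) bounded_lip_def by blast
        also have "\<dots> \<le> C * (total_weight * (1 / 2) ^ k)" by (intro mult_left_mono wdist_grid C)
        finally show "\<bar>h x - h (grid k x)\<bar> \<le> C * total_weight * (1 / 2) ^ k" by (simp only: mult.assoc)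
      qed simp
      also have "\<dots> = C * total_weight * (1 / 2) ^ k" by (simp add: \<mu>k.prob_space)
      finally show ?thesis unfolding e .
    qed
    have "(\<lambda>k. C * total_weight * (1 / 2) ^ k) \<longlonglongrightarrow> 0"
      using tendsto_mult[OF tendsto_const LIMSEQ_power_zero, of "1 / 2 :: real" "C * total_weight"] by simp
    then have "(\<lambda>k. (\<integral>x. h x \<partial>\<mu> k) - (\<integral>\<omega>. h (Y k \<omega>) \<partial>\<Omega>)) \<longlonglongrightarrow> 0"
    proof (rule Lim_null_comparison[rotated])
      show "\<forall>\<^sub>F k in sequentially. norm ((\<integral>x. h x \<partial>\<mu> k) - (\<integral>\<omega>. h (Y k \<omega>) \<partial>\<Omega>)) \<le> C * total_weight * (1 / 2) ^ k"
        using 3 by (intro always_eventually allI) (simp only: real_norm_def)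
    qed
    from tendsto_add[OF this 1] show "(\<lambda>k. \<integral>x. h x \<partial>\<mu> k) \<longlonglongrightarrow> (\<integral>x. h x \<partial>distr \<Omega> E Z)"
      unfolding 2 by simp
  qed
qed

section \<open>The invariant measure\<close>

lemma act_add:
  assumes h: "bounded_lip C h" and x: "x \<in> space E" and "0 \<le> s" "0 \<le> t"
  shows "act h (s + t) x = (\<integral>y. act h t y \<partial>P.trans s x)"
proof -
  have "act h (s + t) x = (\<integral>y. h y \<partial>(P.trans s x \<bind> P.trans t))"
    unfolding act_def P.trans_add[OF assms(3,4) x] ..
  also have "\<dots> = (\<integral>y. act h t y \<partial>P.trans s x)"
    by (rule integral_evolve[OF h trans_prob_measures[OF x]])
  finally show ?thesis .
qed

text \<open>
  Dominated convergence instead of a Wasserstein bound, so that \<open>\<nu>\<close> may have infinite distance from the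
  point mass at \<open>0\<close>; this is what makes the invariant measure unique among all probability measures.
\<close>

lemma act_forget:
  assumes d: "0 < d" and h: "bounded_lip C h" and \<nu>: "\<nu> \<in> prob_measures L n"
  shows "(\<lambda>k. (\<integral>x. act h (real k) x \<partial>\<nu>) - act h (real k) zero) \<longlonglongrightarrow> 0"
proof -
  note \<nu>' = prob_measuresD[OF \<nu>]
  interpret \<nu>: prob_space \<nu> by (rule \<nu>')
  have l: "bounded_lip (C * exp (- d * real k)) (act h (real k))" for k by (rule act_lip[OF h]) simp
  have C: "0 \<le> C" using h by (simp add: bounded_lip_def)
  have "(\<lambda>k. \<integral>x. act h (real k) x - act h (real k) zero \<partial>\<nu>) \<longlonglongrightarrow> (\<integral>x. 0 \<partial>\<nu>)"
  proof (rule integral_dominated_convergence[where w = "\<lambda>_. 2"])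
    show "(\<lambda>x. act h (real k) x - act h (real k) zero) \<in> borel_measurable \<nu>" for k
      using l[of k] unfolding measurable_cong_sets[OF \<nu>'(2) refl] bounded_lip_def
      by (intro borel_measurable_diff borel_measurable_const) blast
    show "AE x in \<nu>. norm (act h (real k) x - act h (real k) zero) \<le> 2" for k
    proof (rule AE_I2)
      fix x assume "x \<in> space \<nu>"
      then have "\<bar>act h (real k) x\<bar> \<le> 1" "\<bar>act h (real k) zero\<bar> \<le> 1" using l[of k] zero_space \<nu>'(3) by (auto simp: bounded_lip_def)
      then show "norm (act h (real k) x - act h (real k) zero) \<le> 2" by simp
    qed
    show "AE x in \<nu>. (\<lambda>k. act h (real k) x - act h (real k) zero) \<longlonglongrightarrow> 0"
    proof (rule AE_I2)
      fix x assume "x \<in> space \<nu>"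
      then have x: "x \<in> space E" using \<nu>'(3) by simp
      have "(\<lambda>k. (exp (- d)) ^ k) \<longlonglongrightarrow> 0" by (rule LIMSEQ_power_zero) (use d in simp)
      then have "(\<lambda>k. C * (exp (- d)) ^ k * wdist x zero) \<longlonglongrightarrow> C * 0 * wdist x zero"
        by (intro tendsto_mult[OF tendsto_mult[OF tendsto_const] tendsto_const])
      then have lim: "(\<lambda>k. C * (exp (- d)) ^ k * wdist x zero) \<longlonglongrightarrow> 0" by simp
      show "(\<lambda>k. act h (real k) x - act h (real k) zero) \<longlonglongrightarrow> 0"
      proof (rule Lim_null_comparison[OF _ lim], intro always_eventually allI)
        fix k
        have "\<bar>act h (real k) x - act h (real k) zero\<bar> \<le> C * exp (- d * real k) * wdist x zero"
          using l[of k] x zero_space by (simp add: bounded_lip_def)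
        then show "norm (act h (real k) x - act h (real k) zero) \<le> C * (exp (- d)) ^ k * wdist x zero"
          by (simp add: exp_of_nat_mult[symmetric] mult.commute)
      qed
    qed
  qed auto
  moreover have "(\<integral>x. act h (real k) x - act h (real k) zero \<partial>\<nu>) = (\<integral>x. act h (real k) x \<partial>\<nu>) - act h (real k) zero" for k
    using bounded_lip_integrable[OF l \<nu>'(1,2), of k] by (simp add: \<nu>.prob_space)
  ultimately show ?thesis by simp
qed

lemma invariant_limit:
  assumes d: "0 < d" and \<pi>: "invariant_measure L n \<alpha> f G \<pi>" and h: "bounded_lip C h"
  shows "(\<lambda>k. act h (real k) zero) \<longlonglongrightarrow> (\<integral>x. h x \<partial>\<pi>)"
proof -
  have p: "\<pi> \<in> prob_measures L n" and inv: "\<pi> \<bind> P.trans t = \<pi>" if "0 \<le> t" for t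
    using \<pi> that by (auto simp: invariant_measure_def evolve_eq)
  have \<pi>p: "\<pi> \<in> prob_measures L n" using p[of 0] by simp
  have "(\<integral>x. act h (real k) x \<partial>\<pi>) = (\<integral>x. h x \<partial>\<pi>)" for k
    using integral_evolve[OF h \<pi>p, of "real k"] inv[of "real k"] by simp
  then have "(\<lambda>k. (\<integral>x. h x \<partial>\<pi>) - act h (real k) zero) \<longlonglongrightarrow> 0"
    using act_forget[OF d h \<pi>p] by simp
  from tendsto_diff[OF tendsto_const[of "\<integral>x. h x \<partial>\<pi>"] this] show ?thesis by simp
qed

text \<open>
  The product of the point mass at \<open>0\<close> and the law at time \<open>1\<close>, evolved by the coupling for \<open>k\<close> units of
  time, couples the laws at times \<open>k\<close> and \<open>k + 1\<close> at a cost of order \<open>exp (- d * k)\<close>. The law of the limit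
  is invariant since \<open>act h (k + t) zero\<close> is both the average of \<open>act h t\<close> at time \<open>k\<close> and that of
  \<open>act h k\<close> at time \<open>t\<close>.
\<close>

theorem invariant_measure_exists:
  assumes d: "0 < d"
  shows "\<exists>\<pi>. invariant_measure L n \<alpha> f G \<pi>"
proof -
  define \<nu> where "\<nu> = P.trans 1 zero"
  have \<nu>: "\<nu> \<in> prob_measures L n" unfolding \<nu>_def by (rule trans_prob_measures[OF zero_space])
  note \<nu>' = prob_measuresD[OF \<nu>]
  interpret \<nu>: prob_space \<nu> by (rule \<nu>')
  define \<mu> where "\<mu> = (\<lambda>k::nat. P.trans (real k) zero)"
  have \<mu>: "\<mu> k \<in> prob_measures L n" for k unfolding \<mu>_def by (rule trans_prob_measures[OF zero_space])
  define \<gamma>0 where "\<gamma>0 = distr \<nu> P.pair_E (\<lambda>y. (zero, y))"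
  have pm: "(\<lambda>y. (zero, y)) \<in> \<nu> \<rightarrow>\<^sub>M P.pair_E" 
    unfolding measurable_cong_sets[OF \<nu>'(2) refl]
    by (intro measurable_Pair measurable_const[OF zero_space] measurable_ident_sets) simp
  have "\<gamma>0 \<in> couplings L n (return E zero) \<nu>"
    unfolding couplings_def
  proof (intro CollectI conjI)
    show "sets \<gamma>0 = sets P.pair_E" by (simp add: \<gamma>0_def)
    show "prob_space \<gamma>0" unfolding \<gamma>0_def by (rule \<nu>.prob_space_distr[OF pm])
    have "distr \<gamma>0 E fst = distr \<nu> E (\<lambda>y. zero)"
      unfolding \<gamma>0_def by (subst distr_distr[OF _ pm]) (auto simp: o_def)
    also have "\<dots> = return E zero" by (rule \<nu>.distr_const[OF zero_space])
    finally show "distr \<gamma>0 E fst = return E zero" .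
    have "distr \<gamma>0 E snd = distr \<nu> E (\<lambda>y. y)"
      unfolding \<gamma>0_def by (subst distr_distr[OF _ pm]) (auto simp: o_def)
    also have "\<dots> = \<nu>" by (rule distr_id2) (simp add: \<nu>')
    finally show "distr \<gamma>0 E snd = \<nu>" .
  qed
  note c = coupling_evolve[OF _ this]
  define M where "M = enn2real (\<integral>\<^sup>+y. ennreal (wdist zero y) \<partial>\<nu>)"
  have M: "(\<integral>\<^sup>+y. ennreal (wdist zero y) \<partial>\<nu>) = ennreal M"
  proof -
    have "(\<integral>\<^sup>+y. ennreal (wdist zero y) \<partial>\<nu>) \<le> P.nn_act (\<lambda>x. ennreal (1 + wnorm x)) 1 zero"
      unfolding P.nn_act_def \<nu>_def wnorm_def
      by (intro nn_integral_mono ennreal_leI) (simp add: wdist_commute[of zero])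
    also have "\<dots> \<le> P.growth_bound 1 zero"
    proof (rule P.nn_act_le)
      show "(0::real) \<le> 1" by simp
    next
      fix t :: real and x assume tx: "0 \<le> t" "x \<in> space E"
      have "P.first_jump (\<lambda>x. ennreal (1 + wnorm x)) P.growth_bound t x \<le> P.first_jump (\<lambda>x. ennreal (1 + wnorm x)) (\<lambda>t x. 1 + P.growth_bound t x) t x"
        using tx by (intro P.first_jump_mono) (auto intro: add_increasing)
      also have "\<dots> \<le> P.growth_bound t x" using tx by (intro P.first_jump_growth_bound)
      finally show "P.first_jump (\<lambda>x. ennreal (1 + wnorm x)) P.growth_bound t x \<le> P.growth_bound t x" .
    next
      show "(\<lambda>x. ennreal (1 + wnorm x)) \<in> borel_measurable E" by measurable
      show "zero \<in> space E" by (rule zero_space)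
    qed
    also have "\<dots> < \<top>" by (simp add: P.growth_bound_def)
    finally show ?thesis unfolding M_def by simp
  qed
  have M0: "0 \<le> M" by (simp add: M_def)
  have ret: "return E zero \<bind> P.trans t = P.trans t zero" for t
    by (rule bind_return[OF trans_kernel zero_space])
  have nxt: "\<nu> \<bind> P.trans (real k) = P.trans (real (Suc k)) zero" for k
    using P.trans_add[of 1 "real k" zero] zero_space by (simp add: \<nu>_def add.commute)
  obtain \<pi> where \<pi>: "\<pi> \<in> prob_measures L n" and conv: "\<And>C h. bounded_lip C h \<Longrightarrow> (\<lambda>k. \<integral>x. h x \<partial>\<mu> k) \<longlonglongrightarrow> (\<integral>x. h x \<partial>\<pi>)"
  proof (rule limit_of_couplings[of \<mu> "\<lambda>k. \<gamma>0 \<bind> P.pair_trans (real k)" "\<lambda>k. M * (exp (- d)) ^ k"])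
    show "\<mu> k \<in> prob_measures L n" for k by (rule \<mu>)
    show "\<gamma>0 \<bind> P.pair_trans (real k) \<in> couplings L n (\<mu> k) (\<mu> (Suc k))" for k
      using c(1)[of "real k"] unfolding ret nxt \<mu>_def by simp
    show "cost (\<gamma>0 \<bind> P.pair_trans (real k)) \<le> ennreal (M * (exp (- d)) ^ k)" for k
    proof -
      have "cost \<gamma>0 = ennreal M"
        unfolding \<gamma>0_def M[symmetric] by (subst nn_integral_distr[OF pm]) simp_all
      then have "cost (\<gamma>0 \<bind> P.pair_trans (real k)) \<le> ennreal (exp (- d * real k)) * ennreal M"
        using c(2)[of "real k"] by simp
      also have "\<dots> = ennreal (M * (exp (- d)) ^ k)"
        using M0 by (simp add: ennreal_mult[symmetric] exp_of_nat_mult[symmetric] mult.commute)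
      finally show ?thesis .
    qed
    show "0 \<le> M * (exp (- d)) ^ k" for k using M0 by simp
    show "summable (\<lambda>k. M * (exp (- d)) ^ k)" using d by (intro summable_mult summable_geometric) simp
  qed blast
  have conv': "(\<lambda>k. act h (real k) zero) \<longlonglongrightarrow> (\<integral>x. h x \<partial>\<pi>)" if "bounded_lip C h" for C h
    using conv[OF that] by (simp add: \<mu>_def act_def)
  have "\<pi> \<bind> P.trans t = \<pi>" if t: "0 \<le> t" for t
  proof (rule bounded_lip_determines)
    show "\<pi> \<bind> P.trans t \<in> prob_measures L n" by (rule evolve_prob_measures[OF \<pi>])
    show "\<pi> \<in> prob_measures L n" by (rule \<pi>)
    fix C h assume h: "bounded_lip C h"
    have l: "bounded_lip (C * exp (- d * t)) (act h t)" by (rule act_lip[OF h t])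
    have sw: "act (act h t) (real k) zero = (\<integral>y. act h (real k) y \<partial>P.trans t zero)" for k
    proof -
      have "act (act h t) (real k) zero = act h (real k + t) zero"
        unfolding act_add[OF h zero_space of_nat_0_le_iff t] act_def[of "act h t"] ..
      also have "\<dots> = act h (t + real k) zero" by (simp only: add.commute)
      also have "\<dots> = (\<integral>y. act h (real k) y \<partial>P.trans t zero)"
        by (rule act_add[OF h zero_space t of_nat_0_le_iff])
      finally show ?thesis .
    qed
    have "(\<lambda>k. act (act h t) (real k) zero - act h (real k) zero) \<longlonglongrightarrow> 0"
      unfolding sw by (rule act_forget[OF d h trans_prob_measures[OF zero_space]])
    from tendsto_add[OF this conv'[OF h]] have "(\<lambda>k. act (act h t) (real k) zero) \<longlonglongrightarrow> (\<integral>x. h x \<partial>\<pi>)" by simp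
    with conv'[OF l] have "(\<integral>x. act h t x \<partial>\<pi>) = (\<integral>x. h x \<partial>\<pi>)" by (rule LIMSEQ_unique)
    then show "(\<integral>x. h x \<partial>(\<pi> \<bind> P.trans t)) = (\<integral>x. h x \<partial>\<pi>)" by (simp add: integral_evolve[OF h \<pi>])
  qed
  then show ?thesis using \<pi> by (auto simp: invariant_measure_def evolve_eq)
qed

theorem invariant_measure_unique:
  assumes d: "0 < d" and "invariant_measure L n \<alpha> f G \<pi>" "invariant_measure L n \<alpha> f G \<pi>'"
  shows "\<pi> = \<pi>'"
proof (rule bounded_lip_determines)
  show "\<pi> \<in> prob_measures L n" "\<pi>' \<in> prob_measures L n" using assms by (auto simp: invariant_measure_def)
  fix C h assume h: "bounded_lip C h"
  show "(\<integral>x. h x \<partial>\<pi>) = (\<integral>x. h x \<partial>\<pi>')"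
    by (rule LIMSEQ_unique[OF invariant_limit[OF d assms(2) h] invariant_limit[OF d assms(3) h]])
qed

end

section \<open>The contraction rate and the constant\<close>

lemma power_le_max: "0 < x \<Longrightarrow> k \<le> m \<Longrightarrow> x ^ k \<le> max (x ^ m) (1::real)"
  by (cases "x \<le> 1") (auto simp: le_max_iff_disj power_le_one power_increasing)

lemma min_le_power: "0 < x \<Longrightarrow> k \<le> m \<Longrightarrow> min 1 (x ^ m) \<le> (x::real) ^ k"
  by (cases "x \<le> 1") (auto simp: min_le_iff_disj power_decreasing one_le_power)

text \<open>
  It remains to check that the weights \<open>b (k + 1) / \<alpha> i ^ k\<close> satisfy \<open>drift\<close> for the given \<open>d\<close>, the two
  parts of the minimum being responsible for \<open>k = 0\<close> and \<open>k > 0\<close>, and that they lie between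
  \<open>b 1 / max (A ^ N) 1\<close> and \<open>b (N + 1) / min 1 (a ^ (N + 1))\<close>.
\<close>

theorem theorem1:
  fixes L N :: nat
    and n :: "nat \<Rightarrow> nat"
    and \<alpha> b :: "nat \<Rightarrow> real"
    and G :: "(nat \<Rightarrow> real) measure"
    and f :: "real \<Rightarrow> real"
    and K a A bmin C d :: real
  assumes L: "L \<ge> 1"
    and \<alpha>_pos: "\<And>i. i \<in> {1..L} \<Longrightarrow> \<alpha> i > 0"
    and N: "N = Max (n ` {1..L})"
    and a: "a = Min (\<alpha> ` {1..L})"
    and A: "A = Max (\<alpha> ` {1..L})"
    and G: "sets G = sets (mark_space L)" "prob_space G"
    and f_nonneg: "\<And>s. f s \<ge> 0"
    and f_Lipschitz: "K-lipschitz_on UNIV f"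
    and G_moment: "integrable G (\<lambda>c. \<Sum>i=1..L. \<bar>c i\<bar>)"
    and small: "K * (\<integral>c. (\<Sum>i=1..L. 1 / a ^ n i * \<bar>c i\<bar>) \<partial>G) < a"
    and b_nonneg: "\<And>k. k \<in> {0..N+1} \<Longrightarrow> b k \<ge> 0"
    and b_mono: "strict_mono_on {0..N+1} b"
    and b_small: "b (N+1) / b 1 * K * (\<integral>c. (\<Sum>i=1..L. 1 / a ^ n i * \<bar>c i\<bar>) \<partial>G) < a"
    and bmin: "bmin = Min ((\<lambda>k. b (k+1) - b k) ` {0..N})"
    and C: "C = max (A ^ N) 1 / min 1 (a ^ (N+1)) * (b (N+1) / b 1)"
    and d: "d = min (a - K * (b (N+1) / b 1) * (\<integral>c. (\<Sum>i=1..L. 1 / \<alpha> i ^ n i * \<bar>c i\<bar>) \<partial>G))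
                    (a * bmin / b (N+1))"
  shows "(\<forall>\<mu>\<in>prob_measures L n. \<forall>\<nu>\<in>prob_measures L n. \<forall>t\<ge>0.
            W1 L n (evolve L n \<alpha> f G t \<mu>) (evolve L n \<alpha> f G t \<nu>)
              \<le> ennreal (C * exp (- d * t)) * W1 L n \<mu> \<nu>) \<and>
         (\<exists>!\<pi>. invariant_measure L n \<alpha> f G \<pi>) \<and>
         (\<forall>\<pi>. invariant_measure L n \<alpha> f G \<pi> \<longrightarrow>
            (\<forall>\<nu>\<in>prob_measures L n. \<forall>t\<ge>0.
              W1 L n \<pi> (evolve L n \<alpha> f G t \<nu>)
                \<le> ennreal (C * exp (- d * t)) * W1 L n \<pi> \<nu>))"
proof -
  have ne: "{1..L} \<noteq> {}" using L by simp
  have a_le: "a \<le> \<alpha> i" and A_ge: "\<alpha> i \<le> A" and n_le: "n i \<le> N" if "i \<in> {1..L}" for i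
    using that by (auto simp: a A N)
  have a_pos: "0 < a"
    unfolding a using ne \<alpha>_pos by (subst Min_gr_iff) auto
  have A_pos: "0 < A" using a_pos a_le[of 1] A_ge[of 1] L by auto
  have K0: "0 \<le> K" using f_Lipschitz by (rule lipschitz_on_nonneg)
  have b_less: "b j < b k" if "j < k" "k \<le> N + 1" for j k
    using b_mono that by (auto simp: strict_mono_on_def)
  have b_le: "b j \<le> b k" if "j \<le> k" "k \<le> N + 1" for j k
    using b_less[of j k] that by (cases "j = k") auto
  have b1: "0 < b 1" using b_less[of 0 1] b_nonneg[of 0] by simp
  have b_pos: "0 < b (Suc k)" if "k \<le> N" for k using b_le[of 1 "Suc k"] b1 that by simp
  have bN: "0 < b (N + 1)" using b_pos[of N] by simp
  have bmin_le: "bmin \<le> b (k + 1) - b k" if "k \<le> N" for k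
    unfolding bmin using that by (intro Min_le) auto
  have bmin_pos: "0 < bmin"
    unfolding bmin using b_less by (subst Min_gr_iff) auto
  interpret G: prob_space G by (rule G(2))
  have c_meas: "(\<lambda>c. c i) \<in> borel_measurable G" if "i \<in> {1..L}" for i
    unfolding measurable_cong_sets[OF G(1) refl] mark_space_def using that by (rule measurable_component_singleton)
  have c_int: "integrable G (\<lambda>c. \<bar>c i\<bar>)" if i: "i \<in> {1..L}" for i
  proof (rule Bochner_Integration.integrable_bound[OF G_moment])
    show "(\<lambda>c. \<bar>c i\<bar>) \<in> borel_measurable G" by (intro borel_measurable_abs c_meas i)
    show "AE c in G. norm \<bar>c i\<bar> \<le> norm (\<Sum>i=1..L. \<bar>c i\<bar>)"
    proof (rule AE_I2)
      fix c :: "nat \<Rightarrow> real"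
      have "\<bar>c i\<bar> \<le> (\<Sum>i=1..L. \<bar>c i\<bar>)" using i by (intro member_le_sum) auto
      then show "norm \<bar>c i\<bar> \<le> norm (\<Sum>i=1..L. \<bar>c i\<bar>)" by simp
    qed
  qed
  have sum_int: "integrable G (\<lambda>c. \<Sum>i=1..L. v i * \<bar>c i\<bar>)" for v :: "nat \<Rightarrow> real"
    by (intro Bochner_Integration.integrable_sum integrable_mult_right c_int)
  have integral_le: "(\<integral>c. (\<Sum>i=1..L. v i * \<bar>c i\<bar>) \<partial>G) \<le> (\<integral>c. (\<Sum>i=1..L. u i * \<bar>c i\<bar>) \<partial>G)"
    if "\<And>i. i \<in> {1..L} \<Longrightarrow> v i \<le> u i" for v u :: "nat \<Rightarrow> real"
    using that by (intro integral_mono sum_int sum_mono mult_right_mono) auto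
  define I where "I = (\<integral>c. (\<Sum>i=1..L. 1 / \<alpha> i ^ n i * \<bar>c i\<bar>) \<partial>G)"
  define J where "J = (\<integral>c. (\<Sum>i=1..L. 1 / a ^ n i * \<bar>c i\<bar>) \<partial>G)"
  have IJ: "I \<le> J"
    unfolding I_def J_def using a_pos a_le \<alpha>_pos
    by (intro integral_le divide_left_mono power_mono mult_pos_pos zero_less_power) auto
  define w where "w = (\<lambda>p::nat \<times> nat. b (snd p + 1) / \<alpha> (fst p) ^ snd p)"
  define Q where "Q = (\<integral>c. (\<Sum>i=1..L. w (i, n i) * \<bar>c i\<bar>) \<partial>G)"
  have Q_le: "Q \<le> b (N + 1) * I"
  proof -
    have "Q \<le> (\<integral>c. (\<Sum>i=1..L. (b (N + 1) * (1 / \<alpha> i ^ n i)) * \<bar>c i\<bar>) \<partial>G)"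
      unfolding Q_def
    proof (rule integral_le)
      fix i assume i: "i \<in> {1..L}"
      have "b (n i + 1) \<le> b (N + 1)" using n_le[OF i] by (intro b_le) auto
      then show "w (i, n i) \<le> b (N + 1) * (1 / \<alpha> i ^ n i)"
        using \<alpha>_pos[OF i] by (simp add: w_def divide_right_mono)
    qed
    also have "\<dots> = (\<integral>c. b (N + 1) * (\<Sum>i=1..L. 1 / \<alpha> i ^ n i * \<bar>c i\<bar>) \<partial>G)"
      by (simp only: sum_distrib_left mult.assoc)
    also have "\<dots> = b (N + 1) * I" unfolding I_def by (rule integral_mult_right_zero)
    finally show ?thesis .
  qed
  have d1: "d \<le> a - K * (b (N + 1) / b 1) * I" and d2: "d \<le> a * bmin / b (N + 1)"
    unfolding d I_def by auto
  have d_pos: "0 < d"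
  proof -
    have "K * (b (N + 1) / b 1) * I \<le> K * (b (N + 1) / b 1) * J"
      using K0 bN b1 IJ by (intro mult_left_mono mult_nonneg_nonneg) auto
    also have "\<dots> < a" using b_small by (simp add: J_def mult_ac)
    finally have "0 < a - K * (b (N + 1) / b 1) * I" by simp
    moreover have "0 < a * bmin / b (N + 1)" using a_pos bmin_pos bN by simp
    ultimately show ?thesis unfolding d I_def by simp
  qed
  have w_pos: "0 < w p" if "p \<in> coords L n" for p
    using that \<alpha>_pos b_pos n_le by (cases p) (force simp: w_def coords_iff)
  interpret network L n \<alpha> G f K w d
  proof (rule network.intro)
    show "sets G = sets (mark_space L)" by (rule G(1))
    show "prob_space G" by (rule G(2))
    show "0 \<le> f s" for s by (rule f_nonneg)
    show "K-lipschitz_on UNIV f" by (rule f_Lipschitz)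
    show "0 < w p" if "p \<in> coords L n" for p by (rule w_pos[OF that])
    show "integrable G (\<lambda>c. \<Sum>i=1..L. w (i, n i) * \<bar>c i\<bar>)" by (rule sum_int)
    show "0 \<le> d" using d_pos by simp
    fix i k assume ik: "(i, k) \<in> coords L n"
    then have i: "i \<in> {1..L}" and k: "k \<le> N" using n_le by (auto simp: coords_iff intro: order_trans)
    show "(if k = 0 then K * (\<integral>c. (\<Sum>i=1..L. w (i, n i) * \<bar>c i\<bar>) \<partial>G) else w (i, k - 1)) \<le> (\<alpha> i - d) * w (i, k)"
    proof (cases k)
      case 0
      have "K * Q \<le> K * (b (N + 1) * I)" using Q_le K0 by (rule mult_left_mono)
      also have "\<dots> = (K * (b (N + 1) / b 1) * I) * b 1" using b1 by simp
      also have "\<dots> \<le> (\<alpha> i - d) * b 1"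
        using d1 a_le[OF i] b1 by (intro mult_right_mono) auto
      also have "\<dots> = (\<alpha> i - d) * w (i, k)" using 0 by (simp add: w_def)
      finally show ?thesis using 0 unfolding Q_def by (simp only: if_True refl)
    next
      case (Suc j)
      have "d * b (k + 1) \<le> (a * bmin / b (N + 1)) * b (N + 1)"
        using d2 b_le[of "k + 1" "N + 1"] k d_pos b_pos[OF k] a_pos bmin_pos bN by (intro mult_mono) auto
      also have "\<dots> = a * bmin" using bN by simp
      also have "\<dots> \<le> \<alpha> i * (b (k + 1) - b k)"
        using a_le[OF i] bmin_le[OF k] a_pos bmin_pos by (intro mult_mono) auto
      finally have "\<alpha> i * b k \<le> (\<alpha> i - d) * b (k + 1)" by (simp add: algebra_simps)
      then have "\<alpha> i * b k / \<alpha> i ^ k \<le> (\<alpha> i - d) * b (k + 1) / \<alpha> i ^ k"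
        using \<alpha>_pos[OF i] by (intro divide_right_mono) auto
      moreover have "\<alpha> i * b k / \<alpha> i ^ k = w (i, k - 1)"
        using \<alpha>_pos[OF i] Suc by (simp add: w_def)
      ultimately show ?thesis using Suc by (simp add: w_def)
    qed
  qed
  have contract: "W1 L n (evolve L n \<alpha> f G t \<mu>) (evolve L n \<alpha> f G t \<nu>) \<le> ennreal (C * exp (- d * t)) * W1 L n \<mu> \<nu>"
    if t: "0 \<le> t" for t \<mu> \<nu>
  proof (rule W1_evolve_le[OF t, where m = "b 1 / max (A ^ N) 1" and M = "b (N + 1) / min 1 (a ^ (N + 1))"])
    have mx: "0 < max (A ^ N) 1" and mn: "0 < min 1 (a ^ (N + 1))" using a_pos by auto
    show "0 < b 1 / max (A ^ N) 1" using b1 mx by (rule divide_pos_pos)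
    show "(b (N + 1) / min 1 (a ^ (N + 1))) / (b 1 / max (A ^ N) 1) \<le> C"
      unfolding C using b1 mx mn by (simp add: field_simps)
    show "0 < C" unfolding C using mx mn b1 bN by (intro mult_pos_pos divide_pos_pos)
    fix p assume "p \<in> coords L n"
    then obtain i k where p: "p = (i, k)" and i: "i \<in> {1..L}" and k: "k \<le> N"
      using n_le by (cases p) (auto simp: coords_iff intro: order_trans)
    have \<alpha>k: "0 < \<alpha> i ^ k" using \<alpha>_pos[OF i] by simp
    have up: "\<alpha> i ^ k \<le> max (A ^ N) 1"
      using power_mono[OF A_ge[OF i], of k] \<alpha>_pos[OF i] power_le_max[OF A_pos k] by linarith
    have lo: "min 1 (a ^ (N + 1)) \<le> \<alpha> i ^ k"
      using power_mono[OF a_le[OF i], of k] a_pos min_le_power[OF a_pos, of k "N + 1"] k by linarith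
    have "b 1 / max (A ^ N) 1 \<le> b (k + 1) / \<alpha> i ^ k"
      using b_le[of 1 "k + 1"] k b1 up \<alpha>k by (intro frac_le) auto
    then show "b 1 / max (A ^ N) 1 \<le> w p" by (simp add: p w_def)
    have "b (k + 1) / \<alpha> i ^ k \<le> b (N + 1) / min 1 (a ^ (N + 1))"
      using b_le[of "k + 1" "N + 1"] k bN lo mn by (intro frac_le) auto
    then show "w p \<le> b (N + 1) / min 1 (a ^ (N + 1))" by (simp add: p w_def)
  qed
  obtain \<pi>0 where \<pi>0: "invariant_measure L n \<alpha> f G \<pi>0"
    using invariant_measure_exists[OF d_pos] by blast
  show ?thesis
  proof (intro conjI ballI allI impI)
    show "W1 L n (evolve L n \<alpha> f G t \<mu>) (evolve L n \<alpha> f G t \<nu>) \<le> ennreal (C * exp (- d * t)) * W1 L n \<mu> \<nu>"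
      if "0 \<le> t" for \<mu> \<nu> t using that by (rule contract)
    show "\<exists>!\<pi>. invariant_measure L n \<alpha> f G \<pi>"
      using \<pi>0 invariant_measure_unique[OF d_pos] by blast
    fix \<pi> \<nu> and t :: real
    assume \<pi>: "invariant_measure L n \<alpha> f G \<pi>" and t: "0 \<le> t"
    have "evolve L n \<alpha> f G t \<pi> = \<pi>" using \<pi> t by (simp add: invariant_measure_def)
    with contract[OF t, of \<pi> \<nu>] show "W1 L n \<pi> (evolve L n \<alpha> f G t \<nu>) \<le> ennreal (C * exp (- d * t)) * W1 L n \<pi> \<nu>"
      by simp
  qed
qed

end
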